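(* If $\kappa\subseteq X\times Y$ is the support of an $\mathfrak{I}$-injective masa-bimodule, then $\kappa$ is operator synthetic.
   Context: $(X,m)$ and $(Y,n)$ are standard measure spaces ($\sigma$-finite regular Borel measures for Borel structures arising from complete separable metrizable topologies), $H_1=L^2(X,m)$, $H_2=L^2(Y,n)$; $\mathcal{D}_1,\mathcal{D}_2$ are the algebras of multiplication operators by functions in $L^\infty(X,m)$, $L^\infty(Y,n)$; $M_g$ is multiplication by $g$. $\mathcal{B}(H_1,H_2)$ has the weak* topology as the dual of the trace class operators from $H_2$ to $H_1$. A masa-bimodule is a subspace $\mathcal{U}\subseteq\mathcal{B}(H_1,H_2)$ with $\mathcal{D}_2\mathcal{U}\mathcal{D}_1\subseteq\mathcal{U}$. $\mathrm{Ref}\,\mathcal{U}=\{T\in\mathcal{B}(H_1,H_2):Tx\in\overline{\mathcal{U}x}\ \forall x\in H_1\}$. Schur maps: let $\Gamma(X,Y)=L^2(X,m)\hat\otimes L^2(Y,n)$ (projective tensor product), identified with the predual of $\mathcal{B}(H_1,H_2)$ via $\langle T,f\otimes g\rangle=(Tf,\overline{g})$, and its elements with functions $h(x,y)=\sum_i f_i(x)g_i(y)$, $\sum\|f_i\|_2^2<\infty$, $\sum\|g_i\|_2^2<\infty$. A Schur multiplier is $\varphi\in L^\infty(X\times Y,m\times n)$ such that $\varphi h$ is equivalent with respect to $m\times n$ to a function in $\Gamma(X,Y)$ for every $h\in\Gamma(X,Y)$; the dual of the map $h\mapsto\varphi h$ is the Schur map $S_\varphi$. (The Schur maps are exactly the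 bounded weak* continuous masa-bimodule maps on $\mathcal{B}(H_1,H_2)$.) $\mathfrak{I}$ is the set of all idempotent Schur maps. A subspace is $\mathfrak{I}$-injective if it is the range of some element of $\mathfrak{I}$. $E\subseteq X\times Y$ is marginally null if $E\subseteq(X_0\times Y)\cup(X\times Y_0)$ with $m(X_0)=n(Y_0)=0$; two sets are marginally equivalent if their symmetric difference is marginally null. A set is $\omega$-open if it is marginally equivalent to a countable union $\bigcup_i\alpha_i\times\beta_i$ of measurable rectangles, and $\omega$-closed if its complement is $\omega$-open. For $\kappa$ $\omega$-closed, $\mathfrak{M}_{\max}(\kappa)$ is the set of $T\in\mathcal{B}(H_1,H_2)$ with $M_{\chi_\beta}TM_{\chi_\alpha}=0$ for all measurable $\alpha\subseteq X$, $\beta\subseteq Y$ with $(\alpha\times\beta)\cap\kappa$ marginally null. The support of a weak* closed masa-bimodule $\mathcal{U}$ is the $\omega$-closed set $\kappa$ (unique up to marginal equivalence) with $\mathrm{Ref}\,\mathcal{U}=\mathfrak{M}_{\max}(\kappa)$. $\mathfrak{M}_{\min}(\kappa)$ is the smallest weak* closed masa-bimodule with support $\kappa$ (it exists). An $\omega$-closed set $\kappa$ is operator synthetic if $\mathfrak{M}_{\min}(\kappa)=\mathfrak{M}_{\max}(\kappa)$. *)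

theory Defs
  imports "HOL-Analysis.Analysis"
begin

section \<open>Standard measure spaces\<close>

definition outer_regular_on :: "'a topology \<Rightarrow> 'a measure \<Rightarrow> bool" where
  "outer_regular_on \<tau> m \<longleftrightarrow>
     (\<forall>E\<in>sets m. emeasure m E = (INF U\<in>{U. openin \<tau> U \<and> E \<subseteq> U}. emeasure m U))"

definition inner_regular_on :: "'a topology \<Rightarrow> 'a measure \<Rightarrow> bool" where
  "inner_regular_on \<tau> m \<longleftrightarrow>
     (\<forall>E\<in>sets m. emeasure m E = (SUP K\<in>{K. compactin \<tau> K \<and> K \<subseteq> E}. emeasure m K))"

text \<open>The topology is not part of the structure. Regularity is required for some topology inducing
  the Borel structure; a \<open>\<sigma>\<close>-finite Borel measure is regular for a suitable finer Polish topology
  with the same Borel sets.\<close>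

definition standard_measure_space :: "'a measure \<Rightarrow> bool" where
  "standard_measure_space m \<longleftrightarrow>
     sigma_finite_measure m \<and>
     (\<exists>\<tau>. topspace \<tau> = space m \<and> completely_metrizable_space \<tau> \<and> separable_space \<tau> \<and>
          sets m = sigma_sets (space m) {U. openin \<tau> U} \<and>
          outer_regular_on \<tau> m \<and> inner_regular_on \<tau> m)"


section \<open>The Hilbert space of square integrable functions modulo null sets\<close>

definition sq_integrable :: "'a measure \<Rightarrow> ('a \<Rightarrow> complex) set" where
  "sq_integrable m = {f \<in> borel_measurable m. integrable m (\<lambda>x. (cmod (f x))\<^sup>2)}"

definition l2_class :: "'a measure \<Rightarrow> ('a \<Rightarrow> complex) \<Rightarrow> ('a \<Rightarrow> complex) set" where
  "l2_class m f = {g \<in> sq_integrable m. AE x in m. g x = f x}"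

definition L2 :: "'a measure \<Rightarrow> ('a \<Rightarrow> complex) set set" where
  "L2 m = l2_class m ` sq_integrable m"

definition l2_rep :: "('a \<Rightarrow> complex) set \<Rightarrow> 'a \<Rightarrow> complex" where
  "l2_rep u = (SOME f. f \<in> u)"

definition l2_zero :: "'a measure \<Rightarrow> ('a \<Rightarrow> complex) set" where
  "l2_zero m = l2_class m (\<lambda>x. 0)"

definition l2_add ::
  "'a measure \<Rightarrow> ('a \<Rightarrow> complex) set \<Rightarrow> ('a \<Rightarrow> complex) set \<Rightarrow> ('a \<Rightarrow> complex) set" where
  "l2_add m u v = l2_class m (\<lambda>x. l2_rep u x + l2_rep v x)"

definition l2_scale :: "'a measure \<Rightarrow> complex \<Rightarrow> ('a \<Rightarrow> complex) set \<Rightarrow> ('a \<Rightarrow> complex) set" where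
  "l2_scale m c u = l2_class m (\<lambda>x. c * l2_rep u x)"

definition l2_inner :: "'a measure \<Rightarrow> ('a \<Rightarrow> complex) set \<Rightarrow> ('a \<Rightarrow> complex) set \<Rightarrow> complex" where
  "l2_inner m u v = (LINT x|m. l2_rep u x * cnj (l2_rep v x))"

definition l2_norm :: "'a measure \<Rightarrow> ('a \<Rightarrow> complex) set \<Rightarrow> real" where
  "l2_norm m u = sqrt (LINT x|m. (cmod (l2_rep u x))\<^sup>2)"

definition l2_dist :: "'a measure \<Rightarrow> ('a \<Rightarrow> complex) set \<Rightarrow> ('a \<Rightarrow> complex) set \<Rightarrow> real" where
  "l2_dist m u v = l2_norm m (l2_add m u (l2_scale m (-1) v))"


section \<open>Bounded operators and multiplication operators\<close>

type_synonym ('a, 'b) l2_op = "('a \<Rightarrow> complex) set \<Rightarrow> ('b \<Rightarrow> complex) set"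

definition bounded_ops :: "'a measure \<Rightarrow> 'b measure \<Rightarrow> ('a, 'b) l2_op set" where
  "bounded_ops m n =
     {T \<in> L2 m \<rightarrow>\<^sub>E L2 n.
        (\<forall>u\<in>L2 m. \<forall>v\<in>L2 m. T (l2_add m u v) = l2_add n (T u) (T v)) \<and>
        (\<forall>c. \<forall>u\<in>L2 m. T (l2_scale m c u) = l2_scale n c (T u)) \<and>
        (\<exists>C. \<forall>u\<in>L2 m. l2_norm n (T u) \<le> C * l2_norm m u)}"

definition op_zero :: "'a measure \<Rightarrow> 'b measure \<Rightarrow> ('a, 'b) l2_op" where
  "op_zero m n = (\<lambda>u\<in>L2 m. l2_zero n)"

definition op_add ::
  "'a measure \<Rightarrow> 'b measure \<Rightarrow> ('a, 'b) l2_op \<Rightarrow> ('a, 'b) l2_op \<Rightarrow> ('a, 'b) l2_op" where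
  "op_add m n S T = (\<lambda>u\<in>L2 m. l2_add n (S u) (T u))"

definition op_scale ::
  "'a measure \<Rightarrow> 'b measure \<Rightarrow> complex \<Rightarrow> ('a, 'b) l2_op \<Rightarrow> ('a, 'b) l2_op" where
  "op_scale m n c T = (\<lambda>u\<in>L2 m. l2_scale n c (T u))"

definition op_subspace :: "'a measure \<Rightarrow> 'b measure \<Rightarrow> ('a, 'b) l2_op set \<Rightarrow> bool" where
  "op_subspace m n \<U> \<longleftrightarrow>
     \<U> \<subseteq> bounded_ops m n \<and> op_zero m n \<in> \<U> \<and>
     (\<forall>S\<in>\<U>. \<forall>T\<in>\<U>. op_add m n S T \<in> \<U>) \<and>
     (\<forall>c. \<forall>T\<in>\<U>. op_scale m n c T \<in> \<U>)"

definition Linf :: "'a measure \<Rightarrow> ('a \<Rightarrow> complex) set" where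
  "Linf m = {g \<in> borel_measurable m. \<exists>C. AE x in m. cmod (g x) \<le> C}"

definition mult_op :: "'a measure \<Rightarrow> ('a \<Rightarrow> complex) \<Rightarrow> ('a, 'a) l2_op" where
  "mult_op m g = (\<lambda>u\<in>L2 m. l2_class m (\<lambda>x. g x * l2_rep u x))"

definition mult_sandwich :: "'a measure \<Rightarrow> 'b measure \<Rightarrow>
    ('b \<Rightarrow> complex) \<Rightarrow> ('a, 'b) l2_op \<Rightarrow> ('a \<Rightarrow> complex) \<Rightarrow> ('a, 'b) l2_op" where
  "mult_sandwich m n b T a = compose (L2 m) (mult_op n b) (compose (L2 m) T (mult_op m a))"

definition masa_bimodule :: "'a measure \<Rightarrow> 'b measure \<Rightarrow> ('a, 'b) l2_op set \<Rightarrow> bool" where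
  "masa_bimodule m n \<U> \<longleftrightarrow>
     op_subspace m n \<U> \<and>
     (\<forall>a\<in>Linf m. \<forall>b\<in>Linf n. \<forall>T\<in>\<U>. mult_sandwich m n b T a \<in> \<U>)"

definition Ref :: "'a measure \<Rightarrow> 'b measure \<Rightarrow> ('a, 'b) l2_op set \<Rightarrow> ('a, 'b) l2_op set" where
  "Ref m n \<U> =
     {T \<in> bounded_ops m n. \<forall>u\<in>L2 m. \<forall>\<epsilon>>0. \<exists>S\<in>\<U>. l2_dist n (T u) (S u) < \<epsilon>}"


section \<open>The predual and the weak* topology\<close>

text \<open>An element \<open>h = \<Sum>i. f\<^sub>i \<otimes> g\<^sub>i\<close> of the predual is given by a representing pair of sequences.
  The function \<open>tensor_fun f g\<close> is determined only off a marginally null set, where the series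
  converges absolutely.\<close>

definition nuclear_pair ::
  "'a measure \<Rightarrow> 'b measure \<Rightarrow> (nat \<Rightarrow> 'a \<Rightarrow> complex) \<Rightarrow> (nat \<Rightarrow> 'b \<Rightarrow> complex) \<Rightarrow> bool" where
  "nuclear_pair m n f g \<longleftrightarrow>
     (\<forall>i. f i \<in> sq_integrable m) \<and> summable (\<lambda>i. LINT x|m. (cmod (f i x))\<^sup>2) \<and>
     (\<forall>i. g i \<in> sq_integrable n) \<and> summable (\<lambda>i. LINT y|n. (cmod (g i y))\<^sup>2)"

definition tensor_fun ::
  "(nat \<Rightarrow> 'a \<Rightarrow> complex) \<Rightarrow> (nat \<Rightarrow> 'b \<Rightarrow> complex) \<Rightarrow> 'a \<times> 'b \<Rightarrow> complex" where
  "tensor_fun f g = (\<lambda>(x, y). \<Sum>i. f i x * g i y)"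

definition pairing :: "'a measure \<Rightarrow> 'b measure \<Rightarrow> ('a, 'b) l2_op \<Rightarrow>
    (nat \<Rightarrow> 'a \<Rightarrow> complex) \<Rightarrow> (nat \<Rightarrow> 'b \<Rightarrow> complex) \<Rightarrow> complex" where
  "pairing m n T f g = (\<Sum>i. l2_inner n (T (l2_class m (f i))) (l2_class n (\<lambda>y. cnj (g i y))))"

definition weak_star_topology :: "'a measure \<Rightarrow> 'b measure \<Rightarrow> ('a, 'b) l2_op topology" where
  "weak_star_topology m n =
     topology_generated_by
       {{T \<in> bounded_ops m n. pairing m n T f g \<in> V} | f g V. nuclear_pair m n f g \<and> open V}"


section \<open>Schur maps\<close>

definition schur_multiplier :: "'a measure \<Rightarrow> 'b measure \<Rightarrow> ('a \<times> 'b \<Rightarrow> complex) \<Rightarrow> bool" where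
  "schur_multiplier m n \<phi> \<longleftrightarrow>
     \<phi> \<in> Linf (m \<Otimes>\<^sub>M n) \<and>
     (\<forall>f g. nuclear_pair m n f g \<longrightarrow>
        (\<exists>f' g'. nuclear_pair m n f' g' \<and>
           (AE z in m \<Otimes>\<^sub>M n. \<phi> z * tensor_fun f g z = tensor_fun f' g' z)))"

text \<open>The dual of \<open>h \<mapsto> \<phi> h\<close>: the operator \<open>S\<close> with \<open>\<langle>S, h\<rangle> = \<langle>T, \<phi> h\<rangle>\<close> for all \<open>h\<close> in the predual.\<close>

definition schur_map ::
  "'a measure \<Rightarrow> 'b measure \<Rightarrow> ('a \<times> 'b \<Rightarrow> complex) \<Rightarrow> ('a, 'b) l2_op \<Rightarrow> ('a, 'b) l2_op" where
  "schur_map m n \<phi> =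
     (\<lambda>T\<in>bounded_ops m n. THE S. S \<in> bounded_ops m n \<and>
        (\<forall>f g f' g'. nuclear_pair m n f g \<longrightarrow> nuclear_pair m n f' g' \<longrightarrow>
           (AE z in m \<Otimes>\<^sub>M n. \<phi> z * tensor_fun f g z = tensor_fun f' g' z) \<longrightarrow>
           pairing m n S f g = pairing m n T f' g'))"

definition schur_idempotents ::
  "'a measure \<Rightarrow> 'b measure \<Rightarrow> (('a, 'b) l2_op \<Rightarrow> ('a, 'b) l2_op) set" where
  "schur_idempotents m n =
     {\<Phi>. (\<exists>\<phi>. schur_multiplier m n \<phi> \<and> \<Phi> = schur_map m n \<phi>) \<and>
         (\<forall>T\<in>bounded_ops m n. \<Phi> (\<Phi> T) = \<Phi> T)}"

definition schur_injective :: "'a measure \<Rightarrow> 'b measure \<Rightarrow> ('a, 'b) l2_op set \<Rightarrow> bool" where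
  "schur_injective m n \<U> \<longleftrightarrow> (\<exists>\<Phi>\<in>schur_idempotents m n. \<U> = \<Phi> ` bounded_ops m n)"


section \<open>Supports and operator synthesis\<close>

definition marginally_null :: "'a measure \<Rightarrow> 'b measure \<Rightarrow> ('a \<times> 'b) set \<Rightarrow> bool" where
  "marginally_null m n E \<longleftrightarrow>
     (\<exists>X0\<in>null_sets m. \<exists>Y0\<in>null_sets n. E \<subseteq> (X0 \<times> space n) \<union> (space m \<times> Y0))"

definition marginally_equivalent ::
  "'a measure \<Rightarrow> 'b measure \<Rightarrow> ('a \<times> 'b) set \<Rightarrow> ('a \<times> 'b) set \<Rightarrow> bool" where
  "marginally_equivalent m n E F \<longleftrightarrow> marginally_null m n ((E - F) \<union> (F - E))"

definition omega_open :: "'a measure \<Rightarrow> 'b measure \<Rightarrow> ('a \<times> 'b) set \<Rightarrow> bool" where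
  "omega_open m n E \<longleftrightarrow>
     E \<subseteq> space m \<times> space n \<and>
     (\<exists>\<alpha> \<beta>. (\<forall>i::nat. \<alpha> i \<in> sets m \<and> \<beta> i \<in> sets n) \<and>
            marginally_equivalent m n E (\<Union>i. \<alpha> i \<times> \<beta> i))"

definition omega_closed :: "'a measure \<Rightarrow> 'b measure \<Rightarrow> ('a \<times> 'b) set \<Rightarrow> bool" where
  "omega_closed m n \<kappa> \<longleftrightarrow>
     \<kappa> \<subseteq> space m \<times> space n \<and> omega_open m n (space m \<times> space n - \<kappa>)"

definition M_max :: "'a measure \<Rightarrow> 'b measure \<Rightarrow> ('a \<times> 'b) set \<Rightarrow> ('a, 'b) l2_op set" where
  "M_max m n \<kappa> =
     {T \<in> bounded_ops m n. \<forall>\<alpha>\<in>sets m. \<forall>\<beta>\<in>sets n.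
        marginally_null m n ((\<alpha> \<times> \<beta>) \<inter> \<kappa>) \<longrightarrow>
        mult_sandwich m n (indicator \<beta>) T (indicator \<alpha>) = op_zero m n}"

definition is_support ::
  "'a measure \<Rightarrow> 'b measure \<Rightarrow> ('a, 'b) l2_op set \<Rightarrow> ('a \<times> 'b) set \<Rightarrow> bool" where
  "is_support m n \<U> \<kappa> \<longleftrightarrow> omega_closed m n \<kappa> \<and> Ref m n \<U> = M_max m n \<kappa>"

definition M_min :: "'a measure \<Rightarrow> 'b measure \<Rightarrow> ('a \<times> 'b) set \<Rightarrow> ('a, 'b) l2_op set" where
  "M_min m n \<kappa> =
     (LEAST \<U>. masa_bimodule m n \<U> \<and> closedin (weak_star_topology m n) \<U> \<and> is_support m n \<U> \<kappa>)"

definition operator_synthetic :: "'a measure \<Rightarrow> 'b measure \<Rightarrow> ('a \<times> 'b) set \<Rightarrow> bool" where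
  "operator_synthetic m n \<kappa> \<longleftrightarrow> omega_closed m n \<kappa> \<and> M_min m n \<kappa> = M_max m n \<kappa>"

end

theory Submission
  imports Defs
begin

text \<open>
  Write \<open>\<U>\<close> for the range of the idempotent Schur map with symbol \<open>\<phi>\<close>, and let \<open>\<V>\<close> be any
  weak* closed masa-bimodule with support \<open>\<kappa>\<close>, so that \<open>Ref \<V> = Ref \<U> = M_max \<kappa>\<close>. The space \<open>M_max \<kappa>\<close>
  is itself a reflexive weak* closed masa-bimodule with support \<open>\<kappa>\<close>, hence it is the least one as
  soon as it is contained in \<open>\<V>\<close>. This also settles the existence of the least one. By separation
  (\<open>weak_star_closed_subspace_mem\<close>) it suffices that \<open>T \<in> M_max \<kappa>\<close> annihilates every element \<open>h\<close> of
  the predual that annihilates \<open>\<V>\<close>.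

  Two mechanisms prove this. First, Schur multipliers and elements of the predual have the form
  \<open>\<Sum>i. F\<^sub>i(x) G\<^sub>i(y)\<close> with \<open>F\<close> and \<open>G\<close> valued in the separable space of square summable sequences, up to a
  factor that separates the variables. Dividing both spaces into countably many sets on which \<open>F\<close> and
  \<open>G\<close> are nearly constant makes such a sum nearly constant on rectangles. Second, rank one operators, and
  more generally operators with a kernel \<open>k\<close> dominated by a product, satisfy \<open>\<langle>Op k, h\<rangle> = \<integral> k h\<close>, so the
  Schur map acts on them by \<open>k \<mapsto> \<phi> k\<close>.

  The action on kernels gives \<open>\<phi>\<^sup>2 = \<phi>\<close> almost everywhere (\<open>idempotent_multiplier\<close>), and the division
  then produces rectangles on each of which \<open>\<phi>\<close> is almost everywhere 0 or almost everywhere 1. Where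
  \<open>\<phi> = 0\<close>, the operators in \<open>\<U>\<close> vanish, and so does \<open>T\<close>, because the rank one annihilators of a space
  and of its reflexive hull are the same (\<open>Ref_form_zero\<close>). Where \<open>\<phi> = 1\<close>, every rank one operator lies
  in \<open>\<U>\<close>, hence in \<open>Ref \<V>\<close>. If \<open>h\<close> were nonzero there, it would be close to a nonzero constant on some
  non-null rectangle; since \<open>\<V>\<close> is a bimodule annihilated by \<open>h\<close>, a contraction argument
  (\<open>rectangle_contraction\<close>) would force \<open>\<V>\<close> and \<open>Ref \<V>\<close> to vanish on that rectangle, against
  the presence of rank one operators. So \<open>h = 0\<close> on the rectangle, and then the restriction of \<open>h\<close> pairs
  to 0 with every operator (\<open>pairing_zero_of_tensor_zero\<close>).

  The rectangles form a grid on \<open>{\<parallel>F\<parallel> \<le> r} \<times> {\<parallel>G\<parallel> \<le> r}\<close> for every \<open>r\<close>. The pairing of \<open>T\<close> with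
  the restriction of \<open>h\<close> to \<open>A \<times> B\<close> is countably additive in \<open>A\<close> and in \<open>B\<close> separately, but in
  general not as a function of the rectangle; the grid structure is what makes the separate additivity suffice
  (\<open>rect_pairing_zero_cover\<close>).
\<close>

section \<open>Square summable sequences and cells in the sequence space\<close>

lemma suminf_mult_le_sqrt:
  fixes a b :: "nat \<Rightarrow> real"
  assumes a: "summable (\<lambda>i. (a i)\<^sup>2)" and b: "summable (\<lambda>i. (b i)\<^sup>2)"
  shows "summable (\<lambda>i. \<bar>a i * b i\<bar>)"
    and "(\<Sum>i. \<bar>a i * b i\<bar>) \<le> sqrt (\<Sum>i. (a i)\<^sup>2) * sqrt (\<Sum>i. (b i)\<^sup>2)"
proof -
  have le: "(\<Sum>i<N. \<bar>a i * b i\<bar>) \<le> sqrt (\<Sum>i. (a i)\<^sup>2) * sqrt (\<Sum>i. (b i)\<^sup>2)" for N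
  proof -
    have "(\<Sum>i<N. \<bar>a i * b i\<bar>) \<le> L2_set a {..<N} * L2_set b {..<N}"
      using L2_set_mult_ineq[of a b "{..<N}"] by (simp add: abs_mult)
    also have "\<dots> \<le> sqrt (\<Sum>i. (a i)\<^sup>2) * sqrt (\<Sum>i. (b i)\<^sup>2)"
      unfolding L2_set_def using a b
      by (intro mult_mono real_sqrt_le_mono sum_le_suminf)
         (auto intro: suminf_nonneg sum_nonneg)
    finally show ?thesis .
  qed
  show s: "summable (\<lambda>i. \<bar>a i * b i\<bar>)"
    by (rule summableI_nonneg_bounded[OF _ le]) simp
  show "(\<Sum>i. \<bar>a i * b i\<bar>) \<le> sqrt (\<Sum>i. (a i)\<^sup>2) * sqrt (\<Sum>i. (b i)\<^sup>2)"
    by (rule suminf_le_const[OF s le])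
qed

definition square_summable :: "(nat \<Rightarrow> complex) \<Rightarrow> bool" where
  "square_summable c \<longleftrightarrow> summable (\<lambda>i. (cmod (c i))\<^sup>2)"

definition ell2 :: "(nat \<Rightarrow> complex) \<Rightarrow> real" where
  "ell2 c = sqrt (\<Sum>i. (cmod (c i))\<^sup>2)"

lemma ell2_nonneg: "square_summable c \<Longrightarrow> 0 \<le> ell2 c"
  unfolding ell2_def square_summable_def by (simp add: suminf_nonneg)

lemma square_summable_product:
  assumes "square_summable c" "square_summable d"
  shows "summable (\<lambda>i. cmod (c i * d i))" and "summable (\<lambda>i. c i * d i)"
    and "cmod (\<Sum>i. c i * d i) \<le> ell2 c * ell2 d"
proof -
  note cs = suminf_mult_le_sqrt[of "\<lambda>i. cmod (c i)" "\<lambda>i. cmod (d i)",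
      OF assms[unfolded square_summable_def]]
  show s: "summable (\<lambda>i. cmod (c i * d i))"
    using cs(1) by (simp add: norm_mult)
  then show "summable (\<lambda>i. c i * d i)"
    by (rule summable_norm_cancel)
  have "cmod (\<Sum>i. c i * d i) \<le> (\<Sum>i. cmod (c i * d i))"
    by (rule summable_norm[OF s])
  also have "\<dots> \<le> ell2 c * ell2 d"
    using cs(2) by (simp add: norm_mult ell2_def)
  finally show "cmod (\<Sum>i. c i * d i) \<le> ell2 c * ell2 d" .
qed

lemma square_summable_add:
  assumes "square_summable c" "square_summable d"
  shows "square_summable (\<lambda>i. c i + d i)"
  unfolding square_summable_def
proof (rule summable_comparison_test')
  show "summable (\<lambda>i. 2 * (cmod (c i))\<^sup>2 + 2 * (cmod (d i))\<^sup>2)"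
    using assms unfolding square_summable_def by (intro summable_add summable_mult)
  fix i :: nat
  have "(cmod (c i + d i))\<^sup>2 \<le> (cmod (c i) + cmod (d i))\<^sup>2"
    by (intro power_mono norm_triangle_ineq) simp
  also have "\<dots> \<le> 2 * (cmod (c i))\<^sup>2 + 2 * (cmod (d i))\<^sup>2"
    using sum_squares_bound[of "cmod (c i)" "cmod (d i)"] by (simp add: power2_sum)
  finally show "norm ((cmod (c i + d i))\<^sup>2) \<le> 2 * (cmod (c i))\<^sup>2 + 2 * (cmod (d i))\<^sup>2"
    by simp
qed

lemma square_summable_scale: "square_summable c \<Longrightarrow> square_summable (\<lambda>i. z * c i)"
  unfolding square_summable_def by (simp add: norm_mult power_mult_distrib summable_mult)

lemma square_summable_diff:
  "square_summable c \<Longrightarrow> square_summable d \<Longrightarrow> square_summable (\<lambda>i. c i - d i)"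
  using square_summable_add[of c "\<lambda>i. -1 * d i"] square_summable_scale[of d "-1"] by simp

lemma ell2_add_le:
  assumes "square_summable c" "square_summable d"
  shows "ell2 (\<lambda>i. c i + d i) \<le> ell2 c + ell2 d"
proof -
  have conv: "(\<lambda>N. L2_set (\<lambda>i. cmod (e i)) {..<N}) \<longlonglongrightarrow> ell2 e" if "square_summable e" for e
    unfolding L2_set_def ell2_def
    by (intro tendsto_real_sqrt summable_LIMSEQ that[unfolded square_summable_def])
  have "L2_set (\<lambda>i. cmod (c i + d i)) {..<N} \<le>
      L2_set (\<lambda>i. cmod (c i)) {..<N} + L2_set (\<lambda>i. cmod (d i)) {..<N}" for N
    by (rule order_trans[OF L2_set_mono L2_set_triangle_ineq]) (auto intro: norm_triangle_ineq)
  then show ?thesis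
    by (intro LIMSEQ_le[OF conv tendsto_add[OF conv conv]] assms square_summable_add) auto
qed

lemma ell2_le_shift:
  assumes "square_summable c" "square_summable d" "ell2 (\<lambda>i. c i - d i) \<le> e"
  shows "ell2 c \<le> ell2 d + e" "ell2 d \<le> ell2 c + e"
proof -
  have "ell2 c \<le> ell2 (\<lambda>i. c i - d i) + ell2 d"
    using ell2_add_le[OF square_summable_diff[OF assms(1,2)] assms(2)] by simp
  then show "ell2 c \<le> ell2 d + e" using assms by simp
  have "ell2 (\<lambda>i. d i - c i) = ell2 (\<lambda>i. c i - d i)"
    by (simp add: ell2_def norm_minus_commute)
  moreover have "ell2 d \<le> ell2 (\<lambda>i. d i - c i) + ell2 c"
    using ell2_add_le[OF square_summable_diff[OF assms(2,1)] assms(1)] by simp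
  ultimately show "ell2 d \<le> ell2 c + e" using assms by simp
qed

text \<open>Continuity of the bilinear pairing of sequences at \<open>(\<xi>, \<eta>)\<close>, in the
  asymmetric form that only needs the norms of \<open>d\<close> and \<open>\<xi>\<close>.\<close>
lemma suminf_product_diff:
  assumes c: "square_summable c" and d: "square_summable d"
    and x: "square_summable \<xi>" and h: "square_summable \<eta>"
    and ce: "ell2 (\<lambda>i. c i - \<xi> i) \<le> e" and de: "ell2 (\<lambda>i. d i - \<eta> i) \<le> e"
  shows "cmod ((\<Sum>i. c i * d i) - (\<Sum>i. \<xi> i * \<eta> i)) \<le> e * ell2 d + ell2 \<xi> * e"
proof -
  note s1 = square_summable_product[OF square_summable_diff[OF c x] d]
  note s2 = square_summable_product[OF x square_summable_diff[OF d h]]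
  have "(\<Sum>i. c i * d i) - (\<Sum>i. \<xi> i * \<eta> i) = (\<Sum>i. c i * d i - \<xi> i * \<eta> i)"
    by (rule suminf_diff) (rule square_summable_product[OF c d] square_summable_product[OF x h])+
  also have "\<dots> = (\<Sum>i. (c i - \<xi> i) * d i + \<xi> i * (d i - \<eta> i))"
    by (simp add: algebra_simps)
  also have "\<dots> = (\<Sum>i. (c i - \<xi> i) * d i) + (\<Sum>i. \<xi> i * (d i - \<eta> i))"
    by (rule suminf_add[symmetric]) (rule s1 s2)+
  also have "cmod \<dots> \<le> ell2 (\<lambda>i. c i - \<xi> i) * ell2 d + ell2 \<xi> * ell2 (\<lambda>i. d i - \<eta> i)"
    by (rule norm_triangle_le) (intro add_mono s1 s2)
  also have "\<dots> \<le> e * ell2 d + ell2 \<xi> * e"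
    by (intro add_mono mult_right_mono mult_left_mono ce de ell2_nonneg d x)
  finally show ?thesis .
qed

text \<open>Separability of the sequence space. A list of indices into a countable dense set of complex
  numbers, extended by 0, encodes a finitely supported sequence.\<close>
lemma dense_sequence_ell2:
  obtains d :: "nat \<Rightarrow> nat \<Rightarrow> complex"
  where "\<And>k. square_summable (d k)"
    and "\<And>c e. square_summable c \<Longrightarrow> 0 < e \<Longrightarrow> \<exists>k. ell2 (\<lambda>i. c i - d k i) < e"
proof -
  obtain D :: "complex set" where D: "countable D" "\<And>X. open X \<Longrightarrow> X \<noteq> {} \<Longrightarrow> \<exists>z\<in>D. z \<in> X"
    using countable_dense_exists[where 'a=complex] by blast
  define q where "q = from_nat_into D"
  have "D \<noteq> {}" using D(2)[of UNIV] by auto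
  then have q: "\<exists>k. cmod (z - q k) < e" if "0 < e" for z e
    using D(2)[of "ball z e"] that from_nat_into_surj[OF D(1)]
    by (metis q_def centre_in_ball empty_iff mem_ball dist_norm open_ball)
  define d where "d k i = (let l = from_nat k :: nat list in if i < length l then q (l ! i) else 0)" for k i
  have "square_summable (d k)" for k
    unfolding square_summable_def
    by (rule summable_finite[of "{..<length (from_nat k :: nat list)}"]) (auto simp: d_def)
  moreover have "\<exists>k. ell2 (\<lambda>i. c i - d k i) < e" if c: "square_summable c" and e: "0 < e" for c e
  proof -
    have c': "summable (\<lambda>i. (cmod (c i))\<^sup>2)" using c by (simp add: square_summable_def)
    obtain N where N: "norm (\<Sum>i. (cmod (c (i + N)))\<^sup>2) < e\<^sup>2 / 2"
      using suminf_exist_split[OF _ c', of "e\<^sup>2 / 2"] e by auto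
    \<comment> \<open>Half of \<open>e\<^sup>2\<close> is spent on the tail, the other half on the first \<open>N\<close> entries; \<open>N + 1\<close> avoids a division by 0.\<close>
    define r where "r = sqrt (e\<^sup>2 / (2 * (N + 1)))"
    have r: "0 < r" using e by (simp add: r_def)
    define l where "l = map (\<lambda>i. SOME k. cmod (c i - q k) < r) [0..<N]"
    have l: "length l = N" "\<And>i. i < N \<Longrightarrow> cmod (c i - q (l ! i)) < r"
      using someI_ex[OF q[OF r]] by (auto simp: l_def)
    have dk: "d (to_nat l) i = (if i < N then q (l ! i) else 0)" for i
      by (simp add: d_def l)
    have s: "summable (\<lambda>i. (cmod (c i - d (to_nat l) i))\<^sup>2)"
      by (rule summable_iff_shift[THEN iffD1, of _ N])
        (simp add: dk summable_ignore_initial_segment[OF c'])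
    have "(\<Sum>i. (cmod (c i - d (to_nat l) i))\<^sup>2) =
        (\<Sum>i. (cmod (c (i + N) - d (to_nat l) (i + N)))\<^sup>2) + (\<Sum>i<N. (cmod (c i - d (to_nat l) i))\<^sup>2)"
      by (rule suminf_split_initial_segment[OF s])
    also have "\<dots> \<le> (\<Sum>i. (cmod (c (i + N)))\<^sup>2) + (\<Sum>i<N. r\<^sup>2)"
      using less_imp_le[OF l(2)] by (intro add_mono sum_mono) (auto simp: dk intro!: power_mono)
    also have "\<dots> < e\<^sup>2 / 2 + e\<^sup>2 / 2"
    proof (rule add_less_le_mono)
      show "(\<Sum>i. (cmod (c (i + N)))\<^sup>2) < e\<^sup>2 / 2" using N by simp
      have "(\<Sum>i<N. r\<^sup>2) = real N * (e\<^sup>2 / (2 * (real N + 1)))" using e by (simp add: r_def)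
      also have "\<dots> \<le> (real N + 1) * (e\<^sup>2 / (2 * (real N + 1)))"
        by (rule mult_right_mono) auto
      also have "\<dots> = e\<^sup>2 / 2" by (simp add: field_simps)
      finally show "(\<Sum>i<N. r\<^sup>2) \<le> e\<^sup>2 / 2" .
    qed
    finally have "(\<Sum>i. (cmod (c i - d (to_nat l) i))\<^sup>2) < e\<^sup>2" by simp
    then have "ell2 (\<lambda>i. c i - d (to_nat l) i) < e"
      unfolding ell2_def using e by (metis real_sqrt_less_mono real_sqrt_abs abs_of_pos)
    then show ?thesis by blast
  qed
  ultimately show thesis by (rule that)
qed

text \<open>Square summability has to be demanded separately, because the sum of a divergent series has
  an arbitrary value.\<close>
definition near_set :: "'a measure \<Rightarrow> (nat \<Rightarrow> 'a \<Rightarrow> complex) \<Rightarrow> (nat \<Rightarrow> complex) \<Rightarrow> real \<Rightarrow> 'a set" where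
  "near_set m F \<xi> e = {x \<in> space m. square_summable (\<lambda>i. F i x) \<and> ell2 (\<lambda>i. F i x - \<xi> i) < e}"

lemma sets_near_set [measurable]:
  assumes [measurable]: "\<And>i. F i \<in> borel_measurable m"
  shows "near_set m F \<xi> e \<in> sets m"
proof -
  have [measurable]: "(\<lambda>x. \<Sum>i. (cmod (F i x - \<xi> i))\<^sup>2) \<in> borel_measurable m"
    by (rule borel_measurable_suminf) measurable
  have [measurable]: "Measurable.pred m (\<lambda>x. summable (\<lambda>i. (cmod (F i x))\<^sup>2))"
    unfolding summable_iff_convergent Cauchy_convergent_iff[symmetric] pred_def
    by (rule sets_Collect_Cauchy) measurable
  show ?thesis
    unfolding near_set_def square_summable_def ell2_def by measurable
qed

text \<open>The set where \<open>\<Sum>j. F\<^sub>j(x) G\<^sub>j(y)\<close> does not vanish is covered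
  by countably many products of near sets, since the centres can be taken from a dense sequence and the
  radii among the numbers \<open>1/(N+1)\<close>. The bound on the radius makes the sum nonzero on the
  whole cell (\<open>near_sets_product_nonzero\<close>) and gives the contraction factor in
  \<open>rectangle_contraction\<close>.\<close>
lemma nonvanishing_cells:
  fixes F :: "nat \<Rightarrow> 'a \<Rightarrow> complex" and G :: "nat \<Rightarrow> 'b \<Rightarrow> complex"
  obtains I :: "(nat \<times> nat \<times> nat) set" and \<xi> \<eta> e
  where "\<And>i. i \<in> I \<Longrightarrow> square_summable (\<xi> i)"
    and "\<And>i. i \<in> I \<Longrightarrow> square_summable (\<eta> i)"
    and "\<And>i. i \<in> I \<Longrightarrow> 0 < e i"
    and "\<And>i. i \<in> I \<Longrightarrow> e i * (ell2 (\<xi> i) + ell2 (\<eta> i) + e i) < cmod (\<Sum>j. \<xi> i j * \<eta> i j)"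
    and "\<And>x y. x \<in> space m \<Longrightarrow> y \<in> space n \<Longrightarrow> square_summable (\<lambda>j. F j x) \<Longrightarrow>
           square_summable (\<lambda>j. G j y) \<Longrightarrow> (\<Sum>j. F j x * G j y) \<noteq> 0 \<Longrightarrow>
           \<exists>i\<in>I. x \<in> near_set m F (\<xi> i) (e i) \<and> y \<in> near_set n G (\<eta> i) (e i)"
proof -
  obtain d :: "nat \<Rightarrow> nat \<Rightarrow> complex" where d: "\<And>k. square_summable (d k)"
    "\<And>c e. square_summable c \<Longrightarrow> 0 < e \<Longrightarrow> \<exists>k. ell2 (\<lambda>i. c i - d k i) < e"
    using dense_sequence_ell2 by blast
  define \<xi> where "\<xi> i = d (fst i)" for i :: "nat \<times> nat \<times> nat"
  define \<eta> where "\<eta> i = d (fst (snd i))" for i :: "nat \<times> nat \<times> nat"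
  define e where "e i = 1 / real (Suc (snd (snd i)))" for i :: "nat \<times> nat \<times> nat"
  define I where "I = {i. e i * (ell2 (\<xi> i) + ell2 (\<eta> i) + e i) < cmod (\<Sum>j. \<xi> i j * \<eta> i j)}"
  have "\<exists>i\<in>I. x \<in> near_set m F (\<xi> i) (e i) \<and> y \<in> near_set n G (\<eta> i) (e i)"
    if x: "x \<in> space m" and y: "y \<in> space n" and F: "square_summable (\<lambda>j. F j x)"
      and G: "square_summable (\<lambda>j. G j y)" and nz: "(\<Sum>j. F j x * G j y) \<noteq> 0" for x y
  proof -
    let ?a = "ell2 (\<lambda>j. F j x)" and ?b = "ell2 (\<lambda>j. G j y)" and ?s = "\<Sum>j. F j x * G j y"
    have ab: "0 \<le> ?a" "0 \<le> ?b" using F G by (auto intro: ell2_nonneg)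
    have "0 < cmod ?s / (2 * ?a + 2 * ?b + 4)" using nz ab by (intro divide_pos_pos) auto
    then obtain N where N: "1 / real (Suc N) < cmod ?s / (2 * ?a + 2 * ?b + 4)"
      using nat_approx_posE by blast
    define r where "r = 1 / real (Suc N)"
    have r: "0 < r" "r \<le> 1" and rs: "r * (2 * ?a + 2 * ?b + 4) < cmod ?s"
      using N ab by (auto simp: r_def pos_less_divide_eq)
    obtain k l where k: "ell2 (\<lambda>j. F j x - d k j) < r" and l: "ell2 (\<lambda>j. G j y - d l j) < r"
      using d(2)[OF F r(1)] d(2)[OF G r(1)] by blast
    have dk: "ell2 (d k) \<le> ?a + r" and dl: "ell2 (d l) \<le> ?b + r"
      using ell2_le_shift(2)[OF F d(1) less_imp_le[OF k]] ell2_le_shift(2)[OF G d(1) less_imp_le[OF l]] by auto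
    have "cmod (?s - (\<Sum>j. d k j * d l j)) \<le> r * ?b + ell2 (d k) * r"
      by (rule suminf_product_diff) (use F G d k l in auto)
    then have "cmod ?s - (r * ?b + ell2 (d k) * r) \<le> cmod (\<Sum>j. d k j * d l j)"
      using norm_triangle_ineq2[of ?s "\<Sum>j. d k j * d l j"] by linarith
    moreover have "r * (ell2 (d k) + ell2 (d l) + r) + (r * ?b + ell2 (d k) * r) < cmod ?s"
    proof -
      have "r * (ell2 (d k) + ell2 (d l) + r) + (r * ?b + ell2 (d k) * r)
          = r * (2 * ell2 (d k) + ell2 (d l) + r + ?b)" by (simp add: algebra_simps)
      also have "\<dots> \<le> r * (2 * ?a + 2 * ?b + 4)"
        using dk dl r by (intro mult_left_mono) auto
      finally show ?thesis using rs by simp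
    qed
    ultimately have "(k, l, N) \<in> I"
      by (auto simp: I_def \<xi>_def \<eta>_def e_def r_def)
    then show ?thesis
      using x y F G k l by (intro bexI[of _ "(k, l, N)"]) (auto simp: near_set_def \<xi>_def \<eta>_def e_def r_def)
  qed
  with that[of I \<xi> \<eta> e] show thesis
    using d(1) by (auto simp: I_def \<xi>_def \<eta>_def e_def)
qed

section \<open>Square integrable functions and the bilinear form of an operator\<close>

lemma sq_integrableD:
  assumes "f \<in> sq_integrable m"
  shows "f \<in> borel_measurable m" "integrable m (\<lambda>x. (cmod (f x))\<^sup>2)"
  using assms by (auto simp: sq_integrable_def)

text \<open>The norm on functions rather than on classes, so that estimates can be made on
  representatives.\<close>
definition snorm :: "'a measure \<Rightarrow> ('a \<Rightarrow> complex) \<Rightarrow> real" where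
  "snorm m f = sqrt (LINT x|m. (cmod (f x))\<^sup>2)"

lemma snorm_nonneg [simp]: "0 \<le> snorm m f"
  by (simp add: snorm_def)

lemma snorm_square [simp]: "(snorm m f)\<^sup>2 = (LINT x|m. (cmod (f x))\<^sup>2)"
  by (simp add: snorm_def)

lemma sq_integrable_add:
  assumes "f \<in> sq_integrable m" "g \<in> sq_integrable m"
  shows "(\<lambda>x. f x + g x) \<in> sq_integrable m"
proof -
  note [measurable] = sq_integrableD(1)[OF assms(1)] sq_integrableD(1)[OF assms(2)]
  have le: "(cmod (f x + g x))\<^sup>2 \<le> 2 * (cmod (f x))\<^sup>2 + 2 * (cmod (g x))\<^sup>2" for x
  proof -
    have "(cmod (f x + g x))\<^sup>2 \<le> (cmod (f x) + cmod (g x))\<^sup>2"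
      by (intro power_mono norm_triangle_ineq) simp
    also have "\<dots> \<le> 2 * (cmod (f x))\<^sup>2 + 2 * (cmod (g x))\<^sup>2"
      using sum_squares_bound[of "cmod (f x)" "cmod (g x)"] by (simp add: power2_sum)
    finally show ?thesis .
  qed
  have "integrable m (\<lambda>x. (cmod (f x + g x))\<^sup>2)"
    by (rule Bochner_Integration.integrable_bound[of m "\<lambda>x. 2 * (cmod (f x))\<^sup>2 + 2 * (cmod (g x))\<^sup>2"])
       (simp_all add: le sq_integrableD(2)[OF assms(1)] sq_integrableD(2)[OF assms(2)])
  then show ?thesis by (simp add: sq_integrable_def)
qed

lemma Linf_mult_sq_integrable:
  assumes "a \<in> Linf m" "f \<in> sq_integrable m"
  shows "(\<lambda>x. a x * f x) \<in> sq_integrable m"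
proof -
  obtain C where C: "AE x in m. cmod (a x) \<le> C" and [measurable]: "a \<in> borel_measurable m"
    using assms(1) by (auto simp: Linf_def)
  note [measurable] = sq_integrableD(1)[OF assms(2)]
  have "integrable m (\<lambda>x. (cmod (a x * f x))\<^sup>2)"
  proof (rule Bochner_Integration.integrable_bound)
    show "integrable m (\<lambda>x. C\<^sup>2 * (cmod (f x))\<^sup>2)"
      by (intro integrable_mult_right sq_integrableD assms)
    show "AE x in m. norm ((cmod (a x * f x))\<^sup>2) \<le> norm (C\<^sup>2 * (cmod (f x))\<^sup>2)"
      using C by eventually_elim (auto simp: norm_mult power_mult_distrib intro!: mult_right_mono power_mono)
  qed measurable
  then show ?thesis by (simp add: sq_integrable_def)
qed

lemma Linf_indicator: "A \<in> sets m \<Longrightarrow> (indicator A :: 'a \<Rightarrow> complex) \<in> Linf m"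
proof -
  assume "A \<in> sets m"
  moreover have "\<exists>C. AE x in m. cmod (indicator A x :: complex) \<le> C"
    by (rule exI[of _ 1]) (simp add: indicator_def)
  ultimately show ?thesis by (simp add: Linf_def)
qed

lemma Linf_const: "(\<lambda>x. c) \<in> Linf m"
proof -
  have "\<exists>C. AE x in m. cmod c \<le> C" by (rule exI[of _ "cmod c"]) simp
  then show ?thesis by (simp add: Linf_def)
qed

lemma Linf_mult:
  assumes "a \<in> Linf m" "b \<in> Linf m"
  shows "(\<lambda>x. a x * b x) \<in> Linf m"
proof -
  obtain C D where C: "AE x in m. cmod (a x) \<le> C" and D: "AE x in m. cmod (b x) \<le> D"
    and [measurable]: "a \<in> borel_measurable m" "b \<in> borel_measurable m"
    using assms by (auto simp: Linf_def)
  have "AE x in m. cmod (a x * b x) \<le> C * D"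
    using C D by eventually_elim (unfold norm_mult, rule mult_mono', simp_all)
  then have "\<exists>C. AE x in m. cmod (a x * b x) \<le> C" ..
  then show ?thesis unfolding Linf_def by simp
qed

lemma sq_integrable_scale: "f \<in> sq_integrable m \<Longrightarrow> (\<lambda>x. c * f x) \<in> sq_integrable m"
  by (rule Linf_mult_sq_integrable[OF Linf_const])

lemma sq_integrable_diff:
  "f \<in> sq_integrable m \<Longrightarrow> g \<in> sq_integrable m \<Longrightarrow> (\<lambda>x. f x - g x) \<in> sq_integrable m"
  using sq_integrable_add[of f m "\<lambda>x. -1 * g x"] sq_integrable_scale[of g m "-1"] by simp

lemma sq_integrable_zero [simp]: "(\<lambda>x. 0) \<in> sq_integrable m"
  by (simp add: sq_integrable_def)

lemma borel_measurable_cnj [measurable (raw)]: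
  "f \<in> borel_measurable m \<Longrightarrow> (\<lambda>x. cnj (f x)) \<in> borel_measurable m"
  using measurable_compose[OF _ borel_measurable_continuous_onI[OF linear_continuous_on[OF bounded_linear_cnj]]] .

lemma sq_integrable_cnj: "f \<in> sq_integrable m \<Longrightarrow> (\<lambda>x. cnj (f x)) \<in> sq_integrable m"
  by (simp add: sq_integrable_def borel_measurable_cnj)

lemma sq_integrable_sum:
  "(\<And>i. i \<in> I \<Longrightarrow> f i \<in> sq_integrable m) \<Longrightarrow> (\<lambda>x. \<Sum>i\<in>I. f i x) \<in> sq_integrable m"
  by (induction I rule: infinite_finite_induct) (simp_all add: sq_integrable_add)

lemma sq_integrable_product:
  assumes "f \<in> sq_integrable m" "g \<in> sq_integrable m"
  shows "integrable m (\<lambda>x. f x * g x)"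
    and "(LINT x|m. cmod (f x * g x)) \<le> snorm m f * snorm m g"
    and "cmod (LINT x|m. f x * g x) \<le> snorm m f * snorm m g"
proof -
  note f = sq_integrableD[OF assms(1)] and g = sq_integrableD[OF assms(2)]
  note [measurable] = f(1) g(1)
  show i: "integrable m (\<lambda>x. f x * g x)"
  proof (rule Bochner_Integration.integrable_bound)
    show "integrable m (\<lambda>x. (cmod (f x))\<^sup>2 + (cmod (g x))\<^sup>2)"
      using f(2) g(2) by (rule Bochner_Integration.integrable_add)
    have "cmod (f x * g x) \<le> (cmod (f x))\<^sup>2 + (cmod (g x))\<^sup>2" for x
      using sum_squares_bound[of "cmod (f x)" "cmod (g x)"]
        mult_nonneg_nonneg[OF norm_ge_zero[of "f x"] norm_ge_zero[of "g x"]] unfolding norm_mult by linarith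
    then show "AE x in m. norm (f x * g x) \<le> norm ((cmod (f x))\<^sup>2 + (cmod (g x))\<^sup>2)"
      by simp
  qed measurable
  have "(\<integral>\<^sup>+x. ennreal (cmod (f x)) * ennreal (cmod (g x)) \<partial>m)\<^sup>2
      \<le> (\<integral>\<^sup>+x. (ennreal (cmod (f x)))\<^sup>2 \<partial>m) * (\<integral>\<^sup>+x. (ennreal (cmod (g x)))\<^sup>2 \<partial>m)"
    by (rule Cauchy_Schwarz_nn_integral) measurable
  also have "(\<integral>\<^sup>+x. (ennreal (cmod (f x)))\<^sup>2 \<partial>m) = ennreal ((snorm m f)\<^sup>2)"
    using f by (simp add: ennreal_power nn_integral_eq_integral)
  also have "(\<integral>\<^sup>+x. (ennreal (cmod (g x)))\<^sup>2 \<partial>m) = ennreal ((snorm m g)\<^sup>2)"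
    using g by (simp add: ennreal_power nn_integral_eq_integral)
  also have "(\<integral>\<^sup>+x. ennreal (cmod (f x)) * ennreal (cmod (g x)) \<partial>m) = ennreal (LINT x|m. cmod (f x * g x))"
    using integrable_norm[OF i]
    by (simp add: ennreal_mult[symmetric] norm_mult nn_integral_eq_integral)
  finally have "(LINT x|m. cmod (f x * g x))\<^sup>2 \<le> (snorm m f * snorm m g)\<^sup>2"
    by (simp add: ennreal_power ennreal_mult[symmetric] power_mult_distrib del: snorm_square)
  then show le: "(LINT x|m. cmod (f x * g x)) \<le> snorm m f * snorm m g"
    by (rule power2_le_imp_le) simp
  show "cmod (LINT x|m. f x * g x) \<le> snorm m f * snorm m g"
    by (rule order_trans[OF integral_norm_bound le])
qed

lemma snorm_scale: "snorm m (\<lambda>x. c * f x) = cmod c * snorm m f"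
  by (simp add: snorm_def norm_mult power_mult_distrib real_sqrt_mult)

lemma snorm_cong_AE:
  assumes "f \<in> borel_measurable m" "g \<in> borel_measurable m" "AE x in m. f x = g x"
  shows "snorm m f = snorm m g"
proof -
  have "(LINT x|m. (cmod (f x))\<^sup>2) = (LINT x|m. (cmod (g x))\<^sup>2)"
    using assms by (intro integral_cong_AE) auto
  then show ?thesis by (simp add: snorm_def)
qed

lemma l2_rep_class:
  assumes "f \<in> sq_integrable m"
  shows "l2_rep (l2_class m f) \<in> sq_integrable m" "AE x in m. l2_rep (l2_class m f) x = f x"
proof -
  have "f \<in> l2_class m f" using assms by (auto simp: l2_class_def)
  then have "l2_rep (l2_class m f) \<in> l2_class m f" unfolding l2_rep_def by (rule someI[of "\<lambda>h. h \<in> l2_class m f"])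
  then show "l2_rep (l2_class m f) \<in> sq_integrable m" "AE x in m. l2_rep (l2_class m f) x = f x"
    by (auto simp: l2_class_def)
qed

lemma l2_class_cong:
  assumes "AE x in m. f x = g x"
  shows "l2_class m f = l2_class m g"
proof -
  have "(AE x in m. h x = f x) \<longleftrightarrow> (AE x in m. h x = g x)" for h
    using assms by (auto elim!: eventually_elim2)
  then show ?thesis by (simp add: l2_class_def)
qed

lemma l2_class_in_L2 [simp]: "f \<in> sq_integrable m \<Longrightarrow> l2_class m f \<in> L2 m"
  by (simp add: L2_def)

lemma L2_rep:
  assumes "u \<in> L2 m"
  shows "l2_rep u \<in> sq_integrable m" "l2_class m (l2_rep u) = u"
  using assms by (auto simp: L2_def l2_rep_class intro!: l2_class_cong)

lemma l2_class_eq_iff: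
  assumes "f \<in> sq_integrable m" "g \<in> sq_integrable m"
  shows "l2_class m f = l2_class m g \<longleftrightarrow> (AE x in m. f x = g x)"
proof
  assume "l2_class m f = l2_class m g"
  moreover have "f \<in> l2_class m f" using assms by (auto simp: l2_class_def)
  ultimately show "AE x in m. f x = g x" by (auto simp: l2_class_def)
qed (rule l2_class_cong)

lemma l2_add_class:
  assumes "f \<in> sq_integrable m" "g \<in> sq_integrable m"
  shows "l2_add m (l2_class m f) (l2_class m g) = l2_class m (\<lambda>x. f x + g x)"
  unfolding l2_add_def
  using l2_rep_class(2)[OF assms(1)] l2_rep_class(2)[OF assms(2)] by (intro l2_class_cong) auto

lemma l2_scale_class:
  assumes "f \<in> sq_integrable m"
  shows "l2_scale m c (l2_class m f) = l2_class m (\<lambda>x. c * f x)"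
  unfolding l2_scale_def using l2_rep_class(2)[OF assms] by (intro l2_class_cong) auto

lemma l2_norm_class:
  assumes "f \<in> sq_integrable m"
  shows "l2_norm m (l2_class m f) = snorm m f"
  unfolding l2_norm_def snorm_def[symmetric]
  using l2_rep_class[OF assms] assms by (intro snorm_cong_AE) (auto simp: sq_integrable_def)

lemma l2_dist_rep:
  assumes "u \<in> L2 m" "v \<in> L2 m"
  shows "l2_dist m u v = snorm m (\<lambda>x. l2_rep u x - l2_rep v x)"
proof -
  note u = L2_rep[OF assms(1)] and v = L2_rep[OF assms(2)]
  have "l2_dist m u v = l2_norm m (l2_add m (l2_class m (l2_rep u)) (l2_scale m (-1) (l2_class m (l2_rep v))))"
    by (simp only: l2_dist_def u(2) v(2))
  also have "\<dots> = snorm m (\<lambda>x. l2_rep u x + (-1) * l2_rep v x)"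
    by (simp only: l2_scale_class l2_add_class l2_norm_class sq_integrable_scale sq_integrable_add u(1) v(1))
  finally show ?thesis by simp
qed

definition op_fun :: "'a measure \<Rightarrow> ('a, 'b) l2_op \<Rightarrow> ('a \<Rightarrow> complex) \<Rightarrow> 'b \<Rightarrow> complex" where
  "op_fun m T f = l2_rep (T (l2_class m f))"

text \<open>The value of \<open>T\<close> on the elementary tensor \<open>f \<otimes> g\<close>. There
  is no conjugation, so the form is bilinear.\<close>
definition form :: "'a measure \<Rightarrow> 'b measure \<Rightarrow> ('a, 'b) l2_op \<Rightarrow> ('a \<Rightarrow> complex) \<Rightarrow> ('b \<Rightarrow> complex) \<Rightarrow> complex" where
  "form m n T f g = (LINT y|n. op_fun m T f y * g y)"

lemma bounded_ops_L2: "T \<in> bounded_ops m n \<Longrightarrow> u \<in> L2 m \<Longrightarrow> T u \<in> L2 n"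
  by (auto simp: bounded_ops_def)

lemma op_fun:
  assumes "T \<in> bounded_ops m n" "f \<in> sq_integrable m"
  shows "op_fun m T f \<in> sq_integrable n" "l2_class n (op_fun m T f) = T (l2_class m f)"
  using L2_rep[OF bounded_ops_L2[OF assms(1) l2_class_in_L2[OF assms(2)]]] by (auto simp: op_fun_def)

lemma op_fun_add:
  assumes T: "T \<in> bounded_ops m n" and f: "f \<in> sq_integrable m" and g: "g \<in> sq_integrable m"
  shows "AE y in n. op_fun m T (\<lambda>x. f x + g x) y = op_fun m T f y + op_fun m T g y"
proof -
  note fg = sq_integrable_add[OF f g]
  have "l2_class n (op_fun m T (\<lambda>x. f x + g x)) = T (l2_add m (l2_class m f) (l2_class m g))"
    using op_fun(2)[OF T fg] l2_add_class[OF f g] by simp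
  also have "\<dots> = l2_add n (T (l2_class m f)) (T (l2_class m g))"
    using T f g unfolding bounded_ops_def by simp
  also have "\<dots> = l2_class n (\<lambda>y. op_fun m T f y + op_fun m T g y)"
    using l2_add_class[OF op_fun(1)[OF T f] op_fun(1)[OF T g]] op_fun(2)[OF T f] op_fun(2)[OF T g] by simp
  finally show ?thesis
    by (rule l2_class_eq_iff[OF op_fun(1)[OF T fg] sq_integrable_add[OF op_fun(1)[OF T f] op_fun(1)[OF T g]], THEN iffD1])
qed

lemma op_fun_scale:
  assumes T: "T \<in> bounded_ops m n" and f: "f \<in> sq_integrable m"
  shows "AE y in n. op_fun m T (\<lambda>x. c * f x) y = c * op_fun m T f y"
proof -
  note cf = sq_integrable_scale[OF f]
  have "l2_class n (op_fun m T (\<lambda>x. c * f x)) = T (l2_scale m c (l2_class m f))"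
    using op_fun(2)[OF T cf] l2_scale_class[OF f] by simp
  also have "\<dots> = l2_scale n c (T (l2_class m f))"
    using T f unfolding bounded_ops_def by simp
  also have "\<dots> = l2_class n (\<lambda>y. c * op_fun m T f y)"
    using l2_scale_class[OF op_fun(1)[OF T f]] op_fun(2)[OF T f] by simp
  finally show ?thesis
    by (rule l2_class_eq_iff[OF op_fun(1)[OF T cf] sq_integrable_scale[OF op_fun(1)[OF T f]], THEN iffD1])
qed

lemma op_fun_cong: "AE x in m. f x = g x \<Longrightarrow> op_fun m T f = op_fun m T g"
  unfolding op_fun_def by (simp add: l2_class_cong)

lemma op_fun_bound:
  assumes "T \<in> bounded_ops m n"
  obtains C where "0 \<le> C" "\<And>f. f \<in> sq_integrable m \<Longrightarrow> snorm n (op_fun m T f) \<le> C * snorm m f"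
proof -
  obtain C where C: "\<And>u. u \<in> L2 m \<Longrightarrow> l2_norm n (T u) \<le> C * l2_norm m u"
    using assms unfolding bounded_ops_def by blast
  have "snorm n (op_fun m T f) \<le> \<bar>C\<bar> * snorm m f" if f: "f \<in> sq_integrable m" for f
  proof -
    have "snorm n (op_fun m T f) = l2_norm n (T (l2_class m f))"
      using l2_norm_class[OF op_fun(1)[OF assms f]] op_fun(2)[OF assms f] by simp
    also have "\<dots> \<le> C * snorm m f"
      using C[OF l2_class_in_L2[OF f]] l2_norm_class[OF f] by simp
    also have "\<dots> \<le> \<bar>C\<bar> * snorm m f" by (rule mult_right_mono) auto
    finally show ?thesis .
  qed
  then show thesis by (intro that[of "\<bar>C\<bar>"]) auto
qed

lemma form_bound:
  assumes T: "T \<in> bounded_ops m n"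
  obtains C where "0 \<le> C"
    "\<And>f g. f \<in> sq_integrable m \<Longrightarrow> g \<in> sq_integrable n \<Longrightarrow> cmod (form m n T f g) \<le> C * snorm m f * snorm n g"
proof -
  obtain C where C: "0 \<le> C" "\<And>f. f \<in> sq_integrable m \<Longrightarrow> snorm n (op_fun m T f) \<le> C * snorm m f"
    using op_fun_bound[OF T] by blast
  have "cmod (form m n T f g) \<le> C * snorm m f * snorm n g" if "f \<in> sq_integrable m" "g \<in> sq_integrable n" for f g
    using sq_integrable_product(3)[OF op_fun(1)[OF T that(1)] that(2)] mult_right_mono[OF C(2)[OF that(1)] snorm_nonneg[of n g]]
    by (simp add: form_def)
  with C(1) show thesis by (rule that)
qed

lemma form_cong:
  assumes "AE x in m. f x = f' x" "AE y in n. g y = g' y" "T \<in> bounded_ops m n" "f \<in> sq_integrable m"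
    "g \<in> sq_integrable n" "g' \<in> sq_integrable n"
  shows "form m n T f g = form m n T f' g'"
  unfolding form_def op_fun_cong[OF assms(1), symmetric]
  using assms(2) sq_integrableD(1)[OF op_fun(1)[OF assms(3,4)]] sq_integrableD(1)[OF assms(5)] sq_integrableD(1)[OF assms(6)]
  by (intro integral_cong_AE) auto

lemma form_add_left:
  assumes T: "T \<in> bounded_ops m n" and f: "f \<in> sq_integrable m" and f': "f' \<in> sq_integrable m" and g: "g \<in> sq_integrable n"
  shows "form m n T (\<lambda>x. f x + f' x) g = form m n T f g + form m n T f' g"
proof -
  note s = op_fun(1)[OF T]
  have "form m n T (\<lambda>x. f x + f' x) g = (LINT y|n. op_fun m T f y * g y + op_fun m T f' y * g y)"
    unfolding form_def
    using op_fun_add[OF T f f'] sq_integrableD(1)[OF s[OF f]] sq_integrableD(1)[OF s[OF f']]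
      sq_integrableD(1)[OF s[OF sq_integrable_add[OF f f']]] sq_integrableD(1)[OF g]
    by (intro integral_cong_AE) (auto simp: algebra_simps)
  also have "\<dots> = form m n T f g + form m n T f' g"
    unfolding form_def by (intro Bochner_Integration.integral_add sq_integrable_product s f f' g)
  finally show ?thesis .
qed

lemma form_scale_left:
  assumes T: "T \<in> bounded_ops m n" and f: "f \<in> sq_integrable m" and g: "g \<in> sq_integrable n"
  shows "form m n T (\<lambda>x. c * f x) g = c * form m n T f g"
proof -
  note s = op_fun(1)[OF T]
  have "form m n T (\<lambda>x. c * f x) g = (LINT y|n. c * (op_fun m T f y * g y))"
    unfolding form_def
    using op_fun_scale[OF T f, of c] sq_integrableD(1)[OF s[OF f]] 
      sq_integrableD(1)[OF s[OF sq_integrable_scale[OF f]]] sq_integrableD(1)[OF g]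
    by (intro integral_cong_AE) (auto simp: algebra_simps)
  then show ?thesis by (simp add: form_def)
qed

lemma form_add_right:
  assumes T: "T \<in> bounded_ops m n" and f: "f \<in> sq_integrable m" and g: "g \<in> sq_integrable n" and g': "g' \<in> sq_integrable n"
  shows "form m n T f (\<lambda>y. g y + g' y) = form m n T f g + form m n T f g'"
  unfolding form_def distrib_left
  by (intro Bochner_Integration.integral_add sq_integrable_product op_fun(1)[OF T f] g g')

lemma form_scale_right: "form m n T f (\<lambda>y. c * g y) = c * form m n T f g"
  unfolding form_def by (simp add: mult.left_commute)

lemma form_zero_right [simp]: "form m n T f (\<lambda>y. 0) = 0"
  by (simp add: form_def)

lemma pairing_eq_form:
  assumes T: "T \<in> bounded_ops m n" and f: "\<And>i. f i \<in> sq_integrable m" and g: "\<And>i. g i \<in> sq_integrable n"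
  shows "pairing m n T f g = (\<Sum>i. form m n T (f i) (g i))"
proof -
  have "l2_inner n (T (l2_class m (f i))) (l2_class n (\<lambda>y. cnj (g i y))) = form m n T (f i) (g i)" for i
    unfolding l2_inner_def form_def op_fun_def[symmetric]
  proof (rule integral_cong_AE)
    note [measurable] = sq_integrableD(1)[OF op_fun(1)[OF T f[of i]]] sq_integrableD(1)[OF g[of i]]
      sq_integrableD(1)[OF l2_rep_class(1)[OF sq_integrable_cnj[OF g[of i]]]]
    show "(\<lambda>y. op_fun m T (f i) y * cnj (l2_rep (l2_class n (\<lambda>y. cnj (g i y))) y)) \<in> borel_measurable n"
      "(\<lambda>y. op_fun m T (f i) y * g i y) \<in> borel_measurable n"
      by measurable
    show "AE y in n. op_fun m T (f i) y * cnj (l2_rep (l2_class n (\<lambda>y. cnj (g i y))) y) = op_fun m T (f i) y * g i y"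
      using l2_rep_class(2)[OF sq_integrable_cnj[OF g[of i]]] by eventually_elim simp
  qed
  then show ?thesis by (simp add: pairing_def)
qed

text \<open>Testing against the conjugate of the difference of the two images shows that the form
  determines the operator.\<close>
lemma bounded_ops_eqI:
  assumes S: "S \<in> bounded_ops m n" and T: "T \<in> bounded_ops m n"
    and eq: "\<And>f g. f \<in> sq_integrable m \<Longrightarrow> g \<in> sq_integrable n \<Longrightarrow> form m n S f g = form m n T f g"
  shows "S = T"
proof
  fix u
  show "S u = T u"
  proof (cases "u \<in> L2 m")
    case False
    have "S \<in> extensional (L2 m)" "T \<in> extensional (L2 m)"
      using S T by (auto simp: bounded_ops_def PiE_def)
    then show ?thesis
      using False extensional_arb[of S "L2 m" u] extensional_arb[of T "L2 m" u] by simp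
  next
    case True
    define f where "f = l2_rep u"
    have f: "f \<in> sq_integrable m" "l2_class m f = u" using L2_rep[OF True] by (auto simp: f_def)
    note s = op_fun(1)[OF S f(1)] and t = op_fun(1)[OF T f(1)]
    define d where "d y = op_fun m S f y - op_fun m T f y" for y
    have d: "d \<in> sq_integrable n" unfolding d_def by (rule sq_integrable_diff[OF s t])
    note [measurable] = sq_integrableD(1)[OF d]
    have "(LINT y|n. op_fun m S f y * cnj (d y) - op_fun m T f y * cnj (d y)) = 0"
      using eq[OF f(1) sq_integrable_cnj[OF d]]
        Bochner_Integration.integral_diff[OF sq_integrable_product(1)[OF s sq_integrable_cnj[OF d]]
          sq_integrable_product(1)[OF t sq_integrable_cnj[OF d]]]
      by (simp add: form_def)
    then have "(LINT y|n. d y * cnj (d y)) = 0"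
      by (simp only: left_diff_distrib[symmetric] d_def[symmetric])
    then have "(LINT y|n. complex_of_real ((cmod (d y))\<^sup>2)) = 0"
      by (simp only: complex_norm_square)
    then have "(LINT y|n. (cmod (d y))\<^sup>2) = 0"
      by (simp only: integral_complex_of_real of_real_eq_0_iff)
    then have "AE y in n. (cmod (d y))\<^sup>2 = 0"
      using integral_nonneg_eq_0_iff_AE[OF sq_integrableD(2)[OF d]] by simp
    then have "l2_class n (op_fun m S f) = l2_class n (op_fun m T f)"
      by (intro l2_class_cong) (auto simp: d_def)
    then show ?thesis using op_fun(2)[OF S f(1)] op_fun(2)[OF T f(1)] f(2) by simp
  qed
qed

section \<open>Algebra of bounded operators and the pairing\<close>

definition op_of :: "'a measure \<Rightarrow> 'b measure \<Rightarrow> (('a \<Rightarrow> complex) \<Rightarrow> 'b \<Rightarrow> complex) \<Rightarrow> ('a, 'b) l2_op" where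
  "op_of m n t = (\<lambda>u\<in>L2 m. l2_class n (t (l2_rep u)))"

text \<open>What a map on square integrable functions must satisfy, up to null sets, in order to induce
  a bounded operator on the classes.\<close>
definition l2_map :: "'a measure \<Rightarrow> 'b measure \<Rightarrow> (('a \<Rightarrow> complex) \<Rightarrow> 'b \<Rightarrow> complex) \<Rightarrow> bool" where
  "l2_map m n t \<longleftrightarrow>
     (\<forall>f\<in>sq_integrable m. t f \<in> sq_integrable n) \<and>
     (\<forall>f\<in>sq_integrable m. \<forall>g\<in>sq_integrable m. AE y in n. t (\<lambda>x. f x + g x) y = t f y + t g y) \<and>
     (\<forall>f\<in>sq_integrable m. \<forall>c. AE y in n. t (\<lambda>x. c * f x) y = c * t f y) \<and>
     (\<forall>f\<in>sq_integrable m. \<forall>g\<in>sq_integrable m. (AE x in m. f x = g x) \<longrightarrow> (AE y in n. t f y = t g y)) \<and>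
     (\<exists>C. \<forall>f\<in>sq_integrable m. snorm n (t f) \<le> C * snorm m f)"

lemma l2_mapI:
  assumes "\<And>f. f \<in> sq_integrable m \<Longrightarrow> t f \<in> sq_integrable n"
    and "\<And>f g. f \<in> sq_integrable m \<Longrightarrow> g \<in> sq_integrable m \<Longrightarrow>
      AE y in n. t (\<lambda>x. f x + g x) y = t f y + t g y"
    and "\<And>f c. f \<in> sq_integrable m \<Longrightarrow> AE y in n. t (\<lambda>x. c * f x) y = c * t f y"
    and "\<And>f g. AE x in m. f x = g x \<Longrightarrow> AE y in n. t f y = t g y"
    and "\<And>f. f \<in> sq_integrable m \<Longrightarrow> snorm n (t f) \<le> C * snorm m f"
  shows "l2_map m n t"
  unfolding l2_map_def using assms by blast

lemma op_of:
  assumes map: "l2_map m n t"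
  shows "op_of m n t \<in> bounded_ops m n"
    and "\<And>f. f \<in> sq_integrable m \<Longrightarrow> AE y in n. op_fun m (op_of m n t) f y = t f y"
    and "\<And>f g. f \<in> sq_integrable m \<Longrightarrow> g \<in> sq_integrable n \<Longrightarrow>
      form m n (op_of m n t) f g = (LINT y|n. t f y * g y)"
proof -
  have sq: "\<And>f. f \<in> sq_integrable m \<Longrightarrow> t f \<in> sq_integrable n"
    and add: "\<And>f g. f \<in> sq_integrable m \<Longrightarrow> g \<in> sq_integrable m \<Longrightarrow>
      AE y in n. t (\<lambda>x. f x + g x) y = t f y + t g y"
    and scale: "\<And>f c. f \<in> sq_integrable m \<Longrightarrow> AE y in n. t (\<lambda>x. c * f x) y = c * t f y"
    and cong: "\<And>f g. f \<in> sq_integrable m \<Longrightarrow> g \<in> sq_integrable m \<Longrightarrow> AE x in m. f x = g x \<Longrightarrow>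
      AE y in n. t f y = t g y"
    using map by (simp_all add: l2_map_def)
  obtain C where bound: "\<And>f. f \<in> sq_integrable m \<Longrightarrow> snorm n (t f) \<le> C * snorm m f"
    using map unfolding l2_map_def by blast
  have val: "op_of m n t (l2_class m f) = l2_class n (t f)" if f: "f \<in> sq_integrable m" for f
    using l2_class_in_L2[OF f] l2_class_cong[OF cong[OF l2_rep_class(1)[OF f] f l2_rep_class(2)[OF f]]]
    by (simp add: op_of_def)
  have L2: "\<exists>f\<in>sq_integrable m. u = l2_class m f" if "u \<in> L2 m" for u
    using that by (auto simp: L2_def)
  show bd: "op_of m n t \<in> bounded_ops m n"
    unfolding bounded_ops_def
  proof (intro CollectI conjI ballI allI)
    show "op_of m n t \<in> L2 m \<rightarrow>\<^sub>E L2 n"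
    proof
      fix u assume "u \<in> L2 m"
      then obtain f where "f \<in> sq_integrable m" "u = l2_class m f" using L2 by blast
      then show "op_of m n t u \<in> L2 n" by (simp add: val sq)
    qed (simp add: op_of_def)
    fix u assume "u \<in> L2 m"
    then obtain f where f: "f \<in> sq_integrable m" "u = l2_class m f" using L2 by blast
    { fix v assume "v \<in> L2 m"
      then obtain g where g: "g \<in> sq_integrable m" "v = l2_class m g" using L2 by blast
      show "op_of m n t (l2_add m u v) = l2_add n (op_of m n t u) (op_of m n t v)"
        using l2_class_cong[OF add[OF f(1) g(1)]]
        by (simp add: f g l2_add_class val sq sq_integrable_add) }
    { fix c
      show "op_of m n t (l2_scale m c u) = l2_scale n c (op_of m n t u)"
        using l2_class_cong[OF scale[OF f(1)]]
        by (simp add: f l2_scale_class val sq sq_integrable_scale) }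
  next
    show "\<exists>C. \<forall>u\<in>L2 m. l2_norm n (op_of m n t u) \<le> C * l2_norm m u"
    proof (intro exI ballI)
      fix u assume "u \<in> L2 m"
      then obtain f where "f \<in> sq_integrable m" "u = l2_class m f" using L2 by blast
      then show "l2_norm n (op_of m n t u) \<le> C * l2_norm m u"
        by (simp add: val l2_norm_class sq bound)
    qed
  qed
  show ae: "AE y in n. op_fun m (op_of m n t) f y = t f y" if f: "f \<in> sq_integrable m" for f
    using l2_rep_class(2)[OF sq[OF f]] by (simp add: op_fun_def val f)
  show "form m n (op_of m n t) f g = (LINT y|n. t f y * g y)"
    if f: "f \<in> sq_integrable m" and g: "g \<in> sq_integrable n" for f g
    unfolding form_def
  proof (rule integral_cong_AE)
    note [measurable] = sq_integrableD(1)[OF op_fun(1)[OF bd f]] sq_integrableD(1)[OF sq[OF f]]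
      sq_integrableD(1)[OF g]
    show "(\<lambda>y. op_fun m (op_of m n t) f y * g y) \<in> borel_measurable n"
      "(\<lambda>y. t f y * g y) \<in> borel_measurable n" by measurable
    show "AE y in n. op_fun m (op_of m n t) f y * g y = t f y * g y"
      using ae[OF f] by eventually_elim simp
  qed
qed

lemma op_fun_rep: "u \<in> L2 m \<Longrightarrow> op_fun m T (l2_rep u) = l2_rep (T u)"
  by (simp add: op_fun_def L2_rep)

lemma op_zero_form:
  shows "op_zero m n \<in> bounded_ops m n"
    and "f \<in> sq_integrable m \<Longrightarrow> g \<in> sq_integrable n \<Longrightarrow> form m n (op_zero m n) f g = 0"
proof -
  have eq: "op_zero m n = op_of m n (\<lambda>f y. 0)" by (simp add: op_zero_def op_of_def l2_zero_def)
  have *: "snorm n (\<lambda>y. 0) \<le> 0 * snorm m f" for f by (simp add: snorm_def)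
  note t = op_of[OF l2_mapI[where m=m and n=n and t="\<lambda>f y. 0" and C=0, OF _ _ _ _ *]]
  show "op_zero m n \<in> bounded_ops m n" unfolding eq by (rule t) auto
  show "form m n (op_zero m n) f g = 0" if "f \<in> sq_integrable m" "g \<in> sq_integrable n"
    unfolding eq by (subst t(3)) (use that in auto)
qed

lemma op_scale_form:
  assumes T: "T \<in> bounded_ops m n"
  shows "op_scale m n c T \<in> bounded_ops m n"
    and "f \<in> sq_integrable m \<Longrightarrow> g \<in> sq_integrable n \<Longrightarrow>
      form m n (op_scale m n c T) f g = c * form m n T f g"
proof -
  have eq: "op_scale m n c T = op_of m n (\<lambda>f y. c * op_fun m T f y)"
    unfolding op_scale_def op_of_def by (intro restrict_ext) (simp add: l2_scale_def op_fun_rep)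
  obtain C where C: "\<And>f. f \<in> sq_integrable m \<Longrightarrow> snorm n (op_fun m T f) \<le> C * snorm m f"
    using op_fun_bound[OF T] by blast
  have 0: "(\<lambda>y. c * op_fun m T f y) \<in> sq_integrable n" if "f \<in> sq_integrable m" for f
    by (intro sq_integrable_scale op_fun(1)[OF T] that)
  have 1: "AE y in n. c * op_fun m T (\<lambda>x. f x + g x) y = c * op_fun m T f y + c * op_fun m T g y"
    if "f \<in> sq_integrable m" "g \<in> sq_integrable m" for f g
    using op_fun_add[OF T that] by eventually_elim (simp add: distrib_left)
  have 2: "AE y in n. c * op_fun m T (\<lambda>x. d * f x) y = d * (c * op_fun m T f y)"
    if "f \<in> sq_integrable m" for f d
    using op_fun_scale[OF T that, of d] by eventually_elim simp
  have 3: "AE y in n. c * op_fun m T f y = c * op_fun m T g y"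
    if "AE x in m. f x = g x" for f g using op_fun_cong[OF that, where T=T] by simp
  have 4: "snorm n (\<lambda>y. c * op_fun m T f y) \<le> (cmod c * C) * snorm m f" if "f \<in> sq_integrable m" for f
    using mult_left_mono[OF C[OF that], of "cmod c"] by (simp add: snorm_scale mult.assoc)
  have "l2_map m n (\<lambda>f y. c * op_fun m T f y)" by (rule l2_mapI) (fact 0 1 2 3 4)+
  note t = op_of[OF this]
  show "op_scale m n c T \<in> bounded_ops m n" unfolding eq by (rule t)
  show "form m n (op_scale m n c T) f g = c * form m n T f g"
    if "f \<in> sq_integrable m" "g \<in> sq_integrable n"
    unfolding eq by (subst t(3)[OF that]) (simp add: form_def mult.assoc)
qed

lemma snorm_add_le:
  assumes f: "f \<in> sq_integrable m" and g: "g \<in> sq_integrable m"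
  shows "snorm m (\<lambda>x. f x + g x) \<le> snorm m f + snorm m g"
proof (rule power2_le_imp_le)
  note fi = sq_integrableD(2)[OF f] and gi = sq_integrableD(2)[OF g]
  have i: "integrable m (\<lambda>x. cmod (f x * g x))"
    by (rule integrable_norm[OF sq_integrable_product(1)[OF f g]])
  have "(snorm m (\<lambda>x. f x + g x))\<^sup>2 \<le> (LINT x|m. ((cmod (f x))\<^sup>2 + (cmod (g x))\<^sup>2) + 2 * cmod (f x * g x))"
    unfolding snorm_square
  proof (rule integral_mono)
    show "integrable m (\<lambda>x. (cmod (f x + g x))\<^sup>2)"
      by (rule sq_integrableD(2)[OF sq_integrable_add[OF f g]])
    show "integrable m (\<lambda>x. ((cmod (f x))\<^sup>2 + (cmod (g x))\<^sup>2) + 2 * cmod (f x * g x))"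
      using fi gi i by (intro Bochner_Integration.integrable_add integrable_mult_right)
    show "(cmod (f x + g x))\<^sup>2 \<le> ((cmod (f x))\<^sup>2 + (cmod (g x))\<^sup>2) + 2 * cmod (f x * g x)" for x
      using power_mono[OF norm_triangle_ineq[of "f x" "g x"], of 2] by (simp add: power2_sum norm_mult)
  qed
  also have "\<dots> = (snorm m f)\<^sup>2 + (snorm m g)\<^sup>2 + 2 * (LINT x|m. cmod (f x * g x))"
    using fi gi i by simp
  also have "\<dots> \<le> (snorm m f + snorm m g)\<^sup>2"
    using sq_integrable_product(2)[OF f g] unfolding power2_sum by linarith
  finally show "(snorm m (\<lambda>x. f x + g x))\<^sup>2 \<le> (snorm m f + snorm m g)\<^sup>2" .
qed simp

lemma op_add_form:
  assumes S: "S \<in> bounded_ops m n" and T: "T \<in> bounded_ops m n"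
  shows "op_add m n S T \<in> bounded_ops m n"
    and "f \<in> sq_integrable m \<Longrightarrow> g \<in> sq_integrable n \<Longrightarrow>
      form m n (op_add m n S T) f g = form m n S f g + form m n T f g"
proof -
  have eq: "op_add m n S T = op_of m n (\<lambda>f y. op_fun m S f y + op_fun m T f y)"
    unfolding op_add_def op_of_def by (intro restrict_ext) (simp add: l2_add_def op_fun_rep)
  obtain C where C: "\<And>f. f \<in> sq_integrable m \<Longrightarrow> snorm n (op_fun m S f) \<le> C * snorm m f"
    using op_fun_bound[OF S] by blast
  obtain D where D: "\<And>f. f \<in> sq_integrable m \<Longrightarrow> snorm n (op_fun m T f) \<le> D * snorm m f"
    using op_fun_bound[OF T] by blast
  have 1: "AE y in n. op_fun m S (\<lambda>x. f x + g x) y + op_fun m T (\<lambda>x. f x + g x) y =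
      (op_fun m S f y + op_fun m T f y) + (op_fun m S g y + op_fun m T g y)"
    if "f \<in> sq_integrable m" "g \<in> sq_integrable m" for f g
    using op_fun_add[OF S that] op_fun_add[OF T that] by eventually_elim simp
  have 2: "AE y in n. op_fun m S (\<lambda>x. d * f x) y + op_fun m T (\<lambda>x. d * f x) y =
      d * (op_fun m S f y + op_fun m T f y)"
    if "f \<in> sq_integrable m" for f d
    using op_fun_scale[OF S that, of d] op_fun_scale[OF T that, of d]
    by eventually_elim (simp add: distrib_left)
  have 3: "AE y in n. op_fun m S f y + op_fun m T f y = op_fun m S g y + op_fun m T g y"
    if "AE x in m. f x = g x" for f g
    using op_fun_cong[OF that, of S] op_fun_cong[OF that, of T] by simp
  have 4: "snorm n (\<lambda>y. op_fun m S f y + op_fun m T f y) \<le> (C + D) * snorm m f"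
    if "f \<in> sq_integrable m" for f
    using snorm_add_le[OF op_fun(1)[OF S that] op_fun(1)[OF T that]] C[OF that] D[OF that]
    by (simp add: distrib_right)
  have 0: "(\<lambda>y. op_fun m S f y + op_fun m T f y) \<in> sq_integrable n" if "f \<in> sq_integrable m" for f
    by (intro sq_integrable_add op_fun(1)[OF S] op_fun(1)[OF T] that)
  have "l2_map m n (\<lambda>f y. op_fun m S f y + op_fun m T f y)" by (rule l2_mapI) (fact 0 1 2 3 4)+
  note t = op_of[OF this]
  show "op_add m n S T \<in> bounded_ops m n" unfolding eq by (rule t)
  show "form m n (op_add m n S T) f g = form m n S f g + form m n T f g"
    if f: "f \<in> sq_integrable m" and g: "g \<in> sq_integrable n"
    unfolding eq t(3)[OF that] unfolding distrib_right form_def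
    by (intro Bochner_Integration.integral_add sq_integrable_product op_fun(1)[OF S f] op_fun(1)[OF T f] g)
qed

lemma Linf_mult_bound:
  assumes c: "c \<in> Linf M"
  shows "\<exists>K\<ge>0. \<forall>h\<in>sq_integrable M. snorm M (\<lambda>x. c x * h x) \<le> K * snorm M h"
proof -
  obtain K0 where K0: "AE x in M. cmod (c x) \<le> K0" using c by (auto simp: Linf_def)
  define K where "K = \<bar>K0\<bar>"
  have K: "AE x in M. cmod (c x) \<le> K" using K0 by eventually_elim (simp add: K_def)
  have "snorm M (\<lambda>x. c x * h x) \<le> K * snorm M h" if h: "h \<in> sq_integrable M" for h
  proof -
    have "(LINT x|M. (cmod (c x * h x))\<^sup>2) \<le> (LINT x|M. K\<^sup>2 * (cmod (h x))\<^sup>2)"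
    proof (rule integral_mono_AE)
      show "integrable M (\<lambda>x. (cmod (c x * h x))\<^sup>2)"
        by (rule sq_integrableD(2)[OF Linf_mult_sq_integrable[OF c h]])
      show "integrable M (\<lambda>x. K\<^sup>2 * (cmod (h x))\<^sup>2)"
        using sq_integrableD(2)[OF h] by simp
      show "AE x in M. (cmod (c x * h x))\<^sup>2 \<le> K\<^sup>2 * (cmod (h x))\<^sup>2"
        using K by eventually_elim
          (simp add: norm_mult power_mult_distrib mult_right_mono power_mono)
    qed
    then have "snorm M (\<lambda>x. c x * h x) \<le> sqrt (K\<^sup>2 * (LINT x|M. (cmod (h x))\<^sup>2))"
      by (simp add: snorm_def)
    then show ?thesis by (simp add: real_sqrt_mult snorm_def K_def)
  qed
  then show ?thesis by (intro exI[of _ K]) (simp add: K_def)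
qed

lemma mult_sandwich_form:
  assumes T: "T \<in> bounded_ops m n" and a: "a \<in> Linf m" and b: "b \<in> Linf n"
  shows "mult_sandwich m n b T a \<in> bounded_ops m n"
    and "f \<in> sq_integrable m \<Longrightarrow> g \<in> sq_integrable n \<Longrightarrow>
      form m n (mult_sandwich m n b T a) f g = form m n T (\<lambda>x. a x * f x) (\<lambda>y. b y * g y)"
proof -
  note am = Linf_mult_sq_integrable[OF a] and bm = Linf_mult_sq_integrable[OF b]
  have eq: "mult_sandwich m n b T a = op_of m n (\<lambda>f y. b y * op_fun m T (\<lambda>x. a x * f x) y)"
    unfolding mult_sandwich_def op_of_def compose_def
  proof (intro restrict_ext)
    fix u assume u: "u \<in> L2 m"
    then have "T (l2_class m (\<lambda>x. a x * l2_rep u x)) \<in> L2 n"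
      by (intro bounded_ops_L2[OF T] l2_class_in_L2 am L2_rep)
    then show "mult_op n b (restrict (\<lambda>u. T (mult_op m a u)) (L2 m) u) =
        l2_class n (\<lambda>y. b y * op_fun m T (\<lambda>x. a x * l2_rep u x) y)"
      using u by (simp add: mult_op_def op_fun_def)
  qed
  obtain C where C: "0 \<le> C" "\<And>f. f \<in> sq_integrable m \<Longrightarrow> snorm n (op_fun m T f) \<le> C * snorm m f"
    using op_fun_bound[OF T] by blast
  obtain Ka where Ka: "\<And>h. h \<in> sq_integrable m \<Longrightarrow> snorm m (\<lambda>x. a x * h x) \<le> Ka * snorm m h"
    using Linf_mult_bound[OF a] by blast
  obtain Kb where Kb: "0 \<le> Kb" "\<And>h. h \<in> sq_integrable n \<Longrightarrow> snorm n (\<lambda>x. b x * h x) \<le> Kb * snorm n h"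
    using Linf_mult_bound[OF b] by blast
  have 0: "(\<lambda>y. b y * op_fun m T (\<lambda>x. a x * f x) y) \<in> sq_integrable n" if "f \<in> sq_integrable m" for f
    by (intro bm op_fun(1)[OF T] am that)
  have 1: "AE y in n. b y * op_fun m T (\<lambda>x. a x * (f x + g x)) y =
      b y * op_fun m T (\<lambda>x. a x * f x) y + b y * op_fun m T (\<lambda>x. a x * g x) y"
    if "f \<in> sq_integrable m" "g \<in> sq_integrable m" for f g
    using op_fun_add[OF T am[OF that(1)] am[OF that(2)]] by eventually_elim (simp add: distrib_left)
  have 2: "AE y in n. b y * op_fun m T (\<lambda>x. a x * (d * f x)) y = d * (b y * op_fun m T (\<lambda>x. a x * f x) y)"
    if "f \<in> sq_integrable m" for f d
    using op_fun_scale[OF T am[OF that], of d] unfolding mult.left_commute[of _ d]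
    by eventually_elim (simp add: mult.left_commute)
  have 3: "AE y in n. b y * op_fun m T (\<lambda>x. a x * f x) y = b y * op_fun m T (\<lambda>x. a x * g x) y"
    if "AE x in m. f x = g x" for f g
  proof -
    have "AE x in m. a x * f x = a x * g x" using that by eventually_elim simp
    from op_fun_cong[OF this, where T=T] show ?thesis by simp
  qed
  have 4: "snorm n (\<lambda>y. b y * op_fun m T (\<lambda>x. a x * f x) y) \<le> (Kb * (C * Ka)) * snorm m f"
    if f: "f \<in> sq_integrable m" for f
  proof -
    have "snorm n (\<lambda>y. b y * op_fun m T (\<lambda>x. a x * f x) y) \<le> Kb * snorm n (op_fun m T (\<lambda>x. a x * f x))"
      by (rule Kb(2)[OF op_fun(1)[OF T am[OF f]]])
    also have "\<dots> \<le> Kb * (C * snorm m (\<lambda>x. a x * f x))"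
      by (rule mult_left_mono[OF C(2)[OF am[OF f]] Kb(1)])
    also have "\<dots> \<le> Kb * (C * (Ka * snorm m f))"
      by (intro mult_left_mono Ka f C Kb)
    finally show ?thesis by (simp add: mult.assoc)
  qed
  have "l2_map m n (\<lambda>f y. b y * op_fun m T (\<lambda>x. a x * f x) y)" by (rule l2_mapI) (fact 0 1 2 3 4)+
  note t = op_of[OF this]
  show "mult_sandwich m n b T a \<in> bounded_ops m n" unfolding eq by (rule t)
  show "form m n (mult_sandwich m n b T a) f g = form m n T (\<lambda>x. a x * f x) (\<lambda>y. b y * g y)"
    if f: "f \<in> sq_integrable m" and g: "g \<in> sq_integrable n"
    unfolding eq t(3)[OF that] unfolding form_def by (simp add: mult_ac)
qed

lemma nuclear_pairD:
  assumes "nuclear_pair m n f g"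
  shows "f i \<in> sq_integrable m" "g i \<in> sq_integrable n"
    "summable (\<lambda>i. (snorm m (f i))\<^sup>2)" "summable (\<lambda>i. (snorm n (g i))\<^sup>2)"
  using assms by (auto simp: nuclear_pair_def)

text \<open>Cauchy-Schwarz in the summation index, on top of the boundedness of the form.\<close>
lemma pairing_bound:
  assumes T: "T \<in> bounded_ops m n"
  obtains C where "0 \<le> C"
    "\<And>f g. nuclear_pair m n f g \<Longrightarrow> summable (\<lambda>i. cmod (form m n T (f i) (g i)))"
    "\<And>f g. nuclear_pair m n f g \<Longrightarrow> cmod (pairing m n T f g)
       \<le> C * (sqrt (\<Sum>i. (snorm m (f i))\<^sup>2) * sqrt (\<Sum>i. (snorm n (g i))\<^sup>2))"
proof -
  obtain C where C: "0 \<le> C" "\<And>f g. f \<in> sq_integrable m \<Longrightarrow> g \<in> sq_integrable n \<Longrightarrow>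
      cmod (form m n T f g) \<le> C * snorm m f * snorm n g"
    using form_bound[OF T] by blast
  have s: "summable (\<lambda>i. cmod (form m n T (f i) (g i)))"
    and "cmod (pairing m n T f g) \<le> C * (sqrt (\<Sum>i. (snorm m (f i))\<^sup>2) * sqrt (\<Sum>i. (snorm n (g i))\<^sup>2))"
    if fg: "nuclear_pair m n f g" for f g
  proof -
    note cs = suminf_mult_le_sqrt[OF nuclear_pairD(3,4)[OF fg]]
    have le: "cmod (form m n T (f i) (g i)) \<le> C * \<bar>snorm m (f i) * snorm n (g i)\<bar>" for i
      using C(2)[OF nuclear_pairD(1,2)[OF fg], of i i] by (simp add: mult.assoc)
    show s: "summable (\<lambda>i. cmod (form m n T (f i) (g i)))"
      by (rule summable_comparison_test'[OF summable_mult[OF cs(1), of C]]) (use le in auto)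
    have "cmod (pairing m n T f g) = cmod (\<Sum>i. form m n T (f i) (g i))"
      by (simp add: pairing_eq_form[OF T nuclear_pairD(1,2)[OF fg]])
    also have "\<dots> \<le> (\<Sum>i. cmod (form m n T (f i) (g i)))"
      by (rule summable_norm[OF s])
    also have "\<dots> \<le> (\<Sum>i. C * \<bar>snorm m (f i) * snorm n (g i)\<bar>)"
      by (rule suminf_le[OF le s summable_mult[OF cs(1)]])
    also have "\<dots> = C * (\<Sum>i. \<bar>snorm m (f i) * snorm n (g i)\<bar>)"
      by (rule suminf_mult[OF cs(1)])
    also have "\<dots> \<le> C * (sqrt (\<Sum>i. (snorm m (f i))\<^sup>2) * sqrt (\<Sum>i. (snorm n (g i))\<^sup>2))"
      by (rule mult_left_mono[OF cs(2) C(1)])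
    finally show "cmod (pairing m n T f g) \<le> C * (sqrt (\<Sum>i. (snorm m (f i))\<^sup>2) * sqrt (\<Sum>i. (snorm n (g i))\<^sup>2))" .
  qed
  with C(1) show thesis by (rule that)
qed

lemma pairing_sums:
  assumes T: "T \<in> bounded_ops m n" and fg: "nuclear_pair m n f g"
  shows "(\<lambda>i. form m n T (f i) (g i)) sums pairing m n T f g"
  using pairing_bound[OF T] summable_norm_cancel[THEN summable_sums] fg
  unfolding pairing_eq_form[OF T nuclear_pairD(1,2)[OF fg]] by metis

lemma pairing_add:
  assumes S: "S \<in> bounded_ops m n" and T: "T \<in> bounded_ops m n" and fg: "nuclear_pair m n f g"
  shows "pairing m n (op_add m n S T) f g = pairing m n S f g + pairing m n T f g"
proof (rule sums_unique2[OF pairing_sums[OF op_add_form(1)[OF S T] fg]])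
  show "(\<lambda>i. form m n (op_add m n S T) (f i) (g i)) sums (pairing m n S f g + pairing m n T f g)"
    using sums_add[OF pairing_sums[OF S fg] pairing_sums[OF T fg]]
    by (simp add: op_add_form(2)[OF S T] nuclear_pairD[OF fg])
qed

lemma pairing_scale:
  assumes T: "T \<in> bounded_ops m n" and fg: "nuclear_pair m n f g"
  shows "pairing m n (op_scale m n c T) f g = c * pairing m n T f g"
proof (rule sums_unique2[OF pairing_sums[OF op_scale_form(1)[OF T] fg]])
  show "(\<lambda>i. form m n (op_scale m n c T) (f i) (g i)) sums (c * pairing m n T f g)"
    using sums_mult[OF pairing_sums[OF T fg], of c]
    by (simp add: op_scale_form(2)[OF T] nuclear_pairD[OF fg])
qed

lemma nuclear_pair_Linf:
  assumes fg: "nuclear_pair m n f g" and a: "a \<in> Linf m" and b: "b \<in> Linf n"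
  shows "nuclear_pair m n (\<lambda>i x. a x * f i x) (\<lambda>i y. b y * g i y)"
proof -
  have s: "summable (\<lambda>i. (snorm M (\<lambda>x. c x * h i x))\<^sup>2)"
    if c: "c \<in> Linf M" and h: "\<And>i. h i \<in> sq_integrable M" and sum: "summable (\<lambda>i. (snorm M (h i))\<^sup>2)"
    for c and M :: "'c measure" and h :: "nat \<Rightarrow> 'c \<Rightarrow> complex"
  proof -
    obtain K where K: "0 \<le> K" "\<And>h. h \<in> sq_integrable M \<Longrightarrow> snorm M (\<lambda>x. c x * h x) \<le> K * snorm M h"
      using Linf_mult_bound[OF c] by blast
    have "(snorm M (\<lambda>x. c x * h i x))\<^sup>2 \<le> K\<^sup>2 * (snorm M (h i))\<^sup>2" for i
      using power_mono[OF K(2)[OF h[of i]] snorm_nonneg, of 2]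
      by (simp add: power_mult_distrib del: snorm_square)
    then show ?thesis
      by (intro summable_comparison_test'[OF summable_mult[OF sum, of "K\<^sup>2"]]) (simp del: snorm_square)
  qed
  note n = nuclear_pairD[OF fg]
  show ?thesis
    using s[OF a n(1,3)] s[OF b n(2,4)] n(1,2)
    by (auto simp: nuclear_pair_def intro: Linf_mult_sq_integrable a b)
qed

lemma pairing_mult_sandwich:
  assumes T: "T \<in> bounded_ops m n" and a: "a \<in> Linf m" and b: "b \<in> Linf n" and fg: "nuclear_pair m n f g"
  shows "pairing m n (mult_sandwich m n b T a) f g = pairing m n T (\<lambda>i x. a x * f i x) (\<lambda>i y. b y * g i y)"
proof (rule sums_unique2[OF pairing_sums[OF mult_sandwich_form(1)[OF T a b] fg]])
  show "(\<lambda>i. form m n (mult_sandwich m n b T a) (f i) (g i)) sums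
      pairing m n T (\<lambda>i x. a x * f i x) (\<lambda>i y. b y * g i y)"
    using pairing_sums[OF T nuclear_pair_Linf[OF fg a b]]
    by (simp add: mult_sandwich_form(2)[OF T a b] nuclear_pairD[OF fg])
qed

definition single_seq :: "('a \<Rightarrow> complex) \<Rightarrow> nat \<Rightarrow> 'a \<Rightarrow> complex" where
  "single_seq f = (\<lambda>i. if i = 0 then f else (\<lambda>x. 0))"

lemma nuclear_pair_single:
  assumes "f \<in> sq_integrable m" "g \<in> sq_integrable n"
  shows "nuclear_pair m n (single_seq f) (single_seq g)"
  unfolding nuclear_pair_def single_seq_def using assms
  by (auto intro!: summable_finite[of "{0}"] split: if_splits)

lemma tensor_fun_single: "tensor_fun (single_seq f) (single_seq g) = (\<lambda>(x, y). f x * g y)"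
proof -
  have "(\<Sum>i. single_seq f i x * single_seq g i y) = f x * g y" for x y
    by (subst suminf_finite[of "{0}"]) (auto simp: single_seq_def)
  then show ?thesis by (simp add: tensor_fun_def)
qed

lemma pairing_single:
  assumes T: "T \<in> bounded_ops m n" and f: "f \<in> sq_integrable m" and g: "g \<in> sq_integrable n"
  shows "pairing m n T (single_seq f) (single_seq g) = form m n T f g"
proof -
  have "pairing m n T (single_seq f) (single_seq g) = (\<Sum>i. form m n T (single_seq f i) (single_seq g i))"
    by (rule pairing_eq_form[OF T nuclear_pairD(1,2)[OF nuclear_pair_single[OF f g]]])
  also have "\<dots> = form m n T f g"
    by (subst suminf_finite[of "{0}"]) (auto simp: single_seq_def)
  finally show ?thesis .
qed

section \<open>Maximal bimodules, reflexive hulls and separation\<close>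

lemma indicator_sq:
  "A \<in> sets m \<Longrightarrow> f \<in> sq_integrable m \<Longrightarrow> (\<lambda>x. indicator A x * f x) \<in> sq_integrable m"
  by (rule Linf_mult_sq_integrable[OF Linf_indicator])

text \<open>Annihilating the restriction of all elementary tensors to a rectangle is the same as
  vanishing between the corresponding spectral projections; in this form the defining conditions are
  linear, weak* closed, and stable under multiplication from both sides.\<close>
lemma M_max_iff:
  "T \<in> M_max m n \<kappa> \<longleftrightarrow> T \<in> bounded_ops m n \<and>
     (\<forall>\<alpha>\<in>sets m. \<forall>\<beta>\<in>sets n. marginally_null m n ((\<alpha> \<times> \<beta>) \<inter> \<kappa>) \<longrightarrow>
        (\<forall>f\<in>sq_integrable m. \<forall>g\<in>sq_integrable n.
           form m n T (\<lambda>x. indicator \<alpha> x * f x) (\<lambda>y. indicator \<beta> y * g y) = 0))"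
proof -
  have "mult_sandwich m n (indicator \<beta>) T (indicator \<alpha>) = op_zero m n \<longleftrightarrow>
      (\<forall>f\<in>sq_integrable m. \<forall>g\<in>sq_integrable n.
         form m n T (\<lambda>x. indicator \<alpha> x * f x) (\<lambda>y. indicator \<beta> y * g y) = 0)"
    if T: "T \<in> bounded_ops m n" and \<alpha>: "\<alpha> \<in> sets m" and \<beta>: "\<beta> \<in> sets n" for \<alpha> \<beta>
  proof -
    note ms = mult_sandwich_form[OF T Linf_indicator[OF \<alpha>] Linf_indicator[OF \<beta>]]
    show ?thesis
    proof
      assume "mult_sandwich m n (indicator \<beta>) T (indicator \<alpha>) = op_zero m n"
      then show "\<forall>f\<in>sq_integrable m. \<forall>g\<in>sq_integrable n.
         form m n T (\<lambda>x. indicator \<alpha> x * f x) (\<lambda>y. indicator \<beta> y * g y) = 0"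
        using ms(2) op_zero_form(2)[of _ m _ n] by metis
    next
      assume "\<forall>f\<in>sq_integrable m. \<forall>g\<in>sq_integrable n.
         form m n T (\<lambda>x. indicator \<alpha> x * f x) (\<lambda>y. indicator \<beta> y * g y) = 0"
      then show "mult_sandwich m n (indicator \<beta>) T (indicator \<alpha>) = op_zero m n"
        by (intro bounded_ops_eqI[OF ms(1) op_zero_form(1)]) (simp add: ms(2) op_zero_form(2))
    qed
  qed
  then show ?thesis unfolding M_max_def by auto
qed

lemma masa_bimodule_M_max: "masa_bimodule m n (M_max m n \<kappa>)"
  unfolding masa_bimodule_def op_subspace_def
proof (intro conjI ballI allI)
  show "M_max m n \<kappa> \<subseteq> bounded_ops m n" by (auto simp: M_max_def)
  show "op_zero m n \<in> M_max m n \<kappa>"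
    by (simp add: M_max_iff op_zero_form indicator_sq)
next
  fix S T assume "S \<in> M_max m n \<kappa>" "T \<in> M_max m n \<kappa>"
  then show "op_add m n S T \<in> M_max m n \<kappa>"
    by (simp add: M_max_iff op_add_form indicator_sq)
next
  fix c T assume "T \<in> M_max m n \<kappa>"
  then show "op_scale m n c T \<in> M_max m n \<kappa>"
    by (simp add: M_max_iff op_scale_form indicator_sq)
next
  fix a b T assume a: "a \<in> Linf m" and b: "b \<in> Linf n" and T: "T \<in> M_max m n \<kappa>"
  show "mult_sandwich m n b T a \<in> M_max m n \<kappa>"
    unfolding M_max_iff
  proof (intro conjI ballI impI)
    have bd: "T \<in> bounded_ops m n" using T by (simp add: M_max_iff)
    show "mult_sandwich m n b T a \<in> bounded_ops m n" by (rule mult_sandwich_form(1)[OF bd a b])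
    fix \<alpha> \<beta> f g
    assume "\<alpha> \<in> sets m" "\<beta> \<in> sets n" "marginally_null m n ((\<alpha> \<times> \<beta>) \<inter> \<kappa>)"
      and "f \<in> sq_integrable m" "g \<in> sq_integrable n"
    then have "form m n T (\<lambda>x. indicator \<alpha> x * (a x * f x)) (\<lambda>y. indicator \<beta> y * (b y * g y)) = 0"
      and "form m n (mult_sandwich m n b T a) (\<lambda>x. indicator \<alpha> x * f x) (\<lambda>y. indicator \<beta> y * g y)
        = form m n T (\<lambda>x. a x * (indicator \<alpha> x * f x)) (\<lambda>y. b y * (indicator \<beta> y * g y))"
      using T Linf_mult_sq_integrable[OF a] Linf_mult_sq_integrable[OF b]
      by (simp_all add: M_max_iff mult_sandwich_form(2)[OF bd a b] indicator_sq)
    then show "form m n (mult_sandwich m n b T a) (\<lambda>x. indicator \<alpha> x * f x) (\<lambda>y. indicator \<beta> y * g y) = 0"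
      by (simp only: mult.left_commute)
  qed
qed

lemma openin_pairing:
  "nuclear_pair m n f g \<Longrightarrow> open V \<Longrightarrow>
    openin (weak_star_topology m n) {T \<in> bounded_ops m n. pairing m n T f g \<in> V}"
  unfolding weak_star_topology_def by (rule topology_generated_by_Basis) blast

lemma topspace_weak_star [simp]: "topspace (weak_star_topology m n) = bounded_ops m n"
proof
  show "topspace (weak_star_topology m n) \<subseteq> bounded_ops m n"
    unfolding weak_star_topology_def by auto
  have "openin (weak_star_topology m n) (bounded_ops m n)"
    using openin_pairing[OF nuclear_pair_single[OF sq_integrable_zero sq_integrable_zero] open_UNIV, of m n]
    by simp
  then show "bounded_ops m n \<subseteq> topspace (weak_star_topology m n)" by (rule openin_subset)
qed

lemma closedin_M_max: "closedin (weak_star_topology m n) (M_max m n \<kappa>)"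
  unfolding closedin_def topspace_weak_star
proof
  show "M_max m n \<kappa> \<subseteq> bounded_ops m n" by (auto simp: M_max_def)
  show "openin (weak_star_topology m n) (bounded_ops m n - M_max m n \<kappa>)"
  proof (subst openin_subopen, intro ballI)
    fix T assume T: "T \<in> bounded_ops m n - M_max m n \<kappa>"
    then obtain \<alpha> \<beta> f g where \<alpha>: "\<alpha> \<in> sets m" and \<beta>: "\<beta> \<in> sets n"
      and null: "marginally_null m n ((\<alpha> \<times> \<beta>) \<inter> \<kappa>)"
      and f: "f \<in> sq_integrable m" and g: "g \<in> sq_integrable n"
      and nz: "form m n T (\<lambda>x. indicator \<alpha> x * f x) (\<lambda>y. indicator \<beta> y * g y) \<noteq> 0"
      by (auto simp: M_max_iff)
    define f' where "f' = (\<lambda>x. indicator \<alpha> x * f x)"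
    define g' where "g' = (\<lambda>y. indicator \<beta> y * g y)"
    have f': "f' \<in> sq_integrable m" and g': "g' \<in> sq_integrable n"
      using f g \<alpha> \<beta> by (simp_all add: f'_def g'_def indicator_sq)
    define W where "W = {S \<in> bounded_ops m n. pairing m n S (single_seq f') (single_seq g') \<in> - {0}}"
    have "openin (weak_star_topology m n) W"
      unfolding W_def by (intro openin_pairing nuclear_pair_single f' g') auto
    moreover have "T \<in> W" using T nz by (simp add: W_def pairing_single f' g') (simp add: f'_def g'_def)
    moreover have "W \<subseteq> bounded_ops m n - M_max m n \<kappa>"
    proof -
      have "form m n S f' g' = 0" if "S \<in> M_max m n \<kappa>" for S
        using that \<alpha> \<beta> null f g by (simp add: M_max_iff f'_def g'_def)
      then show ?thesis by (auto simp: W_def pairing_single f' g')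
    qed
    ultimately show "\<exists>W. openin (weak_star_topology m n) W \<and> T \<in> W \<and> W \<subseteq> bounded_ops m n - M_max m n \<kappa>"
      by blast
  qed
qed

text \<open>For fixed \<open>f\<close>, the functional \<open>T \<mapsto> \<langle>T, f \<otimes>
  g\<rangle>\<close> depends continuously on the vector \<open>T f\<close>, and \<open>T f\<close> is a
  limit of vectors \<open>S f\<close> with \<open>S\<close> in the given space.\<close>
lemma Ref_form_zero:
  assumes T: "T \<in> Ref m n \<U>" and U: "\<U> \<subseteq> bounded_ops m n"
    and f: "f \<in> sq_integrable m" and g: "g \<in> sq_integrable n"
    and zero: "\<And>S. S \<in> \<U> \<Longrightarrow> form m n S f g = 0"
  shows "form m n T f g = 0"
proof -
  have bd: "T \<in> bounded_ops m n" using T by (simp add: Ref_def)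
  have le: "cmod (form m n T f g) \<le> e * snorm n g" if e: "0 < e" for e
  proof -
    obtain S where S: "S \<in> \<U>" "l2_dist n (T (l2_class m f)) (S (l2_class m f)) < e"
      using T e l2_class_in_L2[OF f] unfolding Ref_def by blast
    then have Sb: "S \<in> bounded_ops m n" using U by blast
    note t = op_fun(1)[OF bd f] and s = op_fun(1)[OF Sb f]
    have "form m n T f g = form m n T f g - form m n S f g" using zero[OF S(1)] by simp
    also have "\<dots> = (LINT y|n. (op_fun m T f y - op_fun m S f y) * g y)"
      unfolding form_def left_diff_distrib
      by (intro Bochner_Integration.integral_diff[symmetric] sq_integrable_product t s g)
    finally have "cmod (form m n T f g) \<le> snorm n (\<lambda>y. op_fun m T f y - op_fun m S f y) * snorm n g"
      using sq_integrable_product(3)[OF sq_integrable_diff[OF t s] g] by simp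
    also have "snorm n (\<lambda>y. op_fun m T f y - op_fun m S f y) = l2_dist n (T (l2_class m f)) (S (l2_class m f))"
      using l2_dist_rep[OF bounded_ops_L2[OF bd l2_class_in_L2[OF f]] bounded_ops_L2[OF Sb l2_class_in_L2[OF f]]]
      by (simp add: op_fun_def)
    also have "\<dots> * snorm n g \<le> e * snorm n g" using S(2) by (intro mult_right_mono) auto
    finally show ?thesis .
  qed
  have "cmod (form m n T f g) \<le> 0"
  proof (rule field_le_epsilon)
    fix e :: real assume e: "0 < e"
    have "cmod (form m n T f g) \<le> e / (snorm n g + 1) * snorm n g"
      using e by (intro le) (auto intro!: divide_pos_pos add_nonneg_pos)
    also have "\<dots> \<le> e / (snorm n g + 1) * (snorm n g + 1)"
      using e by (intro mult_left_mono) auto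
    also have "\<dots> = e" using snorm_nonneg[of n g] by (simp add: add_nonneg_eq_0_iff)
    finally show "cmod (form m n T f g) \<le> 0 + e" by simp
  qed
  then show ?thesis by simp
qed

lemma subset_Ref:
  assumes "\<U> \<subseteq> bounded_ops m n"
  shows "\<U> \<subseteq> Ref m n \<U>"
proof
  fix T assume T: "T \<in> \<U>"
  have "l2_dist n (T u) (T u) = 0" if "u \<in> L2 m" for u
  proof -
    have "T u \<in> L2 n" using assms T that bounded_ops_L2[where m=m and n=n] by blast
    from l2_dist_rep[OF this this] show ?thesis by (simp add: snorm_def)
  qed
  then have "\<exists>S\<in>\<U>. l2_dist n (T u) (S u) < e" if "u \<in> L2 m" "0 < e" for u e
    using T that by (intro bexI[of _ T]) simp_all
  then show "T \<in> Ref m n \<U>" using assms T unfolding Ref_def by blast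
qed

lemma Ref_M_max: "Ref m n (M_max m n \<kappa>) = M_max m n \<kappa>"
proof
  have sub: "M_max m n \<kappa> \<subseteq> bounded_ops m n" by (auto simp: M_max_def)
  then show "M_max m n \<kappa> \<subseteq> Ref m n (M_max m n \<kappa>)" by (rule subset_Ref)
  show "Ref m n (M_max m n \<kappa>) \<subseteq> M_max m n \<kappa>"
  proof
    fix T assume T: "T \<in> Ref m n (M_max m n \<kappa>)"
    show "T \<in> M_max m n \<kappa>"
      unfolding M_max_iff
    proof (intro conjI ballI impI)
      show "T \<in> bounded_ops m n" using T by (simp add: Ref_def)
      fix \<alpha> \<beta> f g
      assume "\<alpha> \<in> sets m" "\<beta> \<in> sets n" "marginally_null m n ((\<alpha> \<times> \<beta>) \<inter> \<kappa>)"
        "f \<in> sq_integrable m" "g \<in> sq_integrable n"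
      then show "form m n T (\<lambda>x. indicator \<alpha> x * f x) (\<lambda>y. indicator \<beta> y * g y) = 0"
        by (intro Ref_form_zero[OF T sub] indicator_sq) (simp_all add: M_max_iff)
    qed
  qed
qed

lemma sums_interleave:
  fixes a b :: "nat \<Rightarrow> complex"
  assumes "a sums x" "b sums y"
  shows "(\<lambda>i. if even i then a (i div 2) else b ((i - 1) div 2)) sums (x + y)"
proof -
  have "(\<lambda>i. Re (if even i then a (i div 2) else b ((i - 1) div 2))) sums (Re y + Re x)"
    using sums_if[of "\<lambda>i. Re (b i)" "Re y" "\<lambda>i. Re (a i)" "Re x"] assms
    by (simp add: sums_complex_iff if_distrib cong: if_cong)
  moreover have "(\<lambda>i. Im (if even i then a (i div 2) else b ((i - 1) div 2))) sums (Im y + Im x)"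
    using sums_if[of "\<lambda>i. Im (b i)" "Im y" "\<lambda>i. Im (a i)" "Im x"] assms
    by (simp add: sums_complex_iff if_distrib cong: if_cong)
  ultimately show ?thesis by (simp add: sums_complex_iff add.commute)
qed

text \<open>Interleaving the two series keeps representing pairs closed under linear
  combinations.\<close>
lemma nuclear_pair_combine:
  assumes 1: "nuclear_pair m n f g" and 2: "nuclear_pair m n f' g'"
  obtains F G where "nuclear_pair m n F G"
    "\<And>T. T \<in> bounded_ops m n \<Longrightarrow> pairing m n T F G = pairing m n T f g + c * pairing m n T f' g'"
proof -
  define cf where "cf i x = c * f' i x" for i x
  define F where "F i = (if even i then f (i div 2) else cf ((i - 1) div 2))" for i :: nat
  define G where "G i = (if even i then g (i div 2) else g' ((i - 1) div 2))" for i :: nat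
  have "nuclear_pair m n (\<lambda>i x. c * f' i x) (\<lambda>i y. 1 * g' i y)"
    by (rule nuclear_pair_Linf[OF 2 Linf_const Linf_const])
  then have 3: "nuclear_pair m n cf g'" by (simp add: cf_def[abs_def])
  have s: "summable (\<lambda>i. LINT x|M. (cmod (H i x))\<^sup>2)"
    if "summable (\<lambda>i. LINT x|M. (cmod (h i x))\<^sup>2)" "summable (\<lambda>i. LINT x|M. (cmod (h' i x))\<^sup>2)"
      and H: "\<And>i. H i = (if even i then h (i div 2) else h' ((i - 1) div 2))"
    for M :: "'c measure" and H h h'
  proof -
    have eq: "(\<lambda>i. LINT x|M. (cmod (H i x))\<^sup>2) = (\<lambda>i. if even i then LINT x|M. (cmod (h (i div 2) x))\<^sup>2
        else LINT x|M. (cmod (h' ((i - 1) div 2) x))\<^sup>2)"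
      by (auto simp: H)
    show ?thesis
      unfolding eq using sums_if[OF summable_sums[OF that(2)] summable_sums[OF that(1)]]
      by (rule sums_summable)
  qed
  have FG: "nuclear_pair m n F G"
    unfolding nuclear_pair_def
  proof (intro conjI allI)
    show "F i \<in> sq_integrable m" "G i \<in> sq_integrable n" for i
      using nuclear_pairD[OF 1] nuclear_pairD[OF 2] nuclear_pairD[OF 3] by (auto simp: F_def G_def)
    show "summable (\<lambda>i. LINT x|m. (cmod (F i x))\<^sup>2)"
      using s[of m f cf F] 1 3 by (simp add: nuclear_pair_def F_def)
    show "summable (\<lambda>i. LINT y|n. (cmod (G i y))\<^sup>2)"
      using s[of n g g' G] 1 2 by (simp add: nuclear_pair_def G_def)
  qed
  moreover have "pairing m n T F G = pairing m n T f g + c * pairing m n T f' g'" if T: "T \<in> bounded_ops m n" for T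
  proof (rule sums_unique2[OF pairing_sums[OF T FG]])
    have "(\<lambda>i. form m n T (cf i) (g' i)) sums (c * pairing m n T f' g')"
      using sums_mult[OF pairing_sums[OF T 2], of c]
      by (simp add: cf_def[abs_def] form_scale_left[OF T nuclear_pairD(1,2)[OF 2]])
    from sums_interleave[OF pairing_sums[OF T 1] this]
    show "(\<lambda>i. form m n T (F i) (G i)) sums (pairing m n T f g + c * pairing m n T f' g')"
      by (rule sums_cong[THEN iffD1, rotated]) (simp add: F_def G_def)
  qed
  ultimately show thesis by (rule that)
qed

text \<open>A basic open set is a preimage under a single pairing, so agreement of finitely many
  pairings, rather than closeness, already keeps an operator inside an open set.\<close>
lemma open_weak_star_finitely_many_pairings:
  assumes "openin (weak_star_topology m n) W" "T \<in> W"
  obtains hs where "\<And>f g. (f, g) \<in> set hs \<Longrightarrow> nuclear_pair m n f g"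
    "\<And>S. S \<in> bounded_ops m n \<Longrightarrow> (\<And>f g. (f, g) \<in> set hs \<Longrightarrow> pairing m n S f g = pairing m n T f g) \<Longrightarrow> S \<in> W"
proof -
  let ?B = "{{T \<in> bounded_ops m n. pairing m n T f g \<in> V} | f g V. nuclear_pair m n f g \<and> open V}"
  have "generate_topology_on ?B W"
    using assms(1) by (simp add: weak_star_topology_def openin_topology_generated_by_iff)
  then have "\<forall>T\<in>W. \<exists>hs. (\<forall>f g. (f, g) \<in> set hs \<longrightarrow> nuclear_pair m n f g) \<and>
      (\<forall>S\<in>bounded_ops m n. (\<forall>f g. (f, g) \<in> set hs \<longrightarrow> pairing m n S f g = pairing m n T f g) \<longrightarrow> S \<in> W)"
  proof induction
    case Empty
    then show ?case by simp
  next
    case (Int A B)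
    show ?case
    proof
      fix T assume T: "T \<in> A \<inter> B"
      obtain hs hs' where
        "\<forall>f g. (f, g) \<in> set hs \<longrightarrow> nuclear_pair m n f g"
        "\<forall>S\<in>bounded_ops m n. (\<forall>f g. (f, g) \<in> set hs \<longrightarrow> pairing m n S f g = pairing m n T f g) \<longrightarrow> S \<in> A"
        "\<forall>f g. (f, g) \<in> set hs' \<longrightarrow> nuclear_pair m n f g"
        "\<forall>S\<in>bounded_ops m n. (\<forall>f g. (f, g) \<in> set hs' \<longrightarrow> pairing m n S f g = pairing m n T f g) \<longrightarrow> S \<in> B"
        using bspec[OF Int.IH(1) IntD1[OF T]] bspec[OF Int.IH(2) IntD2[OF T]] by blast
      then show "\<exists>hs. (\<forall>f g. (f, g) \<in> set hs \<longrightarrow> nuclear_pair m n f g) \<and>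
          (\<forall>S\<in>bounded_ops m n. (\<forall>f g. (f, g) \<in> set hs \<longrightarrow> pairing m n S f g = pairing m n T f g) \<longrightarrow> S \<in> A \<inter> B)"
        by (intro exI[of _ "hs @ hs'"]) auto
    qed
  next
    case (UN K)
    show ?case
    proof
      fix T assume "T \<in> \<Union>K"
      then obtain k where k: "k \<in> K" "T \<in> k" by blast
      from bspec[OF UN.IH[OF k(1)] k(2)] k(1)
      show "\<exists>hs. (\<forall>f g. (f, g) \<in> set hs \<longrightarrow> nuclear_pair m n f g) \<and>
          (\<forall>S\<in>bounded_ops m n. (\<forall>f g. (f, g) \<in> set hs \<longrightarrow> pairing m n S f g = pairing m n T f g) \<longrightarrow> S \<in> \<Union>K)"
        by blast
    qed
  next
    case (Basis s)
    then obtain f g V where s: "s = {T \<in> bounded_ops m n. pairing m n T f g \<in> V}" "nuclear_pair m n f g"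
      by blast
    then show ?case by (intro ballI exI[of _ "[(f, g)]"]) auto
  qed
  from bspec[OF this assms(2)] show thesis using that by blast
qed

text \<open>Linear algebra in finitely many functionals, by induction on their number: one functional
  that does not vanish on \<open>\<V>\<close> is used to reduce to its kernel in \<open>\<V>\<close>,
  after moving \<open>T\<close> along \<open>\<V>\<close> into the kernel.\<close>
lemma interpolate_or_separate:
  assumes "\<And>f g. (f, g) \<in> set hs \<Longrightarrow> nuclear_pair m n f g"
    and "op_subspace m n \<V>" and "T \<in> bounded_ops m n"
  shows "(\<exists>S\<in>\<V>. \<forall>f g. (f, g) \<in> set hs \<longrightarrow> pairing m n S f g = pairing m n T f g) \<or>
    (\<exists>f g. nuclear_pair m n f g \<and> (\<forall>S\<in>\<V>. pairing m n S f g = 0) \<and> pairing m n T f g \<noteq> 0)"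
  using assms
proof (induction hs arbitrary: \<V> T)
  case Nil
  then show ?case by (auto simp: op_subspace_def)
next
  case (Cons h hs)
  obtain f0 g0 where h: "h = (f0, g0)" by (cases h)
  have n0: "nuclear_pair m n f0 g0" using Cons.prems(1) h by auto
  have ns: "\<And>f g. (f, g) \<in> set hs \<Longrightarrow> nuclear_pair m n f g" using Cons.prems(1) by auto
  note sub = Cons.prems(2)[unfolded op_subspace_def]
  note T = Cons.prems(3)
  show ?case
  proof (cases "\<forall>S\<in>\<V>. pairing m n S f0 g0 = 0")
    case True
    then show ?thesis
      using Cons.IH[OF ns Cons.prems(2,3)] n0 h by (cases "pairing m n T f0 g0 = 0") auto
  next
    case False
    then obtain S0 where S0: "S0 \<in> \<V>" "pairing m n S0 f0 g0 \<noteq> 0" by blast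
    define s where "s = pairing m n S0 f0 g0"
    define t where "t = pairing m n T f0 g0"
    \<comment> \<open>\<open>T'\<close> differs from \<open>T\<close> by an element of \<open>\<V>\<close> and pairs to 0 with \<open>(f0, g0)\<close>.\<close>
    define T' where "T' = op_add m n T (op_scale m n (- t / s) S0)"
    define \<V>' where "\<V>' = {S \<in> \<V>. pairing m n S f0 g0 = 0}"
    have s: "s \<noteq> 0" using S0 by (simp add: s_def)
    have S0b: "S0 \<in> bounded_ops m n" using sub S0 by blast
    note S0c = op_scale_form(1)[OF S0b]
    have T': "T' \<in> bounded_ops m n" unfolding T'_def by (rule op_add_form(1)[OF T S0c])
    have T'p: "pairing m n T' f g = pairing m n T f g - t / s * pairing m n S0 f g" if "nuclear_pair m n f g" for f g
      unfolding T'_def by (simp add: pairing_add[OF T S0c that] pairing_scale[OF S0b that])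
    have sub': "op_subspace m n \<V>'"
      unfolding op_subspace_def \<V>'_def
    proof (intro conjI ballI allI)
      have "pairing m n (op_scale m n 0 S0) f0 g0 = 0" by (simp add: pairing_scale[OF S0b n0])
      moreover have "op_scale m n 0 S0 = op_zero m n"
        by (intro bounded_ops_eqI[where m=m and n=n] S0c op_zero_form(1)) (simp add: op_scale_form(2)[OF S0b] op_zero_form)
      ultimately show "op_zero m n \<in> {S \<in> \<V>. pairing m n S f0 g0 = 0}" using sub by simp
    next
      fix S R assume "S \<in> {S \<in> \<V>. pairing m n S f0 g0 = 0}" "R \<in> {S \<in> \<V>. pairing m n S f0 g0 = 0}"
      moreover from this have "S \<in> bounded_ops m n" "R \<in> bounded_ops m n" using sub by auto
      ultimately show "op_add m n S R \<in> {S \<in> \<V>. pairing m n S f0 g0 = 0}"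
        using sub by (simp add: pairing_add n0)
    next
      fix c S assume "S \<in> {S \<in> \<V>. pairing m n S f0 g0 = 0}"
      moreover from this have "S \<in> bounded_ops m n" using sub by auto
      ultimately show "op_scale m n c S \<in> {S \<in> \<V>. pairing m n S f0 g0 = 0}"
        using sub by (simp add: pairing_scale n0)
    qed (use sub in auto)
    consider S' where "S' \<in> \<V>'" "\<forall>f g. (f, g) \<in> set hs \<longrightarrow> pairing m n S' f g = pairing m n T' f g"
      | f' g' where "nuclear_pair m n f' g'" "\<forall>S\<in>\<V>'. pairing m n S f' g' = 0" "pairing m n T' f' g' \<noteq> 0"
      using Cons.IH[OF ns sub' T'] by blast
    then show ?thesis
    proof cases
      case 1
      then have S': "S' \<in> \<V>" "pairing m n S' f0 g0 = 0" "S' \<in> bounded_ops m n"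
        using sub by (auto simp: \<V>'_def)
      define S where "S = op_add m n S' (op_scale m n (t / s) S0)"
      have Sp: "pairing m n S f g = pairing m n S' f g + t / s * pairing m n S0 f g" if "nuclear_pair m n f g" for f g
        unfolding S_def by (simp add: pairing_add[OF S'(3) S0c that] pairing_scale[OF S0b that])
      have "S \<in> \<V>" using sub S' S0 by (simp add: S_def)
      moreover have "pairing m n S f g = pairing m n T f g" if "(f, g) \<in> set (h # hs)" for f g
      proof (cases "(f, g) = h")
        case True
        then show ?thesis using Sp[OF n0] S'(2) s h by (simp add: s_def t_def)
      next
        case False
        then have "(f, g) \<in> set hs" using that by auto
        then show ?thesis using Sp[OF ns] T'p[OF ns] 1(2) by simp
      qed
      ultimately show ?thesis by blast
    next
      case 2
      \<comment> \<open>This multiple of \<open>(f0, g0)\<close> makes the combined functional vanish at \<open>S0\<close>, hence on all of \<open>\<V>\<close>.\<close>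
      define c where "c = - pairing m n S0 f' g' / s"
      obtain F G where FG: "nuclear_pair m n F G"
        "\<And>T. T \<in> bounded_ops m n \<Longrightarrow> pairing m n T F G = pairing m n T f' g' + c * pairing m n T f0 g0"
        using nuclear_pair_combine[OF 2(1) n0] by blast
      have "pairing m n S F G = 0" if S: "S \<in> \<V>" for S
      proof -
        have Sb: "S \<in> bounded_ops m n" using sub S by blast
        define R where "R = op_add m n S (op_scale m n (- pairing m n S f0 g0 / s) S0)"
        have Rp: "pairing m n R f g = pairing m n S f g - pairing m n S f0 g0 / s * pairing m n S0 f g"
          if "nuclear_pair m n f g" for f g
          unfolding R_def by (simp add: pairing_add[OF Sb S0c that] pairing_scale[OF S0b that])
        have "R \<in> \<V>'" using sub S S0 Rp[OF n0] s by (simp add: \<V>'_def R_def s_def)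
        then have "pairing m n S f' g' - pairing m n S f0 g0 / s * pairing m n S0 f' g' = 0"
          using 2(2) Rp[OF 2(1)] by simp
        then show ?thesis by (simp add: FG(2)[OF Sb] c_def)
      qed
      moreover have "pairing m n T F G \<noteq> 0"
        using 2(3) T'p[OF 2(1)] by (simp add: FG(2)[OF T] c_def t_def mult.commute)
      ultimately show ?thesis using FG(1) by blast
    qed
  qed
qed

text \<open>The bipolar theorem for subspaces.\<close>
theorem weak_star_closed_subspace_mem:
  assumes V: "op_subspace m n \<V>" and closed: "closedin (weak_star_topology m n) \<V>"
    and T: "T \<in> bounded_ops m n"
    and ann: "\<And>f g. nuclear_pair m n f g \<Longrightarrow> (\<And>S. S \<in> \<V> \<Longrightarrow> pairing m n S f g = 0) \<Longrightarrow> pairing m n T f g = 0"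
  shows "T \<in> \<V>"
proof (rule ccontr)
  assume "T \<notin> \<V>"
  have "openin (weak_star_topology m n) (bounded_ops m n - \<V>)"
    using closed by (simp add: closedin_def)
  moreover have "T \<in> bounded_ops m n - \<V>" using T \<open>T \<notin> \<V>\<close> by simp
  ultimately obtain hs where hs: "\<And>f g. (f, g) \<in> set hs \<Longrightarrow> nuclear_pair m n f g"
    "\<And>S. S \<in> bounded_ops m n \<Longrightarrow> (\<And>f g. (f, g) \<in> set hs \<Longrightarrow> pairing m n S f g = pairing m n T f g) \<Longrightarrow>
      S \<in> bounded_ops m n - \<V>"
    by (rule open_weak_star_finitely_many_pairings) blast
  have "\<V> \<subseteq> bounded_ops m n" using V by (simp add: op_subspace_def)
  then have "\<not> (\<exists>S\<in>\<V>. \<forall>f g. (f, g) \<in> set hs \<longrightarrow> pairing m n S f g = pairing m n T f g)"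
    using hs(2) by blast
  with interpolate_or_separate[OF hs(1) V T] ann show False by blast
qed

section \<open>Operators with dominated kernels\<close>

lemma square_summable_AE:
  assumes f: "\<And>i. f i \<in> sq_integrable m" and s: "summable (\<lambda>i. LINT x|m. (cmod (f i x))\<^sup>2)"
  shows "AE x in m. square_summable (\<lambda>i. f i x)"
    and "integrable m (\<lambda>x. \<Sum>i. (cmod (f i x))\<^sup>2)"
    and "(LINT x|m. (\<Sum>i. (cmod (f i x))\<^sup>2)) = (\<Sum>i. LINT x|m. (cmod (f i x))\<^sup>2)"
proof -
  note [measurable] = sq_integrableD(1)[OF f]
  have "(\<integral>\<^sup>+x. (\<Sum>i. ennreal ((cmod (f i x))\<^sup>2)) \<partial>m) = (\<Sum>i. \<integral>\<^sup>+x. ennreal ((cmod (f i x))\<^sup>2) \<partial>m)"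
    by (rule nn_integral_suminf) measurable
  also have "\<dots> = (\<Sum>i. ennreal (LINT x|m. (cmod (f i x))\<^sup>2))"
    using nn_integral_eq_integral[OF sq_integrableD(2)[OF f]] by simp
  also have "\<dots> \<noteq> top"
    by (rule ennreal_suminf_neq_top[OF s]) (rule integral_nonneg_AE, rule AE_I2, rule zero_le_power2)
  finally have "(\<integral>\<^sup>+x. (\<Sum>i. ennreal ((cmod (f i x))\<^sup>2)) \<partial>m) \<noteq> \<infinity>"
    unfolding infinity_ennreal_def .
  from nn_integral_noteq_infinite[OF _ this]
  have "AE x in m. (\<Sum>i. ennreal ((cmod (f i x))\<^sup>2)) \<noteq> \<infinity>"
    by measurable
  then have ae: "AE x in m. summable (\<lambda>i. (cmod (f i x))\<^sup>2)"
    by eventually_elim (rule summable_suminf_not_top, rule zero_le_power2, unfold infinity_ennreal_def, assumption)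
  then show "AE x in m. square_summable (\<lambda>i. f i x)" by (simp add: square_summable_def)
  have ae': "AE x in m. summable (\<lambda>i. norm ((cmod (f i x))\<^sup>2))" using ae by simp
  have s': "summable (\<lambda>i. LINT x|m. norm ((cmod (f i x))\<^sup>2))" using s by simp
  show "integrable m (\<lambda>x. \<Sum>i. (cmod (f i x))\<^sup>2)"
    by (rule integrable_suminf[OF sq_integrableD(2)[OF f] ae' s'])
  show "(LINT x|m. (\<Sum>i. (cmod (f i x))\<^sup>2)) = (\<Sum>i. LINT x|m. (cmod (f i x))\<^sup>2)"
    by (rule integral_suminf[OF sq_integrableD(2)[OF f] ae' s'])
qed

context pair_sigma_finite
begin

lemma AE_fst: 
  assumes "AE x in M1. P x"
  shows "AE z in M1 \<Otimes>\<^sub>M M2. P (fst z)"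
proof -
  obtain N where N: "N \<in> null_sets M1" "{x\<in>space M1. \<not> P x} \<subseteq> N"
    using assms by (auto simp: eventually_ae_filter)
  show ?thesis
    by (rule AE_I'[of "N \<times> space M2"]) (use N in \<open>auto simp: space_pair_measure\<close>)
qed

lemma AE_snd: 
  assumes "AE y in M2. P y"
  shows "AE z in M1 \<Otimes>\<^sub>M M2. P (snd z)"
proof -
  obtain N where N: "N \<in> null_sets M2" "{x\<in>space M2. \<not> P x} \<subseteq> N"
    using assms by (auto simp: eventually_ae_filter)
  show ?thesis
    by (rule AE_I'[of "space M1 \<times> N"]) (use N in \<open>auto simp: space_pair_measure\<close>)
qed

lemma integrable_times:
  fixes a :: "'a \<Rightarrow> complex" and b :: "'b \<Rightarrow> complex"
  assumes a: "integrable M1 a" and b: "integrable M2 b"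
  shows "integrable (M1 \<Otimes>\<^sub>M M2) (\<lambda>z. a (fst z) * b (snd z))"
    and "(LINT z|(M1 \<Otimes>\<^sub>M M2). a (fst z) * b (snd z)) = (LINT x|M1. a x) * (LINT y|M2. b y)"
proof -
  note [measurable] = borel_measurable_integrable[OF a] borel_measurable_integrable[OF b]
  show i: "integrable (M1 \<Otimes>\<^sub>M M2) (\<lambda>z. a (fst z) * b (snd z))"
  proof (rule Fubini_integrable)
    show "integrable M1 (\<lambda>x. LINT y|M2. norm (a (fst (x, y)) * b (snd (x, y))))"
      using a by (simp add: norm_mult integrable_norm)
    show "AE x in M1. integrable M2 (\<lambda>y. a (fst (x, y)) * b (snd (x, y)))"
      using b by simp
  qed measurable
  show "(LINT z|(M1 \<Otimes>\<^sub>M M2). a (fst z) * b (snd z)) = (LINT x|M1. a x) * (LINT y|M2. b y)"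
    using integral_fst'[OF i] by simp
qed

end

definition dominated_kernel ::
  "'a measure \<Rightarrow> 'b measure \<Rightarrow> ('a \<times> 'b \<Rightarrow> complex) \<Rightarrow> ('a \<Rightarrow> complex) \<Rightarrow> ('b \<Rightarrow> complex) \<Rightarrow> bool" where
  "dominated_kernel m n k p q \<longleftrightarrow>
     k \<in> borel_measurable (m \<Otimes>\<^sub>M n) \<and> p \<in> sq_integrable m \<and> q \<in> sq_integrable n \<and>
     (\<forall>x y. cmod (k (x, y)) \<le> cmod (p x * q y))"

definition kernel_op :: "'a measure \<Rightarrow> 'b measure \<Rightarrow> ('a \<times> 'b \<Rightarrow> complex) \<Rightarrow> ('a, 'b) l2_op" where
  "kernel_op m n k = op_of m n (\<lambda>f y. LINT x|m. k (x, y) * f x)"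

context pair_sigma_finite
begin

text \<open>By Cauchy-Schwarz in the first variable the image of \<open>f\<close> is bounded pointwise
  by \<open>\<parallel>p\<parallel> \<parallel>f\<parallel> |q|\<close>.\<close>
lemma kernel_l2_map:
  assumes "dominated_kernel M1 M2 k p q"
  shows "l2_map M1 M2 (\<lambda>f y. LINT x|M1. k (x, y) * f x)"
proof -
  have [measurable]: "k \<in> borel_measurable (M1 \<Otimes>\<^sub>M M2)" and p: "p \<in> sq_integrable M1"
    and q: "q \<in> sq_integrable M2" and le: "\<And>x y. cmod (k (x, y)) \<le> cmod (p x * q y)"
    using assms by (auto simp: dominated_kernel_def)
  note [measurable] = sq_integrableD(1)[OF p] sq_integrableD(1)[OF q]
  have pf: "integrable M1 (\<lambda>x. cmod (q y) * cmod (p x * f x))" if "f \<in> sq_integrable M1" for f y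
    by (intro integrable_mult_right integrable_norm sq_integrable_product(1) p that)
  have bd: "cmod (k (x, y) * f x) \<le> cmod (q y) * cmod (p x * f x)" for x y and f :: "'a \<Rightarrow> complex"
    using mult_right_mono[OF le[of x y] norm_ge_zero[of "f x"]] by (simp add: norm_mult mult_ac)
  have i: "integrable M1 (\<lambda>x. k (x, y) * f x)" if f: "f \<in> sq_integrable M1" and [measurable]: "y \<in> space M2" for f y
  proof (rule Bochner_Integration.integrable_bound[OF pf[OF f, of y]])
    note [measurable] = sq_integrableD(1)[OF f]
    show "(\<lambda>x. k (x, y) * f x) \<in> borel_measurable M1" by measurable
    show "AE x in M1. norm (k (x, y) * f x) \<le> norm (cmod (q y) * cmod (p x * f x))"
      using bd by simp
  qed
  have t: "cmod (LINT x|M1. k (x, y) * f x) \<le> snorm M1 p * snorm M1 f * cmod (q y)"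
    if f: "f \<in> sq_integrable M1" and y: "y \<in> space M2" for f y
  proof -
    have "cmod (LINT x|M1. k (x, y) * f x) \<le> (LINT x|M1. cmod (k (x, y) * f x))"
      by (rule integral_norm_bound)
    also have "\<dots> \<le> (LINT x|M1. cmod (q y) * cmod (p x * f x))"
      by (rule integral_mono) (rule integrable_norm[OF i[OF f y]] pf[OF f] bd)+
    also have "\<dots> = cmod (q y) * (LINT x|M1. cmod (p x * f x))" by simp
    also have "\<dots> \<le> cmod (q y) * (snorm M1 p * snorm M1 f)"
      by (intro mult_left_mono sq_integrable_product(2) p f) simp
    finally show ?thesis by (simp add: mult.commute)
  qed
  have meas: "(\<lambda>y. LINT x|M1. k (x, y) * f x) \<in> borel_measurable M2" if f: "f \<in> sq_integrable M1" for f
  proof -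
    note [measurable] = sq_integrableD(1)[OF f]
    show ?thesis by measurable
  qed
  have sq: "(\<lambda>y. LINT x|M1. k (x, y) * f x) \<in> sq_integrable M2"
    and bound: "snorm M2 (\<lambda>y. LINT x|M1. k (x, y) * f x) \<le> (snorm M1 p * snorm M2 q) * snorm M1 f"
    if f: "f \<in> sq_integrable M1" for f
  proof -
    note [measurable] = meas[OF f]
    have sqle: "(cmod (LINT x|M1. k (x, y) * f x))\<^sup>2 \<le> (snorm M1 p * snorm M1 f)\<^sup>2 * (cmod (q y))\<^sup>2"
      if "y \<in> space M2" for y
      using power_mono[OF t[OF f that] norm_ge_zero, of 2] by (simp only: power_mult_distrib)
    have qi: "integrable M2 (\<lambda>y. (snorm M1 p * snorm M1 f)\<^sup>2 * (cmod (q y))\<^sup>2)"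
      by (intro integrable_mult_right sq_integrableD q)
    have ki: "integrable M2 (\<lambda>y. (cmod (LINT x|M1. k (x, y) * f x))\<^sup>2)"
    proof (rule Bochner_Integration.integrable_bound[OF qi])
      show "AE y in M2. norm ((cmod (LINT x|M1. k (x, y) * f x))\<^sup>2) \<le>
          norm ((snorm M1 p * snorm M1 f)\<^sup>2 * (cmod (q y))\<^sup>2)"
        by (rule AE_I2) (simp only: norm_of_real real_norm_def abs_mult abs_power2 sqle)
    qed measurable
    then show sq: "(\<lambda>y. LINT x|M1. k (x, y) * f x) \<in> sq_integrable M2"
      using meas[OF f] by (simp add: sq_integrable_def)
    have "(snorm M2 (\<lambda>y. LINT x|M1. k (x, y) * f x))\<^sup>2 \<le>
        (LINT y|M2. (snorm M1 p * snorm M1 f)\<^sup>2 * (cmod (q y))\<^sup>2)"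
      unfolding snorm_square by (rule integral_mono[OF ki qi sqle])
    also have "\<dots> = ((snorm M1 p * snorm M2 q) * snorm M1 f)\<^sup>2"
      by (simp add: power_mult_distrib)
    finally show "snorm M2 (\<lambda>y. LINT x|M1. k (x, y) * f x) \<le> (snorm M1 p * snorm M2 q) * snorm M1 f"
      by (rule power2_le_imp_le) simp
  qed
  show ?thesis
    unfolding l2_map_def
  proof (intro conjI ballI allI impI exI)
    fix f g c assume f: "f \<in> sq_integrable M1" 
    show "(\<lambda>y. LINT x|M1. k (x, y) * f x) \<in> sq_integrable M2" by (rule sq[OF f])
    show "snorm M2 (\<lambda>y. LINT x|M1. k (x, y) * f x) \<le> (snorm M1 p * snorm M2 q) * snorm M1 f"
      by (rule bound[OF f])
    show "AE y in M2. (LINT x|M1. k (x, y) * (c * f x)) = c * (LINT x|M1. k (x, y) * f x)"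
      by (simp add: mult.left_commute)
    assume g: "g \<in> sq_integrable M1"
    show "AE y in M2. (LINT x|M1. k (x, y) * (f x + g x)) = (LINT x|M1. k (x, y) * f x) + (LINT x|M1. k (x, y) * g x)"
      by (rule AE_I2) (simp add: distrib_left i f g)
    assume fg: "AE x in M1. f x = g x"
    show "AE y in M2. (LINT x|M1. k (x, y) * f x) = (LINT x|M1. k (x, y) * g x)"
    proof (rule AE_I2, rule integral_cong_AE)
      fix y assume y: "y \<in> space M2"
      show "AE x in M1. k (x, y) * f x = k (x, y) * g x" using fg by eventually_elim simp
    qed (use i[OF f] i[OF g] in \<open>auto dest: borel_measurable_integrable\<close>)
  qed
qed


lemma kernel_op_bounded: "dominated_kernel M1 M2 k p q \<Longrightarrow> kernel_op M1 M2 k \<in> bounded_ops M1 M2"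
  unfolding kernel_op_def by (rule op_of(1)[OF kernel_l2_map])

lemma kernel_form:
  assumes k: "dominated_kernel M1 M2 k p q" and f: "f \<in> sq_integrable M1" and g: "g \<in> sq_integrable M2"
  shows "integrable (M1 \<Otimes>\<^sub>M M2) (\<lambda>z. k z * (f (fst z) * g (snd z)))"
    and "(LINT z|(M1 \<Otimes>\<^sub>M M2). cmod (k z * (f (fst z) * g (snd z)))) \<le> (snorm M1 p * snorm M2 q) * (snorm M1 f * snorm M2 g)"
    and "form M1 M2 (kernel_op M1 M2 k) f g = (LINT z|(M1 \<Otimes>\<^sub>M M2). k z * (f (fst z) * g (snd z)))"
proof -
  have [measurable]: "k \<in> borel_measurable (M1 \<Otimes>\<^sub>M M2)" and p: "p \<in> sq_integrable M1"
    and q: "q \<in> sq_integrable M2" and le: "\<And>x y. cmod (k (x, y)) \<le> cmod (p x * q y)"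
    using k by (auto simp: dominated_kernel_def)
  note [measurable] = sq_integrableD(1)[OF f] sq_integrableD(1)[OF g]
  note pf = sq_integrable_product[OF p f] and qg = sq_integrable_product[OF q g]
  have dom: "integrable (M1 \<Otimes>\<^sub>M M2) (\<lambda>z. cmod (p (fst z) * f (fst z)) * cmod (q (snd z) * g (snd z)))"
    using integrable_norm[OF integrable_times(1)[OF pf(1) qg(1)]] by (simp add: norm_mult)
  have bd: "cmod (k z * (f (fst z) * g (snd z))) \<le> cmod (p (fst z) * f (fst z)) * cmod (q (snd z) * g (snd z))" for z
    using mult_right_mono[OF le[of "fst z" "snd z"], of "cmod (f (fst z)) * cmod (g (snd z))"]
    by (simp add: norm_mult mult_ac)
  show i: "integrable (M1 \<Otimes>\<^sub>M M2) (\<lambda>z. k z * (f (fst z) * g (snd z)))"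
  proof (rule Bochner_Integration.integrable_bound[OF dom])
    show "AE z in M1 \<Otimes>\<^sub>M M2. norm (k z * (f (fst z) * g (snd z))) \<le>
        norm (cmod (p (fst z) * f (fst z)) * cmod (q (snd z) * g (snd z)))"
      using bd by (simp add: abs_mult)
  qed measurable
  have "(LINT z|(M1 \<Otimes>\<^sub>M M2). cmod (k z * (f (fst z) * g (snd z)))) \<le>
      (LINT z|(M1 \<Otimes>\<^sub>M M2). cmod (p (fst z) * f (fst z)) * cmod (q (snd z) * g (snd z)))"
    by (rule integral_mono[OF integrable_norm[OF i] dom bd])
  also have "\<dots> = (LINT x|M1. cmod (p x * f x)) * (LINT y|M2. cmod (q y * g y))"
    using integral_fst'[OF dom] by simp
  also have "\<dots> \<le> (snorm M1 p * snorm M1 f) * (snorm M2 q * snorm M2 g)"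
    by (intro mult_mono pf(2) qg(2)) auto
  finally show "(LINT z|(M1 \<Otimes>\<^sub>M M2). cmod (k z * (f (fst z) * g (snd z)))) \<le> (snorm M1 p * snorm M2 q) * (snorm M1 f * snorm M2 g)"
    by (simp add: mult_ac)
  have i': "integrable (M1 \<Otimes>\<^sub>M M2) (case_prod (\<lambda>x y. k (x, y) * f x * g y))"
    using i by (simp add: case_prod_unfold mult.assoc)
  have "form M1 M2 (kernel_op M1 M2 k) f g = (LINT y|M2. (LINT x|M1. k (x, y) * f x) * g y)"
    unfolding kernel_op_def by (rule op_of(3)[OF kernel_l2_map[OF k] f g])
  also have "\<dots> = (LINT y|M2. (LINT x|M1. k (x, y) * f x * g y))" by simp
  also have "\<dots> = (LINT z|(M1 \<Otimes>\<^sub>M M2). case_prod (\<lambda>x y. k (x, y) * f x * g y) z)"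
    by (rule integral_snd[OF i'])
  finally show "form M1 M2 (kernel_op M1 M2 k) f g = (LINT z|(M1 \<Otimes>\<^sub>M M2). k z * (f (fst z) * g (snd z)))"
    by (simp add: case_prod_unfold mult.assoc)
qed

lemma nuclear_pair_square_summable:
  assumes "nuclear_pair M1 M2 f g"
  shows "AE z in M1 \<Otimes>\<^sub>M M2. square_summable (\<lambda>i. f i (fst z)) \<and> square_summable (\<lambda>i. g i (snd z))"
proof -
  have "AE x in M1. square_summable (\<lambda>i. f i x)" "AE y in M2. square_summable (\<lambda>i. g i y)"
    using assms by (auto simp: nuclear_pair_def intro: square_summable_AE)
  then show ?thesis using AE_fst AE_snd by fastforce
qed

text \<open>For these operators the pairing is an honest integral, so it sees elements of the predual
  only through their values almost everywhere.\<close>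
lemma kernel_pairing:
  assumes k: "dominated_kernel M1 M2 k p q" and fg: "nuclear_pair M1 M2 f g"
  shows "pairing M1 M2 (kernel_op M1 M2 k) f g = (LINT z|(M1 \<Otimes>\<^sub>M M2). k z * tensor_fun f g z)"
    and "integrable (M1 \<Otimes>\<^sub>M M2) (\<lambda>z. k z * tensor_fun f g z)"
proof -
  note n = nuclear_pairD[OF fg]
  note kf = kernel_form[OF k n(1,2)]
  note cs = suminf_mult_le_sqrt(1)[OF n(3,4)]
  have ae: "AE z in M1 \<Otimes>\<^sub>M M2. summable (\<lambda>i. norm (k z * (f i (fst z) * g i (snd z))))"
    using nuclear_pair_square_summable[OF fg]
    by eventually_elim (auto simp: norm_mult intro!: summable_mult square_summable_product(1)[unfolded norm_mult])
  have s: "summable (\<lambda>i. LINT z|(M1 \<Otimes>\<^sub>M M2). norm (k z * (f i (fst z) * g i (snd z))))"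
    by (rule summable_comparison_test'[OF summable_mult[OF cs, of "snorm M1 p * snorm M2 q"]])
       (use kf(2) in \<open>simp add: integral_nonneg_AE\<close>)
  have eq: "AE z in M1 \<Otimes>\<^sub>M M2. (\<Sum>i. k z * (f i (fst z) * g i (snd z))) = k z * tensor_fun f g z"
    using nuclear_pair_square_summable[OF fg]
    by eventually_elim (simp add: tensor_fun_def case_prod_beta suminf_mult square_summable_product(2))
  note [measurable] = sq_integrableD(1)[OF n(1)] sq_integrableD(1)[OF n(2)]
  have [measurable]: "k \<in> borel_measurable (M1 \<Otimes>\<^sub>M M2)" using k by (simp add: dominated_kernel_def)
  have [measurable]: "tensor_fun f g \<in> borel_measurable (M1 \<Otimes>\<^sub>M M2)"
    unfolding tensor_fun_def by measurable
  have m: "(\<lambda>z. \<Sum>i. k z * (f i (fst z) * g i (snd z))) \<in> borel_measurable (M1 \<Otimes>\<^sub>M M2)"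
    by measurable
  have "pairing M1 M2 (kernel_op M1 M2 k) f g = (\<Sum>i. LINT z|(M1 \<Otimes>\<^sub>M M2). k z * (f i (fst z) * g i (snd z)))"
    by (simp add: pairing_eq_form[OF kernel_op_bounded[OF k] n(1,2)] kf(3))
  also have "\<dots> = (LINT z|(M1 \<Otimes>\<^sub>M M2). (\<Sum>i. k z * (f i (fst z) * g i (snd z))))"
    by (rule integral_suminf[OF kf(1) ae s, symmetric])
  also have "\<dots> = (LINT z|(M1 \<Otimes>\<^sub>M M2). k z * tensor_fun f g z)"
    by (rule integral_cong_AE[OF m _ eq]) measurable
  finally show "pairing M1 M2 (kernel_op M1 M2 k) f g = (LINT z|(M1 \<Otimes>\<^sub>M M2). k z * tensor_fun f g z)" .
  show "integrable (M1 \<Otimes>\<^sub>M M2) (\<lambda>z. k z * tensor_fun f g z)"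
    by (rule integrable_cong_AE_imp[OF integrable_suminf[OF kf(1) ae s]]) (use eq in auto)
qed

end

section \<open>Rectangles on which an element of the preannihilator is nearly constant\<close>

lemma sum_snorm_le:
  assumes h: "\<And>i. h i \<in> sq_integrable m" and u: "u \<in> sq_integrable m" and K: "0 \<le> K"
    and le: "AE x in m. square_summable (\<lambda>i. h i x) \<and> ell2 (\<lambda>i. h i x) \<le> K * cmod (u x)"
  shows "summable (\<lambda>i. (snorm m (h i))\<^sup>2)" and "sqrt (\<Sum>i. (snorm m (h i))\<^sup>2) \<le> K * snorm m u"
proof -
  have part: "(\<Sum>i<N. (snorm m (h i))\<^sup>2) \<le> (K * snorm m u)\<^sup>2" for N
  proof -
    have "(\<Sum>i<N. (snorm m (h i))\<^sup>2) = (LINT x|m. (\<Sum>i<N. (cmod (h i x))\<^sup>2))"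
      using sq_integrableD(2)[OF h] by simp
    also have "\<dots> \<le> (LINT x|m. K\<^sup>2 * (cmod (u x))\<^sup>2)"
    proof (rule integral_mono_AE)
      show "integrable m (\<lambda>x. \<Sum>i<N. (cmod (h i x))\<^sup>2)" using sq_integrableD(2)[OF h] by simp
      show "integrable m (\<lambda>x. K\<^sup>2 * (cmod (u x))\<^sup>2)" using sq_integrableD(2)[OF u] by simp
      show "AE x in m. (\<Sum>i<N. (cmod (h i x))\<^sup>2) \<le> K\<^sup>2 * (cmod (u x))\<^sup>2"
        using le
      proof eventually_elim
        case (elim x)
        then have s: "summable (\<lambda>i. (cmod (h i x))\<^sup>2)" by (simp add: square_summable_def)
        have "(\<Sum>i<N. (cmod (h i x))\<^sup>2) \<le> (\<Sum>i. (cmod (h i x))\<^sup>2)"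
          by (rule sum_le_suminf[OF s]) auto
        also have "\<dots> = (ell2 (\<lambda>i. h i x))\<^sup>2"
          using s by (simp add: ell2_def suminf_nonneg)
        also have "\<dots> \<le> (K * cmod (u x))\<^sup>2"
          using elim ell2_nonneg by (intro power_mono) auto
        finally show ?case by (simp add: power_mult_distrib)
      qed
    qed
    finally show ?thesis by (simp add: power_mult_distrib)
  qed
  show s: "summable (\<lambda>i. (snorm m (h i))\<^sup>2)"
    by (rule summableI_nonneg_bounded[OF _ part]) simp
  have "(\<Sum>i. (snorm m (h i))\<^sup>2) \<le> (K * snorm m u)\<^sup>2"
    by (rule suminf_le_const[OF s part])
  then have "sqrt (\<Sum>i. (snorm m (h i))\<^sup>2) \<le> sqrt ((K * snorm m u)\<^sup>2)"
    by (rule real_sqrt_le_mono)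
  then show "sqrt (\<Sum>i. (snorm m (h i))\<^sup>2) \<le> K * snorm m u"
    using K by simp
qed

lemma near_setD:
  assumes "x \<in> near_set m F \<xi> e" and \<xi>: "square_summable \<xi>"
  shows "x \<in> space m" "square_summable (\<lambda>i. F i x)" "square_summable (\<lambda>i. F i x - \<xi> i)"
    "ell2 (\<lambda>i. F i x - \<xi> i) \<le> e" "ell2 (\<lambda>i. F i x) \<le> ell2 \<xi> + e" "ell2 \<xi> \<le> ell2 (\<lambda>i. F i x) + e"
    "cmod (F i x) \<le> ell2 \<xi> + e"
proof -
  show 1: "x \<in> space m" "square_summable (\<lambda>i. F i x)" "ell2 (\<lambda>i. F i x - \<xi> i) \<le> e"
    using assms(1) by (auto simp: near_set_def)
  show "square_summable (\<lambda>i. F i x - \<xi> i)" by (rule square_summable_diff[OF 1(2) \<xi>])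
  show 2: "ell2 (\<lambda>i. F i x) \<le> ell2 \<xi> + e" and "ell2 \<xi> \<le> ell2 (\<lambda>i. F i x) + e"
    using ell2_le_shift[OF 1(2) \<xi> 1(3)] .
  have "(cmod (F i x))\<^sup>2 \<le> (\<Sum>i. (cmod (F i x))\<^sup>2)"
    using sum_le_suminf[of "\<lambda>i. (cmod (F i x))\<^sup>2" "{i}"] 1(2) by (simp add: square_summable_def)
  then have "sqrt ((cmod (F i x))\<^sup>2) \<le> ell2 (\<lambda>i. F i x)"
    unfolding ell2_def by (rule real_sqrt_le_mono)
  then show "cmod (F i x) \<le> ell2 \<xi> + e" using 2 by simp
qed

lemma near_sets_product_nonzero:
  assumes "x \<in> near_set m F \<xi> e" "y \<in> near_set n G \<eta> e" "square_summable \<xi>" "square_summable \<eta>" "0 < e"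
    and "e * (ell2 \<xi> + ell2 \<eta> + e) < cmod (\<Sum>j. \<xi> j * \<eta> j)"
  shows "(\<Sum>j. F j x * G j y) \<noteq> 0"
proof -
  note x = near_setD[OF assms(1,3)] and y = near_setD[OF assms(2,4)]
  have "cmod ((\<Sum>j. F j x * G j y) - (\<Sum>j. \<xi> j * \<eta> j)) \<le> e * ell2 (\<lambda>j. G j y) + ell2 \<xi> * e"
    by (rule suminf_product_diff[OF x(2) y(2) assms(3,4) x(4) y(4)])
  also have "\<dots> \<le> e * (ell2 \<eta> + e) + ell2 \<xi> * e"
    using y(5) assms(5) by (intro add_right_mono mult_left_mono) auto
  also have "\<dots> < cmod (\<Sum>j. \<xi> j * \<eta> j)" using assms(6) by (simp add: algebra_simps)
  finally show ?thesis by (auto simp: norm_minus_commute)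
qed

text \<open>On the product of the near sets, \<open>h = \<Sum>i. f\<^sub>i \<otimes> g\<^sub>i\<close>
  equals \<open>c (f0 \<otimes> g0)\<close> up to a small relative error, where \<open>c = \<Sum>j.
  \<xi>\<^sub>j \<eta>\<^sub>j\<close>. Since all products \<open>(a \<otimes> b) h\<close> annihilate
  \<open>S\<close>, the number \<open>c \<langle>S, a f0 \<otimes> b g0\<rangle>\<close> is a sum of
  error terms of the same shape. Any bound \<open>C\<close> for the form on such tensors therefore
  improves to \<open>\<theta> C\<close> with \<open>\<theta> < 1\<close>, and the form is 0.\<close>
lemma rectangle_contraction:
  fixes f :: "nat \<Rightarrow> 'a \<Rightarrow> complex" and g :: "nat \<Rightarrow> 'b \<Rightarrow> complex"
  assumes S: "S \<in> bounded_ops m n" and fg: "nuclear_pair m n f g"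
    and f0: "f0 \<in> sq_integrable m" "\<And>x. f0 x \<noteq> 0" and g0: "g0 \<in> sq_integrable n" "\<And>y. g0 y \<noteq> 0"
    and ann: "\<And>a b. a \<in> Linf m \<Longrightarrow> b \<in> Linf n \<Longrightarrow>
      pairing m n S (\<lambda>i x. a x * f i x) (\<lambda>i y. b y * g i y) = 0"
    and \<xi>: "square_summable \<xi>" and \<eta>: "square_summable \<eta>" and e: "0 < e"
    and small: "e * (ell2 \<xi> + ell2 \<eta> + e) < cmod (\<Sum>j. \<xi> j * \<eta> j)"
    and a: "a \<in> Linf m" "\<And>x. x \<notin> near_set m (\<lambda>i x. f i x / f0 x) \<xi> e \<Longrightarrow> a x = 0"
    and b: "b \<in> Linf n" "\<And>y. y \<notin> near_set n (\<lambda>i y. g i y / g0 y) \<eta> e \<Longrightarrow> b y = 0"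
  shows "form m n S (\<lambda>x. a x * f0 x) (\<lambda>y. b y * g0 y) = 0"
proof -
  define F where "F = (\<lambda>i x. f i x / f0 x)"
  define G where "G = (\<lambda>i y. g i y / g0 y)"
  define c where "c = (\<Sum>j. \<xi> j * \<eta> j)"
  define \<theta> where "\<theta> = e * (ell2 \<xi> + ell2 \<eta> + e) / cmod c"
  define \<A> where "\<A> = {a \<in> Linf m. \<forall>x. x \<notin> near_set m F \<xi> e \<longrightarrow> a x = 0}"
  define \<B> where "\<B> = {b \<in> Linf n. \<forall>y. y \<notin> near_set n G \<eta> e \<longrightarrow> b y = 0}"
  define X where "X a b = form m n S (\<lambda>x. a x * f0 x) (\<lambda>y. b y * g0 y)" for a b
  define P where "P C \<longleftrightarrow> (\<forall>a\<in>\<A>. \<forall>b\<in>\<B>. cmod (X a b) \<le>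
     C * (snorm m (\<lambda>x. a x * f0 x) * snorm n (\<lambda>y. b y * g0 y)))" for C
  have nn: "0 \<le> ell2 \<xi>" "0 \<le> ell2 \<eta>" using \<xi> \<eta> by (auto intro: ell2_nonneg)
  have "0 \<le> e * (ell2 \<xi> + ell2 \<eta> + e)" using e nn by simp
  then have c: "0 < cmod c" using small unfolding c_def by linarith
  have \<theta>: "0 \<le> \<theta>" "\<theta> < 1" using small e nn c by (auto simp: \<theta>_def c_def)
  note [measurable] = sq_integrableD(1)[OF nuclear_pairD(1)[OF fg]] sq_integrableD(1)[OF nuclear_pairD(2)[OF fg]]
    sq_integrableD(1)[OF f0(1)] sq_integrableD(1)[OF g0(1)]
  have Fm [measurable]: "F i \<in> borel_measurable m" and Gm [measurable]: "G i \<in> borel_measurable n" for i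
    unfolding F_def G_def by measurable
  have bdd: "(\<lambda>x. u x * H x) \<in> Linf M"
    if u: "u \<in> Linf M" and H: "H \<in> borel_measurable M" and K: "\<And>x. u x \<noteq> 0 \<Longrightarrow> cmod (H x) \<le> K"
    for M :: "'c measure" and u H K
  proof -
    obtain C where [measurable]: "u \<in> borel_measurable M" and C: "AE x in M. cmod (u x) \<le> C"
      using u by (auto simp: Linf_def)
    have "AE x in M. cmod (u x * H x) \<le> C * \<bar>K\<bar>"
      using C
    proof eventually_elim
      case (elim x)
      show ?case
      proof (cases "u x = 0")
        case True
        then show ?thesis using elim norm_ge_zero[of "u x"] by simp
      next
        case False
        then have "cmod (H x) \<le> \<bar>K\<bar>" using K[of x] by linarith
        with elim show ?thesis unfolding norm_mult by (intro mult_mono') auto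
      qed
    qed
    then have "\<exists>C. AE x in M. cmod (u x * H x) \<le> C" ..
    then show ?thesis using H by (simp add: Linf_def)
  qed
  have step: "P (\<theta> * C)" if P: "P C" and C: "0 \<le> C" for C
    unfolding P_def
  proof (intro ballI)
    fix a b assume aA: "a \<in> \<A>" and bB: "b \<in> \<B>"
    then have a: "a \<in> Linf m" "\<And>x. a x \<noteq> 0 \<Longrightarrow> x \<in> near_set m F \<xi> e"
      and b: "b \<in> Linf n" "\<And>y. b y \<noteq> 0 \<Longrightarrow> y \<in> near_set n G \<eta> e"
      by (auto simp: \<A>_def \<B>_def)
    let ?Na = "snorm m (\<lambda>x. a x * f0 x)" and ?Nb = "snorm n (\<lambda>y. b y * g0 y)"
    have am: "(\<lambda>x. a x * f0 x) \<in> sq_integrable m" and bm: "(\<lambda>y. b y * g0 y) \<in> sq_integrable n"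
      by (intro Linf_mult_sq_integrable a f0 b g0)+
    define p where "p i x = a x * (F i x - \<xi> i)" for i x
    define q where "q i y = b y * (G i y - \<eta> i)" for i y
    define r where "r i y = b y * G i y" for i y
    have comp: "cmod (H i z - \<zeta> i) \<le> ell2 \<zeta> + e + cmod (\<zeta> i)"
      if "z \<in> near_set M H \<zeta> e" "square_summable \<zeta>" for M :: "'c measure" and H \<zeta> z i
      using near_setD(7)[OF that, of i] norm_triangle_ineq4[of "H i z" "\<zeta> i"] by linarith
    have pA: "p i \<in> \<A>" for i
    proof -
      have "(\<lambda>x. a x * (F i x - \<xi> i)) \<in> Linf m"
        by (rule bdd[OF a(1), of _ "ell2 \<xi> + e + cmod (\<xi> i)"]) (use comp[OF a(2) \<xi>] in auto)
      then show ?thesis using a(2) by (auto simp: \<A>_def p_def[abs_def])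
    qed
    have qB: "q i \<in> \<B>" for i
    proof -
      have "(\<lambda>y. b y * (G i y - \<eta> i)) \<in> Linf n"
        by (rule bdd[OF b(1), of _ "ell2 \<eta> + e + cmod (\<eta> i)"]) (use comp[OF b(2) \<eta>] in auto)
      then show ?thesis using b(2) by (auto simp: \<B>_def q_def[abs_def])
    qed
    have rB: "r i \<in> \<B>" for i
    proof -
      have "(\<lambda>y. b y * G i y) \<in> Linf n"
        by (rule bdd[OF b(1), of _ "ell2 \<eta> + e"]) (use near_setD(7)[OF b(2) \<eta>] in auto)
      then show ?thesis using b(2) by (auto simp: \<B>_def r_def[abs_def])
    qed
    have saA: "(\<lambda>x. \<xi> i * a x) \<in> \<A>" for i
      using Linf_mult[OF Linf_const[of "\<xi> i"] a(1)] a(2) by (auto simp: \<A>_def)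
    have sqA: "(\<lambda>x. u x * f0 x) \<in> sq_integrable m" if "u \<in> \<A>" for u
      using that by (intro Linf_mult_sq_integrable f0) (simp add: \<A>_def)
    have sqB: "(\<lambda>y. u y * g0 y) \<in> sq_integrable n" if "u \<in> \<B>" for u
      using that by (intro Linf_mult_sq_integrable g0) (simp add: \<B>_def)
    have estimate: "summable (\<lambda>i. X (u i) (v i)) \<and> cmod (\<Sum>i. X (u i) (v i)) \<le> C * ((K * ?Na) * (L * ?Nb))"
      if u: "\<And>i. u i \<in> \<A>" and v: "\<And>i. v i \<in> \<B>" and K: "0 \<le> K" and L: "0 \<le> L"
        and uK: "\<And>x. a x \<noteq> 0 \<Longrightarrow> square_summable (\<lambda>i. u i x) \<and> ell2 (\<lambda>i. u i x) \<le> K * cmod (a x)"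
        and vL: "\<And>y. b y \<noteq> 0 \<Longrightarrow> square_summable (\<lambda>i. v i y) \<and> ell2 (\<lambda>i. v i y) \<le> L * cmod (b y)"
        and u0: "\<And>i x. a x = 0 \<Longrightarrow> u i x = 0" and v0: "\<And>i y. b y = 0 \<Longrightarrow> v i y = 0"
      for u v K L
    proof -
      have sc: "square_summable (\<lambda>i. w i * z) \<and> ell2 (\<lambda>i. w i * z) \<le> K' * cmod (k * z)"
        if "square_summable w" "ell2 w \<le> K' * cmod k" for w z k K'
      proof -
        have "ell2 (\<lambda>i. w i * z) = ell2 w * cmod z"
          using that(1) unfolding ell2_def square_summable_def
          by (simp add: norm_mult power_mult_distrib suminf_mult2[symmetric] real_sqrt_mult)
        then show ?thesis
          using that square_summable_scale[OF that(1), of z] mult_right_mono[OF that(2) norm_ge_zero[of z]]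
          by (simp add: norm_mult mult_ac)
      qed
      have z: "square_summable (\<lambda>i. 0)" "ell2 (\<lambda>i. 0) = 0"
        by (auto simp: square_summable_def ell2_def)
      have 1: "AE x in m. square_summable (\<lambda>i. u i x * f0 x) \<and> ell2 (\<lambda>i. u i x * f0 x) \<le> K * cmod (a x * f0 x)"
      proof (rule AE_I2)
        fix x
        show "square_summable (\<lambda>i. u i x * f0 x) \<and> ell2 (\<lambda>i. u i x * f0 x) \<le> K * cmod (a x * f0 x)"
        proof (cases "a x = 0")
          case True
          then show ?thesis by (simp add: u0 z)
        next
          case False
          from uK[OF this] show ?thesis by (intro sc) auto
        qed
      qed
      have 2: "AE y in n. square_summable (\<lambda>i. v i y * g0 y) \<and> ell2 (\<lambda>i. v i y * g0 y) \<le> L * cmod (b y * g0 y)"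
      proof (rule AE_I2)
        fix y
        show "square_summable (\<lambda>i. v i y * g0 y) \<and> ell2 (\<lambda>i. v i y * g0 y) \<le> L * cmod (b y * g0 y)"
        proof (cases "b y = 0")
          case True
          then show ?thesis by (simp add: v0 z)
        next
          case False
          from vL[OF this] show ?thesis by (intro sc) auto
        qed
      qed
      note su = sum_snorm_le[OF sqA[OF u] am K 1] and sv = sum_snorm_le[OF sqB[OF v] bm L 2]
      note cs = suminf_mult_le_sqrt[OF su(1) sv(1)]
      have le: "cmod (X (u i) (v i)) \<le> C * \<bar>snorm m (\<lambda>x. u i x * f0 x) * snorm n (\<lambda>y. v i y * g0 y)\<bar>" for i
        using P u[of i] v[of i] by (simp add: P_def)
      have s: "summable (\<lambda>i. cmod (X (u i) (v i)))"
        by (rule summable_comparison_test'[OF summable_mult[OF cs(1), of C]]) (use le in auto)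
      have "cmod (\<Sum>i. X (u i) (v i)) \<le> (\<Sum>i. cmod (X (u i) (v i)))" by (rule summable_norm[OF s])
      also have "\<dots> \<le> (\<Sum>i. C * \<bar>snorm m (\<lambda>x. u i x * f0 x) * snorm n (\<lambda>y. v i y * g0 y)\<bar>)"
        by (rule suminf_le[OF le s summable_mult[OF cs(1)]])
      also have "\<dots> = C * (\<Sum>i. \<bar>snorm m (\<lambda>x. u i x * f0 x) * snorm n (\<lambda>y. v i y * g0 y)\<bar>)"
        by (rule suminf_mult[OF cs(1)])
      also have "\<dots> \<le> C * ((K * ?Na) * (L * ?Nb))"
        by (intro mult_left_mono order_trans[OF cs(2)] mult_mono su(2) sv(2) C)
           (auto intro!: mult_nonneg_nonneg K suminf_nonneg su(1) sv(1) simp del: snorm_square)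
      finally show ?thesis using summable_norm_cancel[OF s] by simp
    qed
    have sce: "square_summable (\<lambda>i. z * w i) \<and> ell2 (\<lambda>i. z * w i) \<le> K' * cmod z"
      if "square_summable w" "ell2 w \<le> K'" for w z K'
    proof -
      have "ell2 (\<lambda>i. z * w i) = cmod z * ell2 w"
        using that(1) unfolding ell2_def square_summable_def
        by (simp add: norm_mult power_mult_distrib suminf_mult real_sqrt_mult)
      then show ?thesis
        using square_summable_scale[OF that(1), of z] mult_right_mono[OF that(2) norm_ge_zero[of z]]
        by (simp add: mult.commute)
    qed
    have pe: "square_summable (\<lambda>i. p i x) \<and> ell2 (\<lambda>i. p i x) \<le> e * cmod (a x)" if "a x \<noteq> 0" for x
      unfolding p_def by (rule sce[OF near_setD(3)[OF a(2)[OF that] \<xi>] near_setD(4)[OF a(2)[OF that] \<xi>]])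
    have qe: "square_summable (\<lambda>i. q i y) \<and> ell2 (\<lambda>i. q i y) \<le> e * cmod (b y)" if "b y \<noteq> 0" for y
      unfolding q_def by (rule sce[OF near_setD(3)[OF b(2)[OF that] \<eta>] near_setD(4)[OF b(2)[OF that] \<eta>]])
    have re: "square_summable (\<lambda>i. r i y) \<and> ell2 (\<lambda>i. r i y) \<le> (ell2 \<eta> + e) * cmod (b y)" if "b y \<noteq> 0" for y
      unfolding r_def by (rule sce[OF near_setD(2)[OF b(2)[OF that] \<eta>] near_setD(5)[OF b(2)[OF that] \<eta>]])
    have xe: "square_summable (\<lambda>i. \<xi> i * a x) \<and> ell2 (\<lambda>i. \<xi> i * a x) \<le> ell2 \<xi> * cmod (a x)" for x
      using sce[OF \<xi> order_refl, of "a x"] by (simp add: mult.commute)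
    have E1: "summable (\<lambda>i. X (p i) (r i)) \<and> cmod (\<Sum>i. X (p i) (r i)) \<le> C * ((e * ?Na) * ((ell2 \<eta> + e) * ?Nb))"
      by (rule estimate[OF pA rB _ _ pe re]) (use e nn in \<open>auto simp: p_def r_def\<close>)
    have E2: "summable (\<lambda>i. X (\<lambda>x. \<xi> i * a x) (q i)) \<and>
        cmod (\<Sum>i. X (\<lambda>x. \<xi> i * a x) (q i)) \<le> C * ((ell2 \<xi> * ?Na) * (e * ?Nb))"
      by (rule estimate[OF saA qB _ _ xe qe]) (use e nn in \<open>auto simp: q_def\<close>)
    \<comment> \<open>\<open>a F\<^sub>i = p\<^sub>i + \<xi>\<^sub>i a\<close> and \<open>b G\<^sub>i = r\<^sub>i = q\<^sub>i + \<eta>\<^sub>i b\<close>, where \<open>p\<^sub>i\<close> and \<open>q\<^sub>i\<close> are the small parts.\<close>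
    have summand: "form m n S (\<lambda>x. a x * f i x) (\<lambda>y. b y * g i y) =
        X (p i) (r i) + X (\<lambda>x. \<xi> i * a x) (q i) + \<xi> i * \<eta> i * X a b" for i
    proof -
      have f': "(\<lambda>x. a x * f i x) = (\<lambda>x. p i x * f0 x + \<xi> i * (a x * f0 x))"
        using f0(2) by (auto simp: p_def F_def field_simps)
      have g': "(\<lambda>y. b y * g i y) = (\<lambda>y. r i y * g0 y)"
        using g0(2) by (auto simp: r_def G_def)
      have r': "(\<lambda>y. r i y * g0 y) = (\<lambda>y. q i y * g0 y + \<eta> i * (b y * g0 y))"
        by (auto simp: r_def q_def algebra_simps)
      have "form m n S (\<lambda>x. a x * f i x) (\<lambda>y. b y * g i y) =
          X (p i) (r i) + \<xi> i * form m n S (\<lambda>x. a x * f0 x) (\<lambda>y. r i y * g0 y)"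
        unfolding f' g' X_def
        by (simp add: form_add_left[OF S sqA[OF pA] sq_integrable_scale[OF am] sqB[OF rB]]
              form_scale_left[OF S am sqB[OF rB]])
      also have "form m n S (\<lambda>x. a x * f0 x) (\<lambda>y. r i y * g0 y) =
          form m n S (\<lambda>x. a x * f0 x) (\<lambda>y. q i y * g0 y) + \<eta> i * X a b"
        unfolding r' X_def
        by (simp add: form_add_right[OF S am sqB[OF qB] sq_integrable_scale[OF bm]] form_scale_right)
      also have "\<xi> i * (form m n S (\<lambda>x. a x * f0 x) (\<lambda>y. q i y * g0 y) + \<eta> i * X a b) =
          X (\<lambda>x. \<xi> i * a x) (q i) + \<xi> i * \<eta> i * X a b"
        unfolding X_def
        by (simp add: form_scale_left[OF S am sqB[OF qB], symmetric] distrib_left mult.assoc)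
      finally show ?thesis by (simp add: add.assoc)
    qed
    have "(\<lambda>i. X (p i) (r i) + X (\<lambda>x. \<xi> i * a x) (q i) + \<xi> i * \<eta> i * X a b) sums
        ((\<Sum>i. X (p i) (r i)) + (\<Sum>i. X (\<lambda>x. \<xi> i * a x) (q i)) + c * X a b)"
      unfolding c_def using E1 E2 square_summable_product(2)[OF \<xi> \<eta>]
      by (intro sums_add sums_mult2 summable_sums) auto
    moreover have "(\<lambda>i. form m n S (\<lambda>x. a x * f i x) (\<lambda>y. b y * g i y)) sums 0"
      using pairing_sums[OF S nuclear_pair_Linf[OF fg a(1) b(1)]] ann[OF a(1) b(1)] by simp
    ultimately have "(\<Sum>i. X (p i) (r i)) + (\<Sum>i. X (\<lambda>x. \<xi> i * a x) (q i)) + c * X a b = 0"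
      unfolding summand by (rule sums_unique2)
    then have eq: "c * X a b = - ((\<Sum>i. X (p i) (r i)) + (\<Sum>i. X (\<lambda>x. \<xi> i * a x) (q i)))"
      by (rule minus_unique[symmetric])
    have "cmod c * cmod (X a b) = cmod ((\<Sum>i. X (p i) (r i)) + (\<Sum>i. X (\<lambda>x. \<xi> i * a x) (q i)))"
      unfolding norm_mult[symmetric] eq by (rule norm_minus_cancel)
    also have "\<dots> \<le> C * ((e * ?Na) * ((ell2 \<eta> + e) * ?Nb)) + C * ((ell2 \<xi> * ?Na) * (e * ?Nb))"
      using E1 E2 by (intro norm_triangle_le add_mono) auto
    also have "\<dots> = cmod c * (\<theta> * C * (?Na * ?Nb))"
      using c by (simp add: \<theta>_def field_simps)
    finally show "cmod (X a b) \<le> \<theta> * C * (?Na * ?Nb)" using c by simp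
  qed
  obtain C where C: "0 \<le> C" "\<And>f g. f \<in> sq_integrable m \<Longrightarrow> g \<in> sq_integrable n \<Longrightarrow>
      cmod (form m n S f g) \<le> C * snorm m f * snorm n g"
    using form_bound[OF S] by blast
  have "P C"
    unfolding P_def X_def \<A>_def \<B>_def
    using C(2)[OF Linf_mult_sq_integrable[OF _ f0(1)] Linf_mult_sq_integrable[OF _ g0(1)]]
    by (simp add: mult.assoc)
  then have Pk: "P (\<theta> ^ k * C)" for k
  proof (induction k)
    case (Suc k)
    then show ?case using step[OF Suc.IH[OF Suc.prems]] \<theta> C(1) by (simp add: mult.assoc)
  qed simp
  have abA: "a \<in> \<A>" "b \<in> \<B>" using a b by (auto simp: \<A>_def \<B>_def F_def G_def)
  let ?N = "snorm m (\<lambda>x. a x * f0 x) * snorm n (\<lambda>y. b y * g0 y)"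
  have "(\<lambda>k. \<theta> ^ k * C * ?N) \<longlonglongrightarrow> 0 * C * ?N"
    by (intro tendsto_mult tendsto_const LIMSEQ_power_zero) (use \<theta> in auto)
  then have "cmod (X a b) \<le> 0 * C * ?N"
    by (rule LIMSEQ_le_const) (use Pk abA in \<open>auto simp: P_def\<close>)
  then show ?thesis by (simp add: X_def)
qed

section \<open>Vanishing of the pairing and countable additivity over rectangles\<close>

lemma sq_combination:
  fixes c :: "nat \<Rightarrow> complex"
  assumes c: "square_summable c" and f: "\<And>i. f i \<in> sq_integrable m"
    and s: "summable (\<lambda>i. (snorm m (f i))\<^sup>2)"
  shows "(\<lambda>x. \<Sum>i. c i * f i x) \<in> sq_integrable m"
    and "snorm m (\<lambda>x. \<Sum>i. c i * f i x) \<le> ell2 c * sqrt (\<Sum>i. (snorm m (f i))\<^sup>2)"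
proof -
  note [measurable] = sq_integrableD(1)[OF f]
  note w = square_summable_AE[OF f s[unfolded snorm_square]]
  let ?z = "\<lambda>x. \<Sum>i. c i * f i x"
  have [measurable]: "?z \<in> borel_measurable m" by measurable
  have i: "integrable m (\<lambda>x. (ell2 c)\<^sup>2 * (\<Sum>i. (cmod (f i x))\<^sup>2))" using w(2) by simp
  have le: "AE x in m. (cmod (?z x))\<^sup>2 \<le> (ell2 c)\<^sup>2 * (\<Sum>i. (cmod (f i x))\<^sup>2)"
    using w(1)
  proof eventually_elim
    case (elim x)
    have "(cmod (?z x))\<^sup>2 \<le> (ell2 c * ell2 (\<lambda>i. f i x))\<^sup>2"
      by (intro power_mono square_summable_product(3) c elim) simp
    also have "\<dots> = (ell2 c)\<^sup>2 * (\<Sum>i. (cmod (f i x))\<^sup>2)"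
      using elim by (simp add: power_mult_distrib ell2_def square_summable_def suminf_nonneg)
    finally show ?case .
  qed
  have zi: "integrable m (\<lambda>x. (cmod (?z x))\<^sup>2)"
  proof (rule Bochner_Integration.integrable_bound[OF i])
    show "AE x in m. norm ((cmod (?z x))\<^sup>2) \<le> norm ((ell2 c)\<^sup>2 * (\<Sum>i. (cmod (f i x))\<^sup>2))"
      using le by eventually_elim auto
  qed measurable
  then show "?z \<in> sq_integrable m" by (simp add: sq_integrable_def)
  have "(snorm m ?z)\<^sup>2 \<le> (LINT x|m. (ell2 c)\<^sup>2 * (\<Sum>i. (cmod (f i x))\<^sup>2))"
    unfolding snorm_square by (rule integral_mono_AE[OF zi i le])
  also have "\<dots> = (ell2 c)\<^sup>2 * (\<Sum>i. (snorm m (f i))\<^sup>2)"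
    using w(3) by simp
  also have "\<dots> = (ell2 c * sqrt (\<Sum>i. (snorm m (f i))\<^sup>2))\<^sup>2"
    using suminf_nonneg[OF s] by (simp add: power_mult_distrib del: snorm_square)
  finally show "snorm m ?z \<le> ell2 c * sqrt (\<Sum>i. (snorm m (f i))\<^sup>2)"
    by (rule power2_le_imp_le) (intro mult_nonneg_nonneg ell2_nonneg c real_sqrt_ge_zero suminf_nonneg s zero_le_power2)
qed

lemma op_fun_sum:
  fixes N :: nat
  assumes T: "T \<in> bounded_ops m n" and f: "\<And>i. f i \<in> sq_integrable m"
  shows "AE y in n. op_fun m T (\<lambda>x. \<Sum>i<N. c i * f i x) y = (\<Sum>i<N. c i * op_fun m T (f i) y)"
proof (induction N)
  case 0
  show ?case using op_fun_scale[OF T sq_integrable_zero, of 0] by simp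
next
  case (Suc N)
  have 1: "(\<lambda>x. \<Sum>i<N. c i * f i x) \<in> sq_integrable m" by (intro sq_integrable_sum sq_integrable_scale f)
  have 2: "(\<lambda>x. c N * f N x) \<in> sq_integrable m" by (rule sq_integrable_scale[OF f])
  show ?case
    using Suc.IH op_fun_add[OF T 1 2] op_fun_scale[OF T f[of N], of "c N"]
    unfolding sum.lessThan_Suc
    by eventually_elim simp
qed

lemma ell2_tail_tendsto:
  assumes "square_summable c"
  shows "(\<lambda>N. ell2 (\<lambda>i. c (i + N))) \<longlonglongrightarrow> 0"
proof -
  have s: "summable (\<lambda>i. (cmod (c i))\<^sup>2)" using assms by (simp add: square_summable_def)
  have "(\<lambda>N. sqrt ((\<Sum>i. (cmod (c i))\<^sup>2) - (\<Sum>i<N. (cmod (c i))\<^sup>2))) \<longlonglongrightarrow>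
      sqrt ((\<Sum>i. (cmod (c i))\<^sup>2) - (\<Sum>i. (cmod (c i))\<^sup>2))"
    by (intro tendsto_real_sqrt tendsto_diff tendsto_const summable_LIMSEQ s)
  then show ?thesis
    by (simp add: ell2_def suminf_minus_initial_segment[OF s])
qed

lemma sq_combination_tail:
  fixes c :: "nat \<Rightarrow> complex"
  assumes c: "square_summable c" and f: "\<And>i. f i \<in> sq_integrable m"
    and s: "summable (\<lambda>i. (snorm m (f i))\<^sup>2)"
  shows "(\<lambda>x. \<Sum>i. c (i + N) * f (i + N) x) \<in> sq_integrable m"
    and "snorm m (\<lambda>x. \<Sum>i. c (i + N) * f (i + N) x) \<le>
      ell2 (\<lambda>i. c (i + N)) * sqrt (\<Sum>i. (snorm m (f i))\<^sup>2)"
    and "AE x in m. (\<Sum>i. c i * f i x) = (\<Sum>i. c (i + N) * f (i + N) x) + (\<Sum>i<N. c i * f i x)"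
proof -
  have cN: "square_summable (\<lambda>i. c (i + N))"
    using c unfolding square_summable_def
    by (rule summable_ignore_initial_segment[of "\<lambda>i. (cmod (c i))\<^sup>2"])
  have s': "summable (\<lambda>i. (snorm m (f (i + N)))\<^sup>2)" by (rule summable_ignore_initial_segment[OF s])
  show "(\<lambda>x. \<Sum>i. c (i + N) * f (i + N) x) \<in> sq_integrable m"
    by (rule sq_combination(1)[OF cN f s'])
  have "snorm m (\<lambda>x. \<Sum>i. c (i + N) * f (i + N) x) \<le>
      ell2 (\<lambda>i. c (i + N)) * sqrt (\<Sum>i. (snorm m (f (i + N)))\<^sup>2)"
    by (rule sq_combination(2)[OF cN f s'])
  also have "\<dots> \<le> ell2 (\<lambda>i. c (i + N)) * sqrt (\<Sum>i. (snorm m (f i))\<^sup>2)"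
  proof (intro mult_left_mono real_sqrt_le_mono ell2_nonneg cN)
    show "(\<Sum>i. (snorm m (f (i + N)))\<^sup>2) \<le> (\<Sum>i. (snorm m (f i))\<^sup>2)"
      using suminf_split_initial_segment[OF s, of N] sum_nonneg[of "{..<N}" "\<lambda>i. (snorm m (f i))\<^sup>2"]
      by (simp del: snorm_square)
  qed
  finally show "snorm m (\<lambda>x. \<Sum>i. c (i + N) * f (i + N) x) \<le>
      ell2 (\<lambda>i. c (i + N)) * sqrt (\<Sum>i. (snorm m (f i))\<^sup>2)" .
  show "AE x in m. (\<Sum>i. c i * f i x) = (\<Sum>i. c (i + N) * f (i + N) x) + (\<Sum>i<N. c i * f i x)"
    using square_summable_AE(1)[OF f s[unfolded snorm_square]]
    by eventually_elim (rule suminf_split_initial_segment, rule square_summable_product(2)[OF c])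
qed

text \<open>A bounded operator commutes with infinite combinations with square summable coefficients:
  the tails of both series are small in norm because the tails of the coefficients are.\<close>
lemma op_fun_infinite_combination_zero:
  fixes c :: "nat \<Rightarrow> complex"
  assumes T: "T \<in> bounded_ops m n" and c: "square_summable c" and f: "\<And>i. f i \<in> sq_integrable m"
    and s: "summable (\<lambda>i. (snorm m (f i))\<^sup>2)" and zero: "AE x in m. (\<Sum>i. c i * f i x) = 0"
    and st: "summable (\<lambda>i. (snorm n (op_fun m T (f i)))\<^sup>2)"
  shows "AE y in n. (\<Sum>i. c i * op_fun m T (f i) y) = 0"
proof -
  note t = op_fun(1)[OF T f]
  obtain C where C: "0 \<le> C" "\<And>f. f \<in> sq_integrable m \<Longrightarrow> snorm n (op_fun m T f) \<le> C * snorm m f"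
    using op_fun_bound[OF T] by blast
  define z where "z y = (\<Sum>i. c i * op_fun m T (f i) y)" for y
  define part where "part N x = (\<Sum>i<N. c i * f i x)" for N x
  define rf where "rf N x = (\<Sum>i. c (i + N) * f (i + N) x)" for N x
  define rt where "rt N y = (\<Sum>i. c (i + N) * op_fun m T (f (i + N)) y)" for N y
  define e where "e N = ell2 (\<lambda>i. c (i + N))" for N
  define Wf where "Wf = sqrt (\<Sum>i. (snorm m (f i))\<^sup>2)"
  define Wt where "Wt = sqrt (\<Sum>i. (snorm n (op_fun m T (f i)))\<^sup>2)"
  note tailf = sq_combination_tail[OF c f s, folded rf_def e_def Wf_def]
  note tailt = sq_combination_tail[OF c t st, folded rt_def e_def Wt_def z_def]
  have z: "z \<in> sq_integrable n" unfolding z_def by (rule sq_combination(1)[OF c t st])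
  have "snorm n z \<le> e N * Wt + C * (e N * Wf)" for N
  proof -
    have p: "part N \<in> sq_integrable m" unfolding part_def by (intro sq_integrable_sum sq_integrable_scale f)
    have "AE x in m. part N x = (-1) * rf N x"
      using tailf(3)[of N] zero
      by eventually_elim (simp add: part_def eq_neg_iff_add_eq_0 add.commute)
    then have "snorm m (part N) = snorm m (\<lambda>x. (-1) * rf N x)"
      using sq_integrableD(1)[OF p] sq_integrableD(1)[OF tailf(1)[of N]] by (intro snorm_cong_AE) auto
    then have pN: "snorm m (part N) \<le> e N * Wf"
      using tailf(2)[of N] by (simp only: snorm_scale norm_minus_cancel norm_one mult_1)
    have "AE y in n. z y = rt N y + op_fun m T (part N) y"
      using tailt(3)[of N] op_fun_sum[where f=f and N=N and c=c, OF T f]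
      unfolding part_def by eventually_elim simp
    then have "snorm n z = snorm n (\<lambda>y. rt N y + op_fun m T (part N) y)"
      using sq_integrableD(1)[OF z] sq_integrableD(1)[OF tailt(1)[of N]] sq_integrableD(1)[OF op_fun(1)[OF T p]]
      by (intro snorm_cong_AE) auto
    also have "\<dots> \<le> snorm n (rt N) + snorm n (op_fun m T (part N))"
      by (rule snorm_add_le[OF tailt(1) op_fun(1)[OF T p]])
    also have "\<dots> \<le> e N * Wt + C * (e N * Wf)"
      by (intro add_mono tailt(2) order_trans[OF C(2)[OF p]] mult_left_mono pN C(1))
    finally show ?thesis .
  qed
  moreover have "(\<lambda>N. e N * Wt + C * (e N * Wf)) \<longlonglongrightarrow> 0 * Wt + C * (0 * Wf)"
    unfolding e_def by (intro tendsto_intros ell2_tail_tendsto c)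
  ultimately have "snorm n z \<le> 0 * Wt + C * (0 * Wf)"
    by (intro LIMSEQ_le_const) auto
  then have "snorm n z = 0" using snorm_nonneg[of n z] by simp
  then have "(LINT y|n. (cmod (z y))\<^sup>2) = 0" by (simp flip: snorm_square)
  then have "AE y in n. (cmod (z y))\<^sup>2 = 0"
    using integral_nonneg_eq_0_iff_AE[OF sq_integrableD(2)[OF z]] by simp
  then show ?thesis by (simp add: z_def)
qed

text \<open>Well-definedness of the pairing on functions. For almost every \<open>y\<close> the
  combination \<open>\<Sum>i. g\<^sub>i(y) f\<^sub>i\<close> is null, hence so is \<open>\<Sum>i.
  g\<^sub>i(y) (T f\<^sub>i)\<close>, while the pairing is the integral of this function evaluated at
  \<open>y\<close> itself. The diagonal may be a null set; but a cell on which the sum does not vanish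
  has a null side by the off-diagonal statement, so it meets the diagonal in a null set, and countably
  many cells suffice.\<close>
lemma pairing_zero_of_tensor_zero:
  assumes T: "T \<in> bounded_ops m n" and fg: "nuclear_pair m n f g"
    and zero: "AE y in n. AE x in m. (\<Sum>i. f i x * g i y) = 0"
  shows "pairing m n T f g = 0"
proof -
  note nd = nuclear_pairD[OF fg]
  define t where "t i = op_fun m T (f i)" for i
  have t: "t i \<in> sq_integrable n" for i unfolding t_def by (rule op_fun(1)[OF T nd(1)])
  obtain C where C: "0 \<le> C" "\<And>f. f \<in> sq_integrable m \<Longrightarrow> snorm n (op_fun m T f) \<le> C * snorm m f"
    using op_fun_bound[OF T] by blast
  have "(snorm n (t i))\<^sup>2 \<le> C\<^sup>2 * (snorm m (f i))\<^sup>2" for i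
    using power_mono[OF C(2)[OF nd(1)[of i]] snorm_nonneg, of 2]
    by (simp add: t_def power_mult_distrib del: snorm_square)
  then have st: "summable (\<lambda>i. (snorm n (t i))\<^sup>2)"
    by (intro summable_comparison_test'[OF summable_mult[OF nd(3), of "C\<^sup>2"]]) (simp del: snorm_square)
  note [measurable] = sq_integrableD(1)[OF t] sq_integrableD(1)[OF nd(2)]
  have sst: "AE y in n. square_summable (\<lambda>i. t i y)" by (rule square_summable_AE(1)[OF t st[unfolded snorm_square]])
  have ssg: "AE y in n. square_summable (\<lambda>i. g i y)" by (rule square_summable_AE(1)[OF nd(2) nd(4)[unfolded snorm_square]])
  have sec: "AE y in n. AE y' in n. (\<Sum>i. t i y' * g i y) = 0"
    using zero ssg
  proof eventually_elim
    case (elim y)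
    have "AE x in m. (\<Sum>i. g i y * f i x) = 0" using elim(1) by (simp add: mult.commute)
    from op_fun_infinite_combination_zero[OF T elim(2) nd(1) nd(3) this]
    show ?case using st by (simp add: t_def mult.commute del: snorm_square)
  qed
  obtain I :: "(nat \<times> nat \<times> nat) set" and \<xi> \<eta> e where cells:
    "\<And>i. i \<in> I \<Longrightarrow> square_summable (\<xi> i)" "\<And>i. i \<in> I \<Longrightarrow> square_summable (\<eta> i)" "\<And>i. i \<in> I \<Longrightarrow> 0 < e i"
    "\<And>i. i \<in> I \<Longrightarrow> e i * (ell2 (\<xi> i) + ell2 (\<eta> i) + e i) < cmod (\<Sum>j. \<xi> i j * \<eta> i j)"
    "\<And>x y. x \<in> space n \<Longrightarrow> y \<in> space n \<Longrightarrow> square_summable (\<lambda>j. t j x) \<Longrightarrow>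
       square_summable (\<lambda>j. g j y) \<Longrightarrow> (\<Sum>j. t j x * g j y) \<noteq> 0 \<Longrightarrow>
       \<exists>i\<in>I. x \<in> near_set n t (\<xi> i) (e i) \<and> y \<in> near_set n g (\<eta> i) (e i)"
    using nonvanishing_cells[of n n t g] by blast
  have null: "AE y in n. \<not> (y \<in> near_set n t (\<xi> i) (e i) \<and> y \<in> near_set n g (\<eta> i) (e i))" if i: "i \<in> I" for i
  proof (cases "\<exists>y. y \<in> near_set n g (\<eta> i) (e i) \<and> (AE y' in n. (\<Sum>i. t i y' * g i y) = 0)")
    case True
    then obtain y where y: "y \<in> near_set n g (\<eta> i) (e i)" "AE y' in n. (\<Sum>i. t i y' * g i y) = 0" by blast
    from y(2) show ?thesis
      by eventually_elim (use near_sets_product_nonzero[where m=n and F=t, OF _ y(1) cells(1,2,3,4)[OF i]] in auto)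
  next
    case False
    from sec show ?thesis by eventually_elim (use False in auto)
  qed
  have "AE y in n. \<forall>i\<in>I. \<not> (y \<in> near_set n t (\<xi> i) (e i) \<and> y \<in> near_set n g (\<eta> i) (e i))"
    by (subst AE_ball_countable) (use null in auto)
  then have diag: "AE y in n. (\<Sum>i. t i y * g i y) = 0"
    using sst ssg AE_space by eventually_elim (use cells(5) in blast)
  have int: "integrable n (\<lambda>y. t i y * g i y)" for i by (rule sq_integrable_product(1)[OF t nd(2)])
  have ae: "AE y in n. summable (\<lambda>i. norm (t i y * g i y))"
    using sst ssg by eventually_elim (rule square_summable_product(1))
  have s: "summable (\<lambda>i. LINT y|n. norm (t i y * g i y))"
    by (rule summable_comparison_test'[OF suminf_mult_le_sqrt(1)[OF st nd(4)]])
       (use sq_integrable_product(2)[OF t nd(2)] in \<open>simp add: integral_nonneg_AE\<close>)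
  have "pairing m n T f g = (\<Sum>i. LINT y|n. t i y * g i y)"
    by (simp add: pairing_eq_form[OF T nd(1,2)] form_def t_def)
  also have "\<dots> = (LINT y|n. (\<Sum>i. t i y * g i y))"
    by (rule integral_suminf[OF int ae s, symmetric])
  also have "\<dots> = 0" using diag by (intro integral_eq_zero_AE)
  finally show ?thesis .
qed

lemma restricted_norms_tendsto_0:
  assumes f: "\<And>i. f i \<in> sq_integrable m" and s: "summable (\<lambda>i. (snorm m (f i))\<^sup>2)"
    and D: "\<And>N. D N \<in> sets m" and out: "\<And>x. \<forall>\<^sub>F N in sequentially. x \<notin> D N"
  shows "(\<lambda>N. \<Sum>i. (snorm m (\<lambda>x. indicator (D N) x * f i x))\<^sup>2) \<longlonglongrightarrow> 0"
proof -
  note w = square_summable_AE[OF f s[unfolded snorm_square]]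
  define W where "W x = (\<Sum>i. (cmod (f i x))\<^sup>2)" for x
  have Wi: "integrable m W" using w(2) by (simp add: W_def[abs_def])
  note [measurable] = D borel_measurable_integrable[OF Wi]
  have eq: "(\<Sum>i. (snorm m (\<lambda>x. indicator (D N) x * f i x))\<^sup>2) = (LINT x|m. indicator (D N) x * W x)" for N
  proof -
    have le: "(snorm m (\<lambda>x. indicator (D N) x * f i x))\<^sup>2 \<le> (snorm m (f i))\<^sup>2" for i
      unfolding snorm_square
      by (rule integral_mono[OF sq_integrableD(2)[OF indicator_sq[OF D f]] sq_integrableD(2)[OF f]])
         (simp add: indicator_def)
    have "summable (\<lambda>i. (snorm m (\<lambda>x. indicator (D N) x * f i x))\<^sup>2)"
      by (rule summable_comparison_test'[OF s]) (use le in \<open>simp del: snorm_square\<close>)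
    from square_summable_AE(3)[OF indicator_sq[OF D f] this[unfolded snorm_square]]
    have "(\<Sum>i. (snorm m (\<lambda>x. indicator (D N) x * f i x))\<^sup>2) =
        (LINT x|m. (\<Sum>i. (cmod (indicator (D N) x * f i x))\<^sup>2))" by simp
    also have "(\<lambda>x. \<Sum>i. (cmod (indicator (D N) x * f i x))\<^sup>2) = (\<lambda>x. indicator (D N) x * W x)"
      by (auto simp: W_def indicator_def)
    finally show ?thesis .
  qed
  have "(\<lambda>N. LINT x|m. indicator (D N) x * W x) \<longlonglongrightarrow> (LINT x|m. 0)"
  proof (rule integral_dominated_convergence[where w = "\<lambda>x. \<bar>W x\<bar>"])
    show "AE x in m. (\<lambda>N. indicator (D N) x * W x) \<longlonglongrightarrow> 0"
    proof (rule AE_I2)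
      fix x
      have "\<forall>\<^sub>F N in sequentially. indicator (D N) x * W x = 0"
        using out[of x] by eventually_elim simp
      then show "(\<lambda>N. indicator (D N) x * W x) \<longlonglongrightarrow> 0" by (rule tendsto_eventually)
    qed
    show "AE x in m. norm (indicator (D N) x * W x) \<le> \<bar>W x\<bar>" for N
      by (simp add: indicator_def)
    show "integrable m (\<lambda>x. \<bar>W x\<bar>)" using Wi by simp
  qed auto
  then show ?thesis by (simp add: eq del: snorm_square)
qed

definition rect_pairing :: "'a measure \<Rightarrow> 'b measure \<Rightarrow> ('a, 'b) l2_op \<Rightarrow> (nat \<Rightarrow> 'a \<Rightarrow> complex) \<Rightarrow>
    (nat \<Rightarrow> 'b \<Rightarrow> complex) \<Rightarrow> 'a set \<Rightarrow> 'b set \<Rightarrow> complex" where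
  "rect_pairing m n T f g A B = pairing m n T (\<lambda>i x. indicator A x * f i x) (\<lambda>i y. indicator B y * g i y)"

lemma nuclear_pair_indicator:
  "nuclear_pair m n f g \<Longrightarrow> A \<in> sets m \<Longrightarrow> B \<in> sets n \<Longrightarrow>
    nuclear_pair m n (\<lambda>i x. indicator A x * f i x) (\<lambda>i y. indicator B y * g i y)"
  by (intro nuclear_pair_Linf Linf_indicator)

lemma rect_pairing_disjoint:
  assumes T: "T \<in> bounded_ops m n" and fg: "nuclear_pair m n f g"
  shows "A \<in> sets m \<Longrightarrow> A' \<in> sets m \<Longrightarrow> B \<in> sets n \<Longrightarrow> A \<inter> A' = {} \<Longrightarrow>
      rect_pairing m n T f g (A \<union> A') B = rect_pairing m n T f g A B + rect_pairing m n T f g A' B"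
    and "A \<in> sets m \<Longrightarrow> B \<in> sets n \<Longrightarrow> B' \<in> sets n \<Longrightarrow> B \<inter> B' = {} \<Longrightarrow>
      rect_pairing m n T f g A (B \<union> B') = rect_pairing m n T f g A B + rect_pairing m n T f g A B'"
proof -
  note nd = nuclear_pairD[OF fg]
  have ind: "indicator (C \<union> C') z * w = (indicator C z * w + indicator C' z * w :: complex)" if "C \<inter> C' = {}"
    for C C' :: "'c set" and z w using that by (auto simp: indicator_def)
  show "rect_pairing m n T f g (A \<union> A') B = rect_pairing m n T f g A B + rect_pairing m n T f g A' B"
    if A: "A \<in> sets m" "A' \<in> sets m" and B: "B \<in> sets n" and d: "A \<inter> A' = {}"
    unfolding rect_pairing_def
  proof (rule sums_unique2[OF pairing_sums[OF T nuclear_pair_indicator[OF fg sets.Un[OF A] B]]])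
    show "(\<lambda>i. form m n T (\<lambda>x. indicator (A \<union> A') x * f i x) (\<lambda>y. indicator B y * g i y)) sums
      (pairing m n T (\<lambda>i x. indicator A x * f i x) (\<lambda>i y. indicator B y * g i y) +
       pairing m n T (\<lambda>i x. indicator A' x * f i x) (\<lambda>i y. indicator B y * g i y))"
      unfolding ind[OF d] using A B
      by (simp add: form_add_left[OF T] indicator_sq nd)
         (intro sums_add pairing_sums[OF T] nuclear_pair_indicator fg)
  qed
  show "rect_pairing m n T f g A (B \<union> B') = rect_pairing m n T f g A B + rect_pairing m n T f g A B'"
    if A: "A \<in> sets m" and B: "B \<in> sets n" "B' \<in> sets n" and d: "B \<inter> B' = {}"
    unfolding rect_pairing_def
  proof (rule sums_unique2[OF pairing_sums[OF T nuclear_pair_indicator[OF fg A sets.Un[OF B]]]])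
    show "(\<lambda>i. form m n T (\<lambda>x. indicator A x * f i x) (\<lambda>y. indicator (B \<union> B') y * g i y)) sums
      (pairing m n T (\<lambda>i x. indicator A x * f i x) (\<lambda>i y. indicator B y * g i y) +
       pairing m n T (\<lambda>i x. indicator A x * f i x) (\<lambda>i y. indicator B' y * g i y))"
      unfolding ind[OF d] using A B
      by (simp add: form_add_right[OF T] indicator_sq nd)
         (intro sums_add pairing_sums[OF T] nuclear_pair_indicator fg)
  qed
qed

text \<open>An additive set function that is continuous at the empty set behaves like a measure in that
  it vanishes on a union once it vanishes hereditarily on the pieces.\<close>
lemma sigma_additive_zero:
  fixes \<mu> :: "'c set \<Rightarrow> complex"
  assumes A: "\<And>j::nat. A j \<in> sets M"
    and add: "\<And>C C'. C \<in> sets M \<Longrightarrow> C' \<in> sets M \<Longrightarrow> C \<inter> C' = {} \<Longrightarrow> \<mu> (C \<union> C') = \<mu> C + \<mu> C'"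
    and cont: "\<And>D. (\<And>N. D N \<in> sets M) \<Longrightarrow> (\<And>x. \<forall>\<^sub>F N in sequentially. x \<notin> D N) \<Longrightarrow> (\<lambda>N. \<mu> (D N)) \<longlonglongrightarrow> 0"
    and zero: "\<And>j C. C \<in> sets M \<Longrightarrow> C \<subseteq> A j \<Longrightarrow> \<mu> C = 0"
    and C: "C \<in> sets M" "C \<subseteq> (\<Union>j. A j)"
  shows "\<mu> C = 0"
proof -
  define U where "U N = (\<Union>j<N. A j)" for N
  have U: "U N \<in> sets M" for N using A by (auto simp: U_def)
  have fin: "\<mu> C = 0" if "C \<in> sets M" "C \<subseteq> U N" for C N
    using that
  proof (induction N arbitrary: C)
    case 0
    then show ?case using zero[of "{}" 0] by (simp add: U_def)
  next
    case (Suc N)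
    have "C = (C \<inter> A N) \<union> (C - A N)" by auto
    then have "\<mu> C = \<mu> (C \<inter> A N) + \<mu> (C - A N)"
      using add[of "C \<inter> A N" "C - A N"] Suc.prems(1) A by auto
    moreover have "\<mu> (C \<inter> A N) = 0" using zero[of "C \<inter> A N" N] Suc.prems(1) A by auto
    moreover have "\<mu> (C - A N) = 0"
      using Suc.prems A by (intro Suc.IH) (auto simp: U_def lessThan_Suc)
    ultimately show ?case by simp
  qed
  have eq: "\<mu> C = \<mu> (C - U N)" for N
  proof -
    have "C = (C \<inter> U N) \<union> (C - U N)" by auto
    then have "\<mu> C = \<mu> (C \<inter> U N) + \<mu> (C - U N)"
      using add[of "C \<inter> U N" "C - U N"] C(1) U by auto
    then show ?thesis using fin[of "C \<inter> U N" N] C(1) U by simp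
  qed
  have "(\<lambda>N. \<mu> (C - U N)) \<longlonglongrightarrow> 0"
  proof (rule cont)
    show "C - U N \<in> sets M" for N using C(1) U by simp
    fix x
    show "\<forall>\<^sub>F N in sequentially. x \<notin> C - U N"
    proof (cases "x \<in> C")
      case True
      then obtain j where j: "x \<in> A j" using C(2) by blast
      show ?thesis
        using eventually_gt_at_top[of j] by eventually_elim (use j in \<open>auto simp: U_def\<close>)
    qed simp
  qed
  then have "(\<lambda>N. \<mu> C) \<longlonglongrightarrow> 0" by (simp flip: eq)
  then show ?thesis by (simp add: LIMSEQ_const_iff)
qed

text \<open>Countable additivity in each side separately. The covering of \<open>C \<times> D\<close> is
  by a full grid, so that one side can be exhausted while the other one is kept within a single
  piece.\<close>
lemma rect_pairing_zero_cover:
  assumes T: "T \<in> bounded_ops m n" and fg: "nuclear_pair m n f g"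
    and A: "\<And>j::nat. A j \<in> sets m" and B: "\<And>k::nat. B k \<in> sets n"
    and zero: "\<And>j k C D. C \<in> sets m \<Longrightarrow> D \<in> sets n \<Longrightarrow> C \<subseteq> A j \<Longrightarrow> D \<subseteq> B k \<Longrightarrow> rect_pairing m n T f g C D = 0"
    and C: "C \<in> sets m" "C \<subseteq> (\<Union>j. A j)" and D: "D \<in> sets n" "D \<subseteq> (\<Union>k. B k)"
  shows "rect_pairing m n T f g C D = 0"
proof -
  note nd = nuclear_pairD[OF fg]
  obtain K where K: "0 \<le> K" "\<And>f g. nuclear_pair m n f g \<Longrightarrow> cmod (pairing m n T f g)
       \<le> K * (sqrt (\<Sum>i. (snorm m (f i))\<^sup>2) * sqrt (\<Sum>i. (snorm n (g i))\<^sup>2))"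
    using pairing_bound[OF T] by metis
  have bd: "cmod (rect_pairing m n T f g C D) \<le> K * (sqrt (\<Sum>i. (snorm m (\<lambda>x. indicator C x * f i x))\<^sup>2) *
      sqrt (\<Sum>i. (snorm n (\<lambda>y. indicator D y * g i y))\<^sup>2))" if "C \<in> sets m" "D \<in> sets n" for C D
    unfolding rect_pairing_def by (rule K(2)[OF nuclear_pair_indicator[OF fg that]])
  have left: "rect_pairing m n T f g C D = 0" if C: "C \<in> sets m" "C \<subseteq> (\<Union>j. A j)" and D: "D \<in> sets n" "D \<subseteq> B k" for C D k
  proof (rule sigma_additive_zero[OF A _ _ _ C, where \<mu> = "\<lambda>C. rect_pairing m n T f g C D"])
    show "(\<lambda>N. rect_pairing m n T f g (E N) D) \<longlonglongrightarrow> 0"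
      if E: "\<And>N. E N \<in> sets m" "\<And>x. \<forall>\<^sub>F N in sequentially. x \<notin> E N" for E
    proof (rule tendsto_norm_zero_cancel, rule tendsto_sandwich[OF _ _ tendsto_const])
      let ?b = "sqrt (\<Sum>i. (snorm n (\<lambda>y. indicator D y * g i y))\<^sup>2)"
      show "(\<lambda>N. K * (sqrt (\<Sum>i. (snorm m (\<lambda>x. indicator (E N) x * f i x))\<^sup>2) * ?b)) \<longlonglongrightarrow> 0"
        using tendsto_mult[OF tendsto_const[of K] tendsto_mult[OF tendsto_real_sqrt[OF
            restricted_norms_tendsto_0[OF nd(1,3) E]] tendsto_const[of ?b]]]
        by (simp del: snorm_square)
    qed (use bd E(1) D in auto)
  qed (use zero rect_pairing_disjoint(1)[OF T fg] D in auto)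
  show ?thesis
  proof (rule sigma_additive_zero[OF B _ _ _ D, where \<mu> = "rect_pairing m n T f g C"])
    show "(\<lambda>N. rect_pairing m n T f g C (E N)) \<longlonglongrightarrow> 0"
      if E: "\<And>N. E N \<in> sets n" "\<And>x. \<forall>\<^sub>F N in sequentially. x \<notin> E N" for E
    proof (rule tendsto_norm_zero_cancel, rule tendsto_sandwich[OF _ _ tendsto_const])
      let ?a = "sqrt (\<Sum>i. (snorm m (\<lambda>x. indicator C x * f i x))\<^sup>2)"
      show "(\<lambda>N. K * (?a * sqrt (\<Sum>i. (snorm n (\<lambda>y. indicator (E N) y * g i y))\<^sup>2))) \<longlonglongrightarrow> 0"
        using tendsto_mult[OF tendsto_const[of K] tendsto_mult[OF tendsto_const[of ?a] tendsto_real_sqrt[OF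
            restricted_norms_tendsto_0[OF nd(2,4) E]]]]
        by (simp del: snorm_square)
    qed (use bd E(1) C in auto)
  qed (use left C rect_pairing_disjoint(2)[OF T fg] in auto)
qed

section \<open>Idempotent Schur maps\<close>

text \<open>The property by which the definition of Schur maps selects the image of
  \<open>T\<close>.\<close>
definition schur_dual :: "'a measure \<Rightarrow> 'b measure \<Rightarrow> ('a \<times> 'b \<Rightarrow> complex) \<Rightarrow>
    ('a, 'b) l2_op \<Rightarrow> ('a, 'b) l2_op \<Rightarrow> bool" where
  "schur_dual m n \<phi> T S \<longleftrightarrow> S \<in> bounded_ops m n \<and>
     (\<forall>f g f' g'. nuclear_pair m n f g \<longrightarrow> nuclear_pair m n f' g' \<longrightarrow>
        (AE z in m \<Otimes>\<^sub>M n. \<phi> z * tensor_fun f g z = tensor_fun f' g' z) \<longrightarrow>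
        pairing m n S f g = pairing m n T f' g')"

lemma schur_dual_unique:
  assumes \<phi>: "schur_multiplier m n \<phi>" and S: "schur_dual m n \<phi> T S" and R: "schur_dual m n \<phi> T R"
  shows "S = R"
proof (rule bounded_ops_eqI)
  show Sb: "S \<in> bounded_ops m n" and Rb: "R \<in> bounded_ops m n" using S R by (auto simp: schur_dual_def)
  fix f g assume f: "f \<in> sq_integrable m" and g: "g \<in> sq_integrable n"
  note fg = nuclear_pair_single[OF f g]
  obtain f' g' where fg': "nuclear_pair m n f' g'"
    "AE z in m \<Otimes>\<^sub>M n. \<phi> z * tensor_fun (single_seq f) (single_seq g) z = tensor_fun f' g' z"
    using \<phi> fg unfolding schur_multiplier_def by blast
  have "pairing m n S (single_seq f) (single_seq g) = pairing m n R (single_seq f) (single_seq g)"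
    using S R fg fg' unfolding schur_dual_def by metis
  then show "form m n S f g = form m n R f g"
    by (simp add: pairing_single[OF Sb f g] pairing_single[OF Rb f g])
qed

lemma schur_map_eqI:
  assumes \<phi>: "schur_multiplier m n \<phi>" and T: "T \<in> bounded_ops m n" and S: "schur_dual m n \<phi> T S"
  shows "schur_map m n \<phi> T = S"
proof -
  have "schur_map m n \<phi> T = (THE S. schur_dual m n \<phi> T S)"
    using T by (simp add: schur_map_def schur_dual_def)
  also have "\<dots> = S" by (rule the_equality[where P="schur_dual m n \<phi> T", OF S])
    (rule schur_dual_unique[OF \<phi> _ S])
  finally show ?thesis .
qed

lemma schur_map_cases:
  assumes \<phi>: "schur_multiplier m n \<phi>" and T: "T \<in> bounded_ops m n"
  shows "schur_dual m n \<phi> T (schur_map m n \<phi> T) \<or> schur_map m n \<phi> T = (THE S. False)"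
proof (cases "\<exists>S. schur_dual m n \<phi> T S")
  case True
  then show ?thesis using schur_map_eqI[OF \<phi> T] by blast
next
  case False
  then have "schur_dual m n \<phi> T = (\<lambda>S. False)" by blast
  moreover have "schur_map m n \<phi> T = (THE S. schur_dual m n \<phi> T S)"
    using T by (simp add: schur_map_def schur_dual_def)
  ultimately show ?thesis by simp
qed

text \<open>The image of \<open>T\<close> takes the value \<open>\<langle>T, \<phi> (f \<otimes>
  g)\<rangle> = 0\<close> on \<open>f \<otimes> g\<close>. This also holds for the default value of
  \<open>schur_map_cases\<close> if it belongs to the range: its double is then in the range too, and
  either is a proper image or equals the default value; both alternatives give 0.\<close>
lemma schur_range_form_zero:
  assumes \<phi>: "schur_multiplier m n \<phi>" and sub: "op_subspace m n (schur_map m n \<phi> ` bounded_ops m n)"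
    and S: "S \<in> schur_map m n \<phi> ` bounded_ops m n"
    and f: "f \<in> sq_integrable m" and g: "g \<in> sq_integrable n"
    and zero: "AE z in m \<Otimes>\<^sub>M n. \<phi> z * (f (fst z) * g (snd z)) = 0"
  shows "form m n S f g = 0"
proof -
  let ?U = "schur_map m n \<phi> ` bounded_ops m n"
  have Ub: "?U \<subseteq> bounded_ops m n" using sub by (simp add: op_subspace_def)
  have dual: "form m n R f g = 0" if R: "schur_dual m n \<phi> T R" and T: "T \<in> bounded_ops m n" for R T
  proof -
    have Rb: "R \<in> bounded_ops m n" using R by (simp add: schur_dual_def)
    have "AE z in m \<Otimes>\<^sub>M n. \<phi> z * tensor_fun (single_seq f) (single_seq g) z =
        tensor_fun (single_seq (\<lambda>x. 0)) (single_seq (\<lambda>y. 0)) z"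
      using zero by eventually_elim (simp add: tensor_fun_single case_prod_beta)
    then have "pairing m n R (single_seq f) (single_seq g) =
        pairing m n T (single_seq (\<lambda>x. 0)) (single_seq (\<lambda>y. 0))"
      using R nuclear_pair_single[OF f g] nuclear_pair_single[OF sq_integrable_zero sq_integrable_zero]
      unfolding schur_dual_def by blast
    then show ?thesis
      by (simp add: pairing_single[OF Rb f g] pairing_single[OF T])
  qed
  define J :: "('a, 'b) l2_op" where "J = (THE S. False)"
  have range_cases: "form m n R f g = 0 \<or> R = J" if "R \<in> ?U" for R
    using that schur_map_cases[OF \<phi>] dual unfolding J_def by blast
  have "form m n J f g = 0" if J: "J \<in> ?U"
  proof -
    have Jb: "J \<in> bounded_ops m n" using J Ub by blast
    have "op_scale m n 2 J \<in> ?U" using sub J unfolding op_subspace_def by blast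
    from range_cases[OF this] show ?thesis
    proof
      assume "form m n (op_scale m n 2 J) f g = 0"
      then show ?thesis by (simp add: op_scale_form(2)[OF Jb f g])
    next
      assume "op_scale m n 2 J = J"
      then have "form m n J f g = 2 * form m n J f g"
        using op_scale_form(2)[OF Jb f g, of 2] by simp
      then show ?thesis by simp
    qed
  qed
  with range_cases[OF S] S show ?thesis by blast
qed

lemma nuclear_pair_cnj:
  "nuclear_pair m n f g \<Longrightarrow> nuclear_pair m n (\<lambda>i x. cnj (f i x)) (\<lambda>i y. cnj (g i y))"
  unfolding nuclear_pair_def by (simp add: sq_integrable_cnj)

lemma (in sigma_finite_measure) positive_sq_integrable:
  obtains h :: "'a \<Rightarrow> real" where "\<And>x. 0 < h x" "(\<lambda>x. complex_of_real (h x)) \<in> sq_integrable M"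
proof -
  obtain h :: "'a \<Rightarrow> real" where [measurable]: "h \<in> borel_measurable M" and h: "\<And>x. 0 < h x" "\<And>x. h x \<le> 1" "integrable M h"
    by (rule obtain_positive_integrable_function) blast
  have "integrable M (\<lambda>x. (h x)\<^sup>2)"
  proof (rule Bochner_Integration.integrable_bound[OF h(3)])
    show "AE x in M. norm ((h x)\<^sup>2) \<le> norm (h x)"
      using h by (intro AE_I2) (simp add: power2_eq_square abs_mult mult_left_le less_imp_le)
  qed measurable
  then have "(\<lambda>x. complex_of_real (h x)) \<in> sq_integrable M"
    by (simp add: sq_integrable_def)
  with h(1) show thesis by (rule that)
qed

context pair_sigma_finite
begin

text \<open>Both pairings are the integral of \<open>\<phi> k h\<close>.\<close>
lemma schur_dual_kernel:
  assumes k: "dominated_kernel M1 M2 k p q" and k': "dominated_kernel M1 M2 k' p' q'"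
    and eq: "AE z in M1 \<Otimes>\<^sub>M M2. k' z = \<phi> z * k z"
  shows "schur_dual M1 M2 \<phi> (kernel_op M1 M2 k) (kernel_op M1 M2 k')"
  unfolding schur_dual_def
proof (intro conjI allI impI)
  show "kernel_op M1 M2 k' \<in> bounded_ops M1 M2" by (rule kernel_op_bounded[OF k'])
  fix f g f' g'
  assume fg: "nuclear_pair M1 M2 f g" and fg': "nuclear_pair M1 M2 f' g'"
    and h: "AE z in M1 \<Otimes>\<^sub>M M2. \<phi> z * tensor_fun f g z = tensor_fun f' g' z"
  have "(LINT z|(M1 \<Otimes>\<^sub>M M2). k' z * tensor_fun f g z) = (LINT z|(M1 \<Otimes>\<^sub>M M2). k z * tensor_fun f' g' z)"
  proof (rule integral_cong_AE)
    show "AE z in M1 \<Otimes>\<^sub>M M2. k' z * tensor_fun f g z = k z * tensor_fun f' g' z"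
      using eq h
    proof eventually_elim
      case (elim z)
      have "k' z * tensor_fun f g z = k z * (\<phi> z * tensor_fun f g z)" using elim(1) by simp
      then show ?case by (simp only: elim(2))
    qed
  qed (rule borel_measurable_integrable[OF kernel_pairing(2)[OF k' fg]]
        borel_measurable_integrable[OF kernel_pairing(2)[OF k fg']])+
  then show "pairing M1 M2 (kernel_op M1 M2 k') f g = pairing M1 M2 (kernel_op M1 M2 k) f' g'"
    by (simp add: kernel_pairing(1)[OF k' fg] kernel_pairing(1)[OF k fg'])
qed

lemma tensor_fun_cnj:
  assumes "nuclear_pair M1 M2 f g"
  shows "AE z in M1 \<Otimes>\<^sub>M M2. tensor_fun (\<lambda>i x. cnj (f i x)) (\<lambda>i y. cnj (g i y)) z = cnj (tensor_fun f g z)"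
  using nuclear_pair_square_summable[OF assms]
proof eventually_elim
  case (elim z)
  then have "summable (\<lambda>i. f i (fst z) * g i (snd z))" by (intro square_summable_product) auto
  from sums_unique[OF sums_cnj[THEN iffD2, OF summable_sums[OF this]]]
  show ?case by (simp add: tensor_fun_def case_prod_beta)
qed

text \<open>Let \<open>k = f0 \<otimes> g0\<close> with positive factors. The operators with kernels
  \<open>\<phi>\<^sup>2 k\<close> and \<open>\<phi> k\<close> coincide, so the difference \<open>d =
  \<phi>\<^sup>2 k - \<phi> k\<close> integrates to 0 against the predual. Since \<open>k\<close>
  belongs to the predual, so do \<open>\<phi> k\<close>, \<open>\<phi>\<^sup>2 k\<close> and their
  conjugates; testing with the conjugate of \<open>d\<close> gives \<open>\<integral> |d|\<^sup>2 =
  0\<close>.\<close>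
lemma idempotent_multiplier:
  assumes \<phi>: "schur_multiplier M1 M2 \<phi>"
    and idem: "\<And>T. T \<in> bounded_ops M1 M2 \<Longrightarrow>
      schur_map M1 M2 \<phi> (schur_map M1 M2 \<phi> T) = schur_map M1 M2 \<phi> T"
  shows "AE z in M1 \<Otimes>\<^sub>M M2. \<phi> z = 0 \<or> \<phi> z = 1"
proof -
  obtain u :: "'a \<Rightarrow> real" where u: "\<And>x. 0 < u x" "(\<lambda>x. complex_of_real (u x)) \<in> sq_integrable M1"
    using M1.positive_sq_integrable by blast
  obtain v :: "'b \<Rightarrow> real" where v: "\<And>y. 0 < v y" "(\<lambda>y. complex_of_real (v y)) \<in> sq_integrable M2"
    using M2.positive_sq_integrable by blast
  define f0 where "f0 x = complex_of_real (u x)" for x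
  define g0 where "g0 y = complex_of_real (v y)" for y
  have f0: "f0 \<in> sq_integrable M1" and g0: "g0 \<in> sq_integrable M2" using u v by (simp_all add: f0_def[abs_def] g0_def[abs_def])
  note [measurable] = sq_integrableD(1)[OF f0] sq_integrableD(1)[OF g0]
  obtain C where [measurable]: "\<phi> \<in> borel_measurable (M1 \<Otimes>\<^sub>M M2)" and C: "AE z in M1 \<Otimes>\<^sub>M M2. cmod (\<phi> z) \<le> C"
    using \<phi> by (auto simp: schur_multiplier_def Linf_def)
  \<comment> \<open>Domination of kernels is demanded everywhere, so \<open>\<phi>\<close> is truncated on a null set.\<close>
  define \<psi> where "\<psi> z = (if cmod (\<phi> z) \<le> C then \<phi> z else 0)" for z
  have [measurable]: "\<psi> \<in> borel_measurable (M1 \<Otimes>\<^sub>M M2)" unfolding \<psi>_def by measurable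
  have \<psi>: "AE z in M1 \<Otimes>\<^sub>M M2. \<psi> z = \<phi> z" using C by eventually_elim (simp add: \<psi>_def)
  have \<psi>C: "cmod (\<psi> z) \<le> \<bar>C\<bar>" for z
    by (auto simp: \<psi>_def intro: order_trans[OF _ abs_ge_self])
  define k where "k z = f0 (fst z) * g0 (snd z)" for z
  define k1 where "k1 z = \<psi> z * k z" for z
  define k2 where "k2 z = \<psi> z * k1 z" for z
  have [measurable]: "k \<in> borel_measurable (M1 \<Otimes>\<^sub>M M2)" unfolding k_def by measurable
  have [measurable]: "k1 \<in> borel_measurable (M1 \<Otimes>\<^sub>M M2)" "k2 \<in> borel_measurable (M1 \<Otimes>\<^sub>M M2)"
    unfolding k2_def k1_def by measurable
  have dk: "dominated_kernel M1 M2 k f0 g0"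
    using f0 g0 by (simp add: dominated_kernel_def k_def)
  have dom_mult: "dominated_kernel M1 M2 (\<lambda>z. \<psi> z * l z) (\<lambda>x. of_real \<bar>C\<bar> * p x) g0"
    if "dominated_kernel M1 M2 l p g0" for l p
  proof -
    have l: "l \<in> borel_measurable (M1 \<Otimes>\<^sub>M M2)" "p \<in> sq_integrable M1" "\<And>x y. cmod (l (x, y)) \<le> cmod (p x * g0 y)"
      using that by (auto simp: dominated_kernel_def)
    note [measurable] = l(1)
    have "cmod (\<psi> (x, y) * l (x, y)) \<le> cmod (of_real \<bar>C\<bar> * p x * g0 y)" for x y
      using mult_mono'[OF \<psi>C l(3) norm_ge_zero norm_ge_zero] by (simp add: norm_mult mult.assoc)
    then show ?thesis
      using sq_integrable_scale[OF l(2)] g0 by (simp add: dominated_kernel_def)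
  qed
  have dk1: "dominated_kernel M1 M2 k1 (\<lambda>x. of_real \<bar>C\<bar> * f0 x) g0"
    unfolding k1_def by (rule dom_mult[OF dk])
  have dk2: "dominated_kernel M1 M2 k2 (\<lambda>x. of_real \<bar>C\<bar> * (of_real \<bar>C\<bar> * f0 x)) g0"
    unfolding k2_def by (rule dom_mult[OF dk1])
  have "schur_map M1 M2 \<phi> (kernel_op M1 M2 k) = kernel_op M1 M2 k1"
    by (rule schur_map_eqI[OF \<phi> kernel_op_bounded[OF dk] schur_dual_kernel[OF dk dk1]])
       (use \<psi> in \<open>auto simp: k1_def\<close>)
  moreover have "schur_map M1 M2 \<phi> (kernel_op M1 M2 k1) = kernel_op M1 M2 k2"
    by (rule schur_map_eqI[OF \<phi> kernel_op_bounded[OF dk1] schur_dual_kernel[OF dk1 dk2]])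
       (use \<psi> in \<open>auto simp: k2_def\<close>)
  ultimately have op_eq: "kernel_op M1 M2 k2 = kernel_op M1 M2 k1"
    using idem[OF kernel_op_bounded[OF dk]] by simp
  have mult: "\<exists>f' g'. nuclear_pair M1 M2 f' g' \<and> (AE z in M1 \<Otimes>\<^sub>M M2. \<phi> z * tensor_fun f g z = tensor_fun f' g' z)"
    if "nuclear_pair M1 M2 f g" for f g
    using \<phi> that unfolding schur_multiplier_def by blast
  obtain f1 g1 where 1: "nuclear_pair M1 M2 f1 g1"
    "AE z in M1 \<Otimes>\<^sub>M M2. \<phi> z * tensor_fun (single_seq f0) (single_seq g0) z = tensor_fun f1 g1 z"
    using mult[OF nuclear_pair_single[OF f0 g0]] by blast
  obtain f2 g2 where 2: "nuclear_pair M1 M2 f2 g2"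
    "AE z in M1 \<Otimes>\<^sub>M M2. \<phi> z * tensor_fun f1 g1 z = tensor_fun f2 g2 z"
    using mult[OF 1(1)] by blast
  define t1 where "t1 = tensor_fun (\<lambda>i x. cnj (f1 i x)) (\<lambda>i y. cnj (g1 i y))"
  define t2 where "t2 = tensor_fun (\<lambda>i x. cnj (f2 i x)) (\<lambda>i y. cnj (g2 i y))"
  note n1 = nuclear_pair_cnj[OF 1(1)] and n2 = nuclear_pair_cnj[OF 2(1)]
  have i: "integrable (M1 \<Otimes>\<^sub>M M2) (\<lambda>z. k1 z * t1 z)" "integrable (M1 \<Otimes>\<^sub>M M2) (\<lambda>z. k1 z * t2 z)"
    "integrable (M1 \<Otimes>\<^sub>M M2) (\<lambda>z. k2 z * t1 z)" "integrable (M1 \<Otimes>\<^sub>M M2) (\<lambda>z. k2 z * t2 z)"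
    unfolding t1_def t2_def
    by (rule kernel_pairing(2)[OF dk1 n1] kernel_pairing(2)[OF dk1 n2]
        kernel_pairing(2)[OF dk2 n1] kernel_pairing(2)[OF dk2 n2])+
  have e1: "(LINT z|(M1 \<Otimes>\<^sub>M M2). k2 z * t1 z) = (LINT z|(M1 \<Otimes>\<^sub>M M2). k1 z * t1 z)"
    using kernel_pairing(1)[OF dk1 n1] kernel_pairing(1)[OF dk2 n1] op_eq by (simp add: t1_def)
  have e2: "(LINT z|(M1 \<Otimes>\<^sub>M M2). k2 z * t2 z) = (LINT z|(M1 \<Otimes>\<^sub>M M2). k1 z * t2 z)"
    using kernel_pairing(1)[OF dk1 n2] kernel_pairing(1)[OF dk2 n2] op_eq by (simp add: t2_def)
  define d where "d z = (k2 z * t2 z - k1 z * t2 z) - (k2 z * t1 z - k1 z * t1 z)" for z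
  have di: "integrable (M1 \<Otimes>\<^sub>M M2) d" unfolding d_def using i by simp
  have d0: "(LINT z|(M1 \<Otimes>\<^sub>M M2). d z) = 0" unfolding d_def using i e1 e2 by simp
  have dw: "AE z in M1 \<Otimes>\<^sub>M M2. d z = complex_of_real ((cmod (k2 z - k1 z))\<^sup>2)"
    using \<psi> 1(2) 2(2) tensor_fun_cnj[OF 1(1)] tensor_fun_cnj[OF 2(1)]
  proof eventually_elim
    case (elim z)
    have "tensor_fun f1 g1 z = k1 z"
      using elim(1,2) by (simp add: k1_def k_def tensor_fun_single case_prod_beta)
    moreover from this have "tensor_fun f2 g2 z = k2 z" using elim(1,3) by (simp add: k2_def)
    ultimately have "t1 z = cnj (k1 z)" "t2 z = cnj (k2 z)" using elim(4,5) by (simp_all add: t1_def t2_def)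
    then have "d z = (k2 z - k1 z) * cnj (k2 z - k1 z)" by (simp add: d_def algebra_simps)
    then show ?case by (simp only: complex_norm_square)
  qed
  have wi: "integrable (M1 \<Otimes>\<^sub>M M2) (\<lambda>z. (cmod (k2 z - k1 z))\<^sup>2)"
  proof -
    have "integrable (M1 \<Otimes>\<^sub>M M2) (\<lambda>z. complex_of_real ((cmod (k2 z - k1 z))\<^sup>2))"
      by (rule integrable_cong_AE_imp[OF di]) (use dw in auto)
    from integrable_Re[OF this] show ?thesis by simp
  qed
  have "(LINT z|(M1 \<Otimes>\<^sub>M M2). complex_of_real ((cmod (k2 z - k1 z))\<^sup>2)) = (LINT z|(M1 \<Otimes>\<^sub>M M2). d z)"
    using dw di by (intro integral_cong_AE) auto
  then have "(LINT z|(M1 \<Otimes>\<^sub>M M2). (cmod (k2 z - k1 z))\<^sup>2) = 0"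
    by (simp only: d0 integral_complex_of_real of_real_eq_0_iff)
  then have "AE z in M1 \<Otimes>\<^sub>M M2. (cmod (k2 z - k1 z))\<^sup>2 = 0"
    using integral_nonneg_eq_0_iff_AE[OF wi] by simp
  then show ?thesis
    using \<psi>
  proof eventually_elim
    case (elim z)
    have "k z \<noteq> 0" using u(1)[of "fst z"] v(1)[of "snd z"] by (simp add: k_def f0_def g0_def)
    moreover have "(\<phi> z * \<phi> z - \<phi> z) * k z = 0" using elim by (simp add: k2_def k1_def algebra_simps)
    ultimately have "\<phi> z * (\<phi> z - 1) = 0" by (simp add: algebra_simps)
    then show ?case by simp
  qed
qed

end

section \<open>Comparison of the bimodules with a common reflexive hull\<close>

lemma near_set_mono: "e \<le> e' \<Longrightarrow> near_set m F \<xi> e \<subseteq> near_set m F \<xi> e'"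
  by (auto simp: near_set_def)

lemma null_of_integral_square_zero:
  fixes u :: "'a \<Rightarrow> real"
  assumes u: "\<And>x. 0 < u x" "(\<lambda>x. complex_of_real (u x)) \<in> sq_integrable m" and A: "A \<in> sets m"
    and zero: "(LINT x|m. (indicator A x * complex_of_real (u x)) * (indicator A x * complex_of_real (u x))) = 0"
  shows "AE x in m. x \<notin> A"
proof -
  define a where "a x = indicator A x * complex_of_real (u x)" for x
  have a: "a \<in> sq_integrable m" unfolding a_def by (rule indicator_sq[OF A u(2)])
  have "a x * a x = complex_of_real ((cmod (a x))\<^sup>2)" for x
    using u(1)[of x] by (simp add: a_def indicator_def power2_eq_square)
  then have "(LINT x|m. complex_of_real ((cmod (a x))\<^sup>2)) = 0"
    using zero by (simp flip: a_def)
  then have "(LINT x|m. (cmod (a x))\<^sup>2) = 0"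
    by (simp only: integral_complex_of_real of_real_eq_0_iff)
  then have "AE x in m. (cmod (a x))\<^sup>2 = 0"
    using integral_nonneg_eq_0_iff_AE[OF sq_integrableD(2)[OF a]] by simp
  then show ?thesis
  proof eventually_elim
    case (elim x)
    then show ?case using u(1)[of x] by (auto simp: a_def indicator_def split: if_splits)
  qed
qed

context pair_sigma_finite
begin

text \<open>Normalising \<open>f\<^sub>i\<close> and \<open>g\<^sub>i\<close> by positive square
  integrable functions \<open>u\<close> and \<open>v\<close>, the contraction kills \<open>\<V>\<close>,
  and with it the reflexive hull, on each cell where \<open>h\<close> does not vanish. The rank one
  operator built from the restrictions of \<open>u\<close> and \<open>v\<close> to the cell belongs to
  the hull, and its value on the same restrictions is a product of two squared norms; so one side of the
  cell is null.\<close>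
lemma rect_pairing_zero_on_full_rectangle:
  assumes V: "masa_bimodule M1 M2 \<V>" and fg: "nuclear_pair M1 M2 f g"
    and ann: "\<And>S. S \<in> \<V> \<Longrightarrow> pairing M1 M2 S f g = 0"
    and T: "T \<in> bounded_ops M1 M2" and A: "A \<in> sets M1" and B: "B \<in> sets M2"
    and full: "\<And>a b. a \<in> sq_integrable M1 \<Longrightarrow> b \<in> sq_integrable M2 \<Longrightarrow>
      (\<And>x. x \<notin> A \<Longrightarrow> a x = 0) \<Longrightarrow> (\<And>y. y \<notin> B \<Longrightarrow> b y = 0) \<Longrightarrow>
      kernel_op M1 M2 (\<lambda>z. a (fst z) * b (snd z)) \<in> Ref M1 M2 \<V>"
  shows "rect_pairing M1 M2 T f g A B = 0"
proof -
  note nd = nuclear_pairD[OF fg]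
  have Vb: "\<V> \<subseteq> bounded_ops M1 M2" using V by (simp add: masa_bimodule_def op_subspace_def)
  obtain u :: "'a \<Rightarrow> real" where u: "\<And>x. 0 < u x" "(\<lambda>x. complex_of_real (u x)) \<in> sq_integrable M1"
    using M1.positive_sq_integrable by blast
  obtain v :: "'b \<Rightarrow> real" where v: "\<And>y. 0 < v y" "(\<lambda>y. complex_of_real (v y)) \<in> sq_integrable M2"
    using M2.positive_sq_integrable by blast
  define F where "F = (\<lambda>i x. f i x / complex_of_real (u x))"
  define G where "G = (\<lambda>i y. g i y / complex_of_real (v y))"
  note [measurable] = sq_integrableD(1)[OF nd(1)] sq_integrableD(1)[OF nd(2)] sq_integrableD(1)[OF u(2)] sq_integrableD(1)[OF v(2)]
  have [measurable]: "F i \<in> borel_measurable M1" "G i \<in> borel_measurable M2" for i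
    unfolding F_def G_def by measurable
  have u0: "complex_of_real (u x) \<noteq> 0" and v0: "complex_of_real (v y) \<noteq> 0" for x y
    using u(1)[of x] v(1)[of y] by auto
  obtain I :: "(nat \<times> nat \<times> nat) set" and \<xi> \<eta> e where cells:
    "\<And>i. i \<in> I \<Longrightarrow> square_summable (\<xi> i)" "\<And>i. i \<in> I \<Longrightarrow> square_summable (\<eta> i)" "\<And>i. i \<in> I \<Longrightarrow> 0 < e i"
    "\<And>i. i \<in> I \<Longrightarrow> e i * (ell2 (\<xi> i) + ell2 (\<eta> i) + e i) < cmod (\<Sum>j. \<xi> i j * \<eta> i j)"
    "\<And>x y. x \<in> space M1 \<Longrightarrow> y \<in> space M2 \<Longrightarrow> square_summable (\<lambda>j. F j x) \<Longrightarrow>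
       square_summable (\<lambda>j. G j y) \<Longrightarrow> (\<Sum>j. F j x * G j y) \<noteq> 0 \<Longrightarrow>
       \<exists>i\<in>I. x \<in> near_set M1 F (\<xi> i) (e i) \<and> y \<in> near_set M2 G (\<eta> i) (e i)"
    using nonvanishing_cells[of M1 M2 F G] by blast
  define \<alpha> where "\<alpha> i = near_set M1 F (\<xi> i) (e i) \<inter> A" for i
  define \<beta> where "\<beta> i = near_set M2 G (\<eta> i) (e i) \<inter> B" for i
  have \<alpha>: "\<alpha> i \<in> sets M1" and \<beta>: "\<beta> i \<in> sets M2" for i
    using A B by (auto simp: \<alpha>_def \<beta>_def)
  have null: "(AE x in M1. x \<notin> \<alpha> i) \<or> (AE y in M2. y \<notin> \<beta> i)" if i: "i \<in> I" for i
  proof -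
    define a where "a = (\<lambda>x. indicator (\<alpha> i) x * complex_of_real (u x))"
    define b where "b = (\<lambda>y. indicator (\<beta> i) y * complex_of_real (v y))"
    have a: "a \<in> sq_integrable M1" and b: "b \<in> sq_integrable M2"
      unfolding a_def b_def by (intro indicator_sq \<alpha> \<beta> u v)+
    have V0: "form M1 M2 S a b = 0" if S: "S \<in> \<V>" for S
    proof -
      have Sb: "S \<in> bounded_ops M1 M2" using S Vb by blast
      have ann': "pairing M1 M2 S (\<lambda>i x. c x * f i x) (\<lambda>i y. d y * g i y) = 0"
        if c: "c \<in> Linf M1" and d: "d \<in> Linf M2" for c d
      proof -
        have "mult_sandwich M1 M2 d S c \<in> \<V>" using V S c d by (simp add: masa_bimodule_def)
        from ann[OF this] show ?thesis by (simp add: pairing_mult_sandwich[OF Sb c d fg])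
      qed
      show ?thesis
        unfolding a_def b_def
        by (rule rectangle_contraction[OF Sb fg u(2) u0 v(2) v0 ann' cells(1,2,3,4)[OF i]
              Linf_indicator[OF \<alpha>] _ Linf_indicator[OF \<beta>]])
           (auto simp: \<alpha>_def \<beta>_def F_def G_def)
    qed
    define k where "k = (\<lambda>z. a (fst z) * b (snd z))"
    note [measurable] = sq_integrableD(1)[OF a] sq_integrableD(1)[OF b]
    have k: "dominated_kernel M1 M2 k a b"
      using a b by (simp add: dominated_kernel_def k_def)
    have R: "kernel_op M1 M2 k \<in> Ref M1 M2 \<V>"
      unfolding k_def by (rule full[OF a b]) (auto simp: a_def b_def \<alpha>_def \<beta>_def)
    have "0 = form M1 M2 (kernel_op M1 M2 k) a b"
      by (rule Ref_form_zero[OF R Vb a b V0, symmetric])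
    also have "\<dots> = (LINT z|(M1 \<Otimes>\<^sub>M M2). (a (fst z) * a (fst z)) * (b (snd z) * b (snd z)))"
      unfolding kernel_form(3)[OF k a b] by (simp add: k_def mult_ac)
    also have "\<dots> = (LINT x|M1. a x * a x) * (LINT y|M2. b y * b y)"
      by (rule integrable_times(2)[OF sq_integrable_product(1)[OF a a] sq_integrable_product(1)[OF b b]])
    finally have "(LINT x|M1. a x * a x) = 0 \<or> (LINT y|M2. b y * b y) = 0" by auto
    then show ?thesis
      unfolding a_def b_def
      using null_of_integral_square_zero[OF u \<alpha>] null_of_integral_square_zero[OF v \<beta>] by blast
  qed
  have ax: "AE x in M1. \<forall>i\<in>I. (AE x in M1. x \<notin> \<alpha> i) \<longrightarrow> x \<notin> \<alpha> i"
    by (subst AE_ball_countable) auto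
  have ay: "AE y in M2. \<forall>i\<in>I. (AE y in M2. y \<notin> \<beta> i) \<longrightarrow> y \<notin> \<beta> i"
    by (subst AE_ball_countable) auto
  have sx: "AE x in M1. square_summable (\<lambda>i. f i x)" and sy: "AE y in M2. square_summable (\<lambda>i. g i y)"
    using fg by (auto simp: nuclear_pair_def intro: square_summable_AE)
  have zero: "(\<Sum>i. (indicator A x * f i x) * (indicator B y * g i y)) = 0"
    if x: "x \<in> space M1" "square_summable (\<lambda>i. f i x)" "\<forall>i\<in>I. (AE x in M1. x \<notin> \<alpha> i) \<longrightarrow> x \<notin> \<alpha> i"
      and y: "y \<in> space M2" "square_summable (\<lambda>i. g i y)" "\<forall>i\<in>I. (AE y in M2. y \<notin> \<beta> i) \<longrightarrow> y \<notin> \<beta> i" for x y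
  proof (cases "x \<in> A \<and> y \<in> B")
    case True
    have F: "square_summable (\<lambda>i. F i x)"
      using square_summable_scale[OF x(2), of "1 / complex_of_real (u x)"] by (simp add: F_def)
    have G: "square_summable (\<lambda>i. G i y)"
      using square_summable_scale[OF y(2), of "1 / complex_of_real (v y)"] by (simp add: G_def)
    have FG0: "(\<Sum>i. F i x * G i y) = 0"
    proof (rule ccontr)
      assume "(\<Sum>i. F i x * G i y) \<noteq> 0"
      then obtain i where "i \<in> I" "x \<in> \<alpha> i" "y \<in> \<beta> i"
        using cells(5)[OF x(1) y(1) F G] True by (auto simp: \<alpha>_def \<beta>_def)
      then show False using null x(3) y(3) by blast
    qed
    have "(\<Sum>i. (indicator A x * f i x) * (indicator B y * g i y)) =
        (\<Sum>i. (complex_of_real (u x) * complex_of_real (v y)) * (F i x * G i y))"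
      using True u0[of x] v0[of y] by (simp add: F_def G_def)
    also have "\<dots> = (complex_of_real (u x) * complex_of_real (v y)) * (\<Sum>i. F i x * G i y)"
      by (rule suminf_mult[OF square_summable_product(2)[OF F G]])
    finally show ?thesis using FG0 by simp
  qed (auto simp: indicator_def)
  show ?thesis
    unfolding rect_pairing_def
  proof (rule pairing_zero_of_tensor_zero[OF T nuclear_pair_indicator[OF fg A B]])
    show "AE y in M2. AE x in M1. (\<Sum>i. (indicator A x * f i x) * (indicator B y * g i y)) = 0"
      using sy ay AE_space
    proof eventually_elim
      case (elim y)
      show ?case using sx ax AE_space by eventually_elim (rule zero; use elim in simp)
    qed
  qed
qed

text \<open>The product \<open>\<phi> (u \<otimes> v)\<close> lies in the predual; dividing it by
  \<open>u \<otimes> v\<close> gives \<open>\<phi> = \<Sum>i. F\<^sub>i \<otimes> G\<^sub>i\<close>. On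
  the points where \<open>F\<close> and \<open>G\<close> have norm below \<open>r\<close>, cells of
  radius \<open>1/(4(r+1))\<close> keep \<open>\<phi>\<close> within distance 1/2 of a constant and thus
  exclude one of its two values.\<close>
lemma pairing_zero_of_Ref_eq:
  assumes \<phi>: "schur_multiplier M1 M2 \<phi>"
    and idem: "\<And>T. T \<in> bounded_ops M1 M2 \<Longrightarrow>
      schur_map M1 M2 \<phi> (schur_map M1 M2 \<phi> T) = schur_map M1 M2 \<phi> T"
    and sub: "op_subspace M1 M2 (schur_map M1 M2 \<phi> ` bounded_ops M1 M2)"
    and V: "masa_bimodule M1 M2 \<V>"
    and Ref: "Ref M1 M2 (schur_map M1 M2 \<phi> ` bounded_ops M1 M2) = Ref M1 M2 \<V>"
    and T: "T \<in> Ref M1 M2 \<V>" and fg: "nuclear_pair M1 M2 f g"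
    and ann: "\<And>S. S \<in> \<V> \<Longrightarrow> pairing M1 M2 S f g = 0"
  shows "pairing M1 M2 T f g = 0"
proof -
  let ?U = "schur_map M1 M2 \<phi> ` bounded_ops M1 M2"
  note nd = nuclear_pairD[OF fg]
  have Ub: "?U \<subseteq> bounded_ops M1 M2" using sub by (simp add: op_subspace_def)
  have Tb: "T \<in> bounded_ops M1 M2" and TU: "T \<in> Ref M1 M2 ?U" using T Ref by (auto simp: Ref_def)
  have \<phi>01: "AE z in M1 \<Otimes>\<^sub>M M2. \<phi> z = 0 \<or> \<phi> z = 1" by (rule idempotent_multiplier[OF \<phi> idem])
  have empty_case: "rect_pairing M1 M2 T f g C D = 0"
    if C: "C \<in> sets M1" and D: "D \<in> sets M2" and z: "AE z in M1 \<Otimes>\<^sub>M M2. z \<in> C \<times> D \<longrightarrow> \<phi> z = 0" for C D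
  proof -
    have "form M1 M2 T (\<lambda>x. indicator C x * f i x) (\<lambda>y. indicator D y * g i y) = 0" for i
    proof (rule Ref_form_zero[OF TU Ub indicator_sq[OF C nd(1)] indicator_sq[OF D nd(2)]])
      fix S assume "S \<in> ?U"
      then show "form M1 M2 S (\<lambda>x. indicator C x * f i x) (\<lambda>y. indicator D y * g i y) = 0"
      proof (rule schur_range_form_zero[OF \<phi> sub _ indicator_sq[OF C nd(1)] indicator_sq[OF D nd(2)]])
        show "AE z in M1 \<Otimes>\<^sub>M M2. \<phi> z * (indicator C (fst z) * f i (fst z) * (indicator D (snd z) * g i (snd z))) = 0"
          using z by eventually_elim (auto simp: indicator_def mem_Times_iff)
      qed
    qed
    then show ?thesis
      using pairing_sums[OF Tb nuclear_pair_indicator[OF fg C D]]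
      unfolding rect_pairing_def by (simp add: sums_unique2[OF _ sums_zero])
  qed
  have full_case: "rect_pairing M1 M2 T f g C D = 0"
    if C: "C \<in> sets M1" and D: "D \<in> sets M2" and z: "AE z in M1 \<Otimes>\<^sub>M M2. z \<in> C \<times> D \<longrightarrow> \<phi> z = 1" for C D
  proof (rule rect_pairing_zero_on_full_rectangle[OF V fg ann Tb C D])
    fix a b assume a: "a \<in> sq_integrable M1" and b: "b \<in> sq_integrable M2"
      and supp: "\<And>x. x \<notin> C \<Longrightarrow> a x = 0" "\<And>y. y \<notin> D \<Longrightarrow> b y = 0"
    define k where "k = (\<lambda>z. a (fst z) * b (snd z))"
    note [measurable] = sq_integrableD(1)[OF a] sq_integrableD(1)[OF b]
    have k: "dominated_kernel M1 M2 k a b" using a b by (simp add: dominated_kernel_def k_def)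
    have "AE z in M1 \<Otimes>\<^sub>M M2. k z = \<phi> z * k z"
      using z by eventually_elim (use supp in \<open>auto simp: k_def mem_Times_iff\<close>)
    then have "schur_map M1 M2 \<phi> (kernel_op M1 M2 k) = kernel_op M1 M2 k"
      by (intro schur_map_eqI[OF \<phi> kernel_op_bounded[OF k]] schur_dual_kernel[OF k k])
    then have "kernel_op M1 M2 k \<in> ?U" using kernel_op_bounded[OF k] by (metis imageI)
    then show "kernel_op M1 M2 (\<lambda>z. a (fst z) * b (snd z)) \<in> Ref M1 M2 \<V>"
      using subset_Ref[OF Ub] Ref by (auto simp: k_def)
  qed
  obtain u :: "'a \<Rightarrow> real" where u: "\<And>x. 0 < u x" "(\<lambda>x. complex_of_real (u x)) \<in> sq_integrable M1"
    using M1.positive_sq_integrable by blast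
  obtain v :: "'b \<Rightarrow> real" where v: "\<And>y. 0 < v y" "(\<lambda>y. complex_of_real (v y)) \<in> sq_integrable M2"
    using M2.positive_sq_integrable by blast
  obtain f' g' where fg': "nuclear_pair M1 M2 f' g'"
    and eq: "AE z in M1 \<Otimes>\<^sub>M M2. \<phi> z * tensor_fun (single_seq (\<lambda>x. complex_of_real (u x)))
      (single_seq (\<lambda>y. complex_of_real (v y))) z = tensor_fun f' g' z"
    using \<phi> nuclear_pair_single[OF u(2) v(2)] unfolding schur_multiplier_def by blast
  note nd' = nuclear_pairD[OF fg']
  define F where "F = (\<lambda>i x. f' i x / complex_of_real (u x))"
  define G where "G = (\<lambda>i y. g' i y / complex_of_real (v y))"
  note [measurable] = sq_integrableD(1)[OF nd'(1)] sq_integrableD(1)[OF nd'(2)] sq_integrableD(1)[OF u(2)] sq_integrableD(1)[OF v(2)]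
  have [measurable]: "F i \<in> borel_measurable M1" "G i \<in> borel_measurable M2" for i
    unfolding F_def G_def by measurable
  have Fs: "square_summable (\<lambda>i. F i x)" if "square_summable (\<lambda>i. f' i x)" for x
    using square_summable_scale[OF that, of "1 / complex_of_real (u x)"] by (simp add: F_def)
  have Gs: "square_summable (\<lambda>i. G i y)" if "square_summable (\<lambda>i. g' i y)" for y
    using square_summable_scale[OF that, of "1 / complex_of_real (v y)"] by (simp add: G_def)
  have \<phi>FG: "AE z in M1 \<Otimes>\<^sub>M M2. \<phi> z = (\<Sum>i. F i (fst z) * G i (snd z))"
    using eq nuclear_pair_square_summable[OF fg']
  proof eventually_elim
    case (elim z)
    let ?w = "complex_of_real (u (fst z)) * complex_of_real (v (snd z))"
    have w: "?w \<noteq> 0" using u(1)[of "fst z"] v(1)[of "snd z"] by auto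
    have "\<phi> z * ?w = (\<Sum>i. f' i (fst z) * g' i (snd z))"
      using elim(1) unfolding tensor_fun_single by (simp add: tensor_fun_def case_prod_beta)
    also have "\<dots> = (\<Sum>i. (F i (fst z) * G i (snd z)) * ?w)"
      using w by (simp add: F_def G_def)
    also have "\<dots> = (\<Sum>i. F i (fst z) * G i (snd z)) * ?w"
      using elim(2) by (intro suminf_mult2[symmetric] square_summable_product Fs Gs) auto
    finally show ?case using w by simp
  qed
  obtain d :: "nat \<Rightarrow> nat \<Rightarrow> complex" where d: "\<And>k. square_summable (d k)"
    "\<And>c e. square_summable c \<Longrightarrow> 0 < e \<Longrightarrow> \<exists>k. ell2 (\<lambda>i. c i - d k i) < e"
    by (rule dense_sequence_ell2) blast
  define e where "e r = 1 / (4 * (real r + 1))" for r :: nat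
  define X where "X r = near_set M1 F (\<lambda>i. 0) (real r)" for r
  define Y where "Y r = near_set M2 G (\<lambda>i. 0) (real r)" for r
  have e: "0 < e r" "e r \<le> 1" for r by (auto simp: e_def field_simps)
  have X: "X r \<in> sets M1" and Y: "Y r \<in> sets M2" for r by (auto simp: X_def Y_def)
  have cell: "rect_pairing M1 M2 T f g C D = 0"
    if C: "C \<in> sets M1" "C \<subseteq> X r \<inter> near_set M1 F (d j) (e r)"
      and D: "D \<in> sets M2" "D \<subseteq> Y r \<inter> near_set M2 G (d k) (e r)" for C D r j k
  proof -
    define c where "c = (\<Sum>i. d j i * d k i)"
    have near: "cmod ((\<Sum>i. F i x * G i y) - c) < 1 / 2" if x: "x \<in> C" and y: "y \<in> D" for x y
    proof -
      have xX: "x \<in> X r" "x \<in> near_set M1 F (d j) (e r)" and yY: "y \<in> Y r" "y \<in> near_set M2 G (d k) (e r)"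
        using x y C D by auto
      note nx = near_setD[OF xX(2) d(1)] and ny = near_setD[OF yY(2) d(1)]
      have b: "ell2 (\<lambda>i. F i x) \<le> real r" "ell2 (\<lambda>i. G i y) \<le> real r"
        using xX(1) yY(1) by (auto simp: X_def Y_def near_set_def)
      have "cmod ((\<Sum>i. F i x * G i y) - c) \<le> e r * ell2 (\<lambda>i. G i y) + ell2 (d j) * e r"
        unfolding c_def by (rule suminf_product_diff[OF nx(2) ny(2) d(1) d(1) nx(4) ny(4)])
      also have "\<dots> \<le> e r * real r + (real r + 1) * e r"
        using b nx(6) e[of r] by (intro add_mono mult_left_mono mult_right_mono) auto
      also have "\<dots> < 1 / 2"
      proof -
        have "e r * (real r + 1) = 1 / 4" by (simp add: e_def field_simps)
        then show ?thesis using e(1)[of r] by (simp add: algebra_simps)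
      qed
      finally show ?thesis .
    qed
    have c\<phi>: "AE z in M1 \<Otimes>\<^sub>M M2. z \<in> C \<times> D \<longrightarrow> cmod (\<phi> z - c) < 1 / 2"
      using \<phi>FG by eventually_elim (use near in auto)
    show ?thesis
    proof (cases "cmod (1 - c) < 1 / 2")
      case True
      then have c0: "\<not> cmod (0 - c) < 1 / 2"
        using norm_triangle_ineq[of "1 - c" c] by auto
      have "AE z in M1 \<Otimes>\<^sub>M M2. z \<in> C \<times> D \<longrightarrow> \<phi> z = 1"
        using c\<phi> \<phi>01 by eventually_elim (use c0 in auto)
      then show ?thesis by (rule full_case[OF C(1) D(1)])
    next
      case False
      have "AE z in M1 \<Otimes>\<^sub>M M2. z \<in> C \<times> D \<longrightarrow> \<phi> z = 0"
        using c\<phi> \<phi>01 by eventually_elim (use False in auto)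
      then show ?thesis by (rule empty_case[OF C(1) D(1)])
    qed
  qed
  have block: "rect_pairing M1 M2 T f g C D = 0"
    if C: "C \<in> sets M1" "C \<subseteq> X r" and D: "D \<in> sets M2" "D \<subseteq> Y r" for C D r
  proof (rule rect_pairing_zero_cover[OF Tb fg, where A = "\<lambda>j. X r \<inter> near_set M1 F (d j) (e r)"
        and B = "\<lambda>k. Y r \<inter> near_set M2 G (d k) (e r)"])
    show "C \<subseteq> (\<Union>j. X r \<inter> near_set M1 F (d j) (e r))"
    proof
      fix x assume "x \<in> C"
      then have x: "x \<in> X r" "x \<in> space M1" "square_summable (\<lambda>i. F i x)" using C by (auto simp: X_def near_set_def)
      then obtain j where "ell2 (\<lambda>i. F i x - d j i) < e r" using d(2) e(1) by blast
      then show "x \<in> (\<Union>j. X r \<inter> near_set M1 F (d j) (e r))" using x by (auto simp: near_set_def)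
    qed
    show "D \<subseteq> (\<Union>k. Y r \<inter> near_set M2 G (d k) (e r))"
    proof
      fix y assume "y \<in> D"
      then have y: "y \<in> Y r" "y \<in> space M2" "square_summable (\<lambda>i. G i y)" using D by (auto simp: Y_def near_set_def)
      then obtain k where "ell2 (\<lambda>i. G i y - d k i) < e r" using d(2) e(1) by blast
      then show "y \<in> (\<Union>k. Y r \<inter> near_set M2 G (d k) (e r))" using y by (auto simp: near_set_def)
    qed
  qed (use C D X Y cell in auto)
  have all: "rect_pairing M1 M2 T f g (\<Union>r. X r) (\<Union>r. Y r) = 0"
  proof (rule rect_pairing_zero_cover[OF Tb fg X Y])
    fix j k C D assume C: "C \<in> sets M1" "C \<subseteq> X j" and D: "D \<in> sets M2" "D \<subseteq> Y k"
    have "X j \<subseteq> X (max j k)" "Y k \<subseteq> Y (max j k)"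
      unfolding X_def Y_def by (intro near_set_mono; simp)+
    then show "rect_pairing M1 M2 T f g C D = 0"
      using C D by (intro block[of C "max j k" D]) auto
  qed (use X Y in auto)
  have "AE x in M1. square_summable (\<lambda>i. f' i x)" "AE y in M2. square_summable (\<lambda>i. g' i y)"
    using fg' by (auto simp: nuclear_pair_def intro: square_summable_AE)
  then have full: "AE x in M1. x \<in> (\<Union>r. X r)" "AE y in M2. y \<in> (\<Union>r. Y r)"
  proof -
    have *: "x \<in> (\<Union>r. near_set M H (\<lambda>i. 0) (real r))"
      if "square_summable (\<lambda>i. H i x)" "x \<in> space M" for M :: "'c measure" and H x
      using that reals_Archimedean2[of "ell2 (\<lambda>i. H i x)"] by (auto simp: near_set_def)
    assume f': "AE x in M1. square_summable (\<lambda>i. f' i x)" and g': "AE y in M2. square_summable (\<lambda>i. g' i y)"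
    show "AE x in M1. x \<in> (\<Union>r. X r)"
      using f' AE_space unfolding X_def by eventually_elim (intro * Fs)
    show "AE y in M2. y \<in> (\<Union>r. Y r)"
      using g' AE_space unfolding Y_def by eventually_elim (intro * Gs)
  qed
  have XY: "(\<Union>r. X r) \<in> sets M1" "(\<Union>r. Y r) \<in> sets M2" using X Y by auto
  have "form M1 M2 T (f i) (g i) =
      form M1 M2 T (\<lambda>x. indicator (\<Union>r. X r) x * f i x) (\<lambda>y. indicator (\<Union>r. Y r) y * g i y)" for i
  proof (rule form_cong[OF _ _ Tb nd(1) nd(2) indicator_sq[OF XY(2) nd(2)]])
    show "AE x in M1. f i x = indicator (\<Union>r. X r) x * f i x"
      using full(1) by eventually_elim (simp only: indicator_simps mult_1)
    show "AE y in M2. g i y = indicator (\<Union>r. Y r) y * g i y"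
      using full(2) by eventually_elim (simp only: indicator_simps mult_1)
  qed
  then have "pairing M1 M2 T f g = rect_pairing M1 M2 T f g (\<Union>r. X r) (\<Union>r. Y r)"
    unfolding rect_pairing_def
    by (simp add: pairing_eq_form[OF Tb nd(1,2)] pairing_eq_form[OF Tb indicator_sq[OF XY(1) nd(1)] indicator_sq[OF XY(2) nd(2)]])
  with all show ?thesis by simp
qed

end

theorem mainTheorem6:
  fixes m :: "'a measure" and n :: "'b measure"
    and \<U> :: "('a, 'b) l2_op set" and \<kappa> :: "('a \<times> 'b) set"
  assumes "standard_measure_space m" and "standard_measure_space n"
    and "masa_bimodule m n \<U>" and "schur_injective m n \<U>"
    and "is_support m n \<U> \<kappa>"
  shows "operator_synthetic m n \<kappa>"
proof -
  interpret pair_sigma_finite m n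
    using assms(1,2) by (simp add: pair_sigma_finite_def standard_measure_space_def)
  obtain \<phi> where \<phi>: "schur_multiplier m n \<phi>" and U: "\<U> = schur_map m n \<phi> ` bounded_ops m n"
    and idem: "\<And>T. T \<in> bounded_ops m n \<Longrightarrow> schur_map m n \<phi> (schur_map m n \<phi> T) = schur_map m n \<phi> T"
    using assms(4) unfolding schur_injective_def schur_idempotents_def by blast
  have sub: "op_subspace m n (schur_map m n \<phi> ` bounded_ops m n)"
    using assms(3) by (simp add: masa_bimodule_def U)
  have closed: "omega_closed m n \<kappa>" and RefU: "Ref m n \<U> = M_max m n \<kappa>"
    using assms(5) by (auto simp: is_support_def)
  have "M_min m n \<kappa> = M_max m n \<kappa>"
    unfolding M_min_def
  proof (rule Least_equality)
    show "masa_bimodule m n (M_max m n \<kappa>) \<and> closedin (weak_star_topology m n) (M_max m n \<kappa>) \<and>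
        is_support m n (M_max m n \<kappa>) \<kappa>"
      by (simp add: masa_bimodule_M_max closedin_M_max is_support_def closed Ref_M_max)
    fix \<V> assume V: "masa_bimodule m n \<V> \<and> closedin (weak_star_topology m n) \<V> \<and> is_support m n \<V> \<kappa>"
    then have RefV: "Ref m n \<V> = M_max m n \<kappa>" and V': "masa_bimodule m n \<V>" "op_subspace m n \<V>"
      by (auto simp: is_support_def masa_bimodule_def)
    show "M_max m n \<kappa> \<le> \<V>"
    proof
      fix T assume T: "T \<in> M_max m n \<kappa>"
      show "T \<in> \<V>"
      proof (rule weak_star_closed_subspace_mem[OF V'(2)])
        show "T \<in> bounded_ops m n" using T by (simp add: M_max_def)
        show "pairing m n T f g = 0" if "nuclear_pair m n f g" "\<And>S. S \<in> \<V> \<Longrightarrow> pairing m n S f g = 0" for f g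
          by (rule pairing_zero_of_Ref_eq[OF \<phi> idem sub V'(1) _ _ that]) (use RefU RefV T U in auto)
      qed (use V in simp)
    qed
  qed
  then show ?thesis using closed by (simp add: operator_synthetic_def)
qed

end
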